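(* Let $E$ be a real Hilbert space and define $G^2(E)$ relative to a tensor norm $\|\cdot\|_\otimes$ on $E\otimes_aE$ which satisfies $\|x\otimes y\|_\otimes\le\|x\|\,\|y\|$ and $\|x\otimes y\|_\otimes=\|y\otimes x\|_\otimes$ for all $x,y\in E$, and which is bounded from below by the injective tensor norm $\|\cdot\|_{\mathrm{Sch}^\infty}$. If we define $G^2_{cc}(E):=\exp(E\oplus\mathfrak{so}_{cc}(E))$, then $$G^2_{cc}(E)=\{\mathbf{x}\in G^2(E):\rho(0,\mathbf{x})<\infty\}.$$ Furthermore, the metric space $(G^2_{cc}(E),\rho)$ is a complete, geodesic space, and if we define $$|\!|\!|x+x^{(2)}|\!|\!|=\max\left\{\|x\|_E,\sqrt{\pi}\,\|x^{(2)}\|_{cc}^{1/2}\right\},$$ then $$|\!|\!|\mathbf{x}|\!|\!|\le\rho(0,\mathbf{x})\le3\,|\!|\!|\mathbf{x}|\!|\!|\qquad\text{for every }\mathbf{x}\in G^2_{cc}(E).$$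
   Context: Operators: $E\otimes_aE$ is identified with the finite rank operators on $E$, and $E\otimes E$ with the closure of the finite rank operators with respect to $\|\cdot\|_\otimes$; the injective tensor norm is the operator norm. For $X,Y\in E$, $X\wedge Y=X\otimes Y-Y\otimes X$ is identified with the skew-symmetric operator $X^*\otimes Y-Y^*\otimes X$, where $X^*=\langle X,\cdot\rangle$. $\mathfrak{so}_\otimes(E)$ is the set of skew-symmetric operators on $E$ in the $\|\cdot\|_\otimes$-closure of the finite rank skew-symmetric operators. For a compact skew-symmetric operator $\mathbb{X}$, $\sigma(\mathbb{X})=(\sigma_j)_{j\ge1}$ is the sequence such that $|\mathbb{X}|=\sqrt{-\mathbb{X}^2}$ has eigenvalues, in non-increasing order, $\sigma_1=\sigma_1\ge\sigma_2=\sigma_2\ge\cdots$ (each repeated twice, followed by zeros if necessary). Put $\|\mathbb{X}\|_{cc}=\sum_{j\ge1}j\sigma_j\in[0,\infty]$, and let $\mathfrak{so}_{cc}(E)$ be the set of compact skew-symmetric operators with $\|\mathbb{X}\|_{cc}<\infty$ (one has $\mathfrak{so}_{cc}(E)\subseteq\mathfrak{so}_\otimes(E)$). Group in exponential coordinates: the exponential map is a diffeomorphism used to identify $G^2(E)$ with the Lie algebra $\mathfrak{g}(E)=E\oplus\mathfrak{so}_\otimes(E)$, with group operation $(x+x^{(2)})\cdot(y+y^{(2)})=x+y+x^{(2)}+y^{(2)}+\frac12x\wedge y$ and identity $0$. Thus $G^2_{cc}(E)$ is the subset $E\oplus\mathfrak{so}_{cc}(E)$. Carnot–Carathéodory distance: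 for $u\in L^1([0,1],E)$ let $\mathbf{\Gamma}_u$ solve $\mathbf{\Gamma}_u(t)^{-1}\cdot\dot{\mathbf{\Gamma}}_u(t)=u(t)$, $\mathbf{\Gamma}_u(0)=0$; that is, $\mathbf{\Gamma}_u=\gamma+\gamma^{(2)}$ with $\gamma(t)=\int_0^tu(s)\,ds$ and $\gamma^{(2)}(t)=\frac12\int_0^t\gamma(s)\wedge u(s)\,ds$. Then $\rho(0,\mathbf{x})=\inf\{\|u\|_{L^1}:u\in L^1([0,1],E),\ \mathbf{\Gamma}_u(1)=\mathbf{x}\}\in[0,\infty]$ and $\rho(\mathbf{x},\mathbf{y})=\rho(0,\mathbf{x}^{-1}\cdot\mathbf{y})$. A metric space $(M,\rho)$ is geodesic if any two points are joined by a curve $\gamma:[0,1]\to M$ with $\mathrm{Length}(\gamma|_{[s,t]})=\rho(\gamma(s),\gamma(t))=|t-s|\rho(\gamma(0),\gamma(1))$ for all $0\le s\le t\le1$. *)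

theory Defs
  imports "HOL-Analysis.Analysis"
begin

text \<open>
  Throughout, the real Hilbert space \<open>E\<close> is a type \<open>'a :: {real_inner, banach}\<close>, of arbitrary
  dimension and not assumed separable.
\<close>

section \<open>Operators and tensor norms\<close>

text \<open>The elementary tensor \<open>x \<otimes> y\<close> is the rank one operator \<open>v \<mapsto> \<langle>x, v\<rangle> y\<close>.\<close>

definition tensor :: "'a::{real_inner,banach} \<Rightarrow> 'a \<Rightarrow> 'a \<Rightarrow>\<^sub>L 'a" where
  "tensor x y = Blinfun (\<lambda>v. (x \<bullet> v) *\<^sub>R y)"

lemma tensor_apply: "blinfun_apply (tensor x y) v = (x \<bullet> v) *\<^sub>R y"
  unfolding tensor_def
  by (subst bounded_linear_Blinfun_apply)
     (auto intro!: bounded_linear_intros)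

definition wedge :: "'a::{real_inner,banach} \<Rightarrow> 'a \<Rightarrow> 'a \<Rightarrow>\<^sub>L 'a" where
  "wedge x y = tensor x y - tensor y x"

definition finite_rank :: "('a::{real_inner,banach} \<Rightarrow>\<^sub>L 'a) \<Rightarrow> bool" where
  "finite_rank T \<longleftrightarrow> (\<exists>B. finite B \<and> range (blinfun_apply T) \<subseteq> span B)"

definition skew :: "('a::{real_inner,banach} \<Rightarrow>\<^sub>L 'a) \<Rightarrow> bool" where
  "skew T \<longleftrightarrow> (\<forall>x y. blinfun_apply T x \<bullet> y = - (x \<bullet> blinfun_apply T y))"

definition compact_op :: "('a::{real_inner,banach} \<Rightarrow>\<^sub>L 'a) \<Rightarrow> bool" where
  "compact_op T \<longleftrightarrow> compact (closure (blinfun_apply T ` cball 0 1))"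

text \<open>
  A norm on the algebraic tensor product of \<open>E\<close> with itself, i.e. on the space of finite rank
  operators; the values of \<open>N\<close> elsewhere are irrelevant.
\<close>

definition norm_on_finite_rank :: "(('a::{real_inner,banach} \<Rightarrow>\<^sub>L 'a) \<Rightarrow> real) \<Rightarrow> bool" where
  "norm_on_finite_rank N \<longleftrightarrow>
     (\<forall>T. finite_rank T \<longrightarrow> 0 \<le> N T \<and> (N T = 0 \<longleftrightarrow> T = 0)) \<and>
     (\<forall>c T. finite_rank T \<longrightarrow> N (c *\<^sub>R T) = \<bar>c\<bar> * N T) \<and>
     (\<forall>S T. finite_rank S \<longrightarrow> finite_rank T \<longrightarrow> N (S + T) \<le> N S + N T)"

text \<open>
  The closure, inside the operators, of a set \<open>S\<close> of finite rank operators with respect to \<open>N\<close>.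
  Since \<open>N\<close> dominates the operator norm, an \<open>N\<close>-Cauchy sequence has an operator norm limit, and
  this limit is the operator with which the sequence's limit in the completion is identified.
\<close>

definition tensor_closure ::
  "(('a::{real_inner,banach} \<Rightarrow>\<^sub>L 'a) \<Rightarrow> real) \<Rightarrow> ('a \<Rightarrow>\<^sub>L 'a) set \<Rightarrow> ('a \<Rightarrow>\<^sub>L 'a) set" where
  "tensor_closure N S =
     {T. \<exists>X. (\<forall>n::nat. X n \<in> S) \<and>
             (\<forall>e>0. \<exists>k. \<forall>m\<ge>k. \<forall>n\<ge>k. N (X m - X n) < e) \<and>
             X \<longlonglongrightarrow> T}"

definition so_tensor :: "(('a::{real_inner,banach} \<Rightarrow>\<^sub>L 'a) \<Rightarrow> real) \<Rightarrow> ('a \<Rightarrow>\<^sub>L 'a) set" where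
  "so_tensor N = {T. skew T \<and> T \<in> tensor_closure N {F. finite_rank F \<and> skew F}}"


section \<open>Singular values and the cc-norm\<close>

definition positive_op :: "('a::{real_inner,banach} \<Rightarrow>\<^sub>L 'a) \<Rightarrow> bool" where
  "positive_op P \<longleftrightarrow>
     (\<forall>x y. blinfun_apply P x \<bullet> y = x \<bullet> blinfun_apply P y) \<and>
     (\<forall>x. 0 \<le> blinfun_apply P x \<bullet> x)"

text \<open>\<open>|X|\<close> for skew-symmetric \<open>X\<close>: the positive square root of \<open>- X\<^sup>2\<close>.\<close>

definition abs_op :: "('a::{real_inner,banach} \<Rightarrow>\<^sub>L 'a) \<Rightarrow> 'a \<Rightarrow>\<^sub>L 'a" where
  "abs_op X = (THE P. positive_op P \<and> P o\<^sub>L P = - (X o\<^sub>L X))"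

text \<open>
  \<open>l\<close> lists the positive eigenvalues of the compact positive operator \<open>P\<close> in non-increasing order
  with multiplicity, followed by zeros if there are only finitely many.  Finiteness of the level
  sets has to be demanded separately because \<open>card\<close> is \<open>0\<close> on infinite sets.
\<close>

definition eigenvalue_seq :: "('a::{real_inner,banach} \<Rightarrow>\<^sub>L 'a) \<Rightarrow> (nat \<Rightarrow> real) \<Rightarrow> bool" where
  "eigenvalue_seq P l \<longleftrightarrow>
     antimono l \<and> (\<forall>n. 0 \<le> l n) \<and>
     (\<forall>\<mu>>0. finite {n. l n = \<mu>} \<and>
            card {n. l n = \<mu>} = dim {v. blinfun_apply P v = \<mu> *\<^sub>R v})"

text \<open>Indexed from \<open>0\<close>, i.e. \<open>sing_val X j\<close> is the \<open>j+1\<close>-st term of \<open>\<sigma>(X)\<close>.\<close>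

definition sing_val :: "('a::{real_inner,banach} \<Rightarrow>\<^sub>L 'a) \<Rightarrow> nat \<Rightarrow> real" where
  "sing_val X = (THE s. eigenvalue_seq (abs_op X) (\<lambda>n. s (n div 2)))"

definition cc_norm :: "('a::{real_inner,banach} \<Rightarrow>\<^sub>L 'a) \<Rightarrow> ennreal" where
  "cc_norm X = (\<Sum>j. ennreal (real (Suc j) * sing_val X j))"

definition so_cc :: "('a::{real_inner,banach} \<Rightarrow>\<^sub>L 'a) set" where
  "so_cc = {X. compact_op X \<and> skew X \<and> cc_norm X < \<infinity>}"


section \<open>The group in exponential coordinates\<close>

text \<open>
  The pair \<open>(x, X)\<close> stands for the group element \<open>exp (x + X)\<close>; the identity is \<open>0\<close>.
\<close>

definition G2 :: "(('a::{real_inner,banach} \<Rightarrow>\<^sub>L 'a) \<Rightarrow> real) \<Rightarrow> ('a \<times> ('a \<Rightarrow>\<^sub>L 'a)) set" where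
  "G2 N = UNIV \<times> so_tensor N"

definition G2cc :: "('a::{real_inner,banach} \<times> ('a \<Rightarrow>\<^sub>L 'a)) set" where
  "G2cc = UNIV \<times> so_cc"

definition g2_mult ::
  "'a::{real_inner,banach} \<times> ('a \<Rightarrow>\<^sub>L 'a) \<Rightarrow> 'a \<times> ('a \<Rightarrow>\<^sub>L 'a) \<Rightarrow> 'a \<times> ('a \<Rightarrow>\<^sub>L 'a)" where
  "g2_mult x y = (fst x + fst y, snd x + snd y + (1/2) *\<^sub>R wedge (fst x) (fst y))"

definition g2_inv :: "'a::{real_inner,banach} \<times> ('a \<Rightarrow>\<^sub>L 'a) \<Rightarrow> 'a \<times> ('a \<Rightarrow>\<^sub>L 'a)" where
  "g2_inv x = - x"

lemma g2_inv_left: "g2_mult (g2_inv x) x = 0"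
  and g2_inv_right: "g2_mult x (g2_inv x) = 0"
  by (auto simp: g2_mult_def g2_inv_def wedge_def zero_prod_def
        intro!: blinfun_eqI simp: tensor_apply blinfun.diff_left blinfun.scaleR_left)


section \<open>The Carnot--Caratheodory distance\<close>

text \<open>
  The library's Bochner integral is restricted to second countable spaces, so \<open>L\<^sup>1([0,1],E)\<close>
  is spelled out: strongly measurable functions with integrable norm.  On such functions (and
  on \<open>\<gamma> \<and> u\<close> below, which is of the same kind) the Henstock--Kurzweil integral \<open>integral\<close>,
  available in every Banach space, exists and is the Bochner integral.
\<close>

definition strongly_measurable :: "'b measure \<Rightarrow> ('b \<Rightarrow> 'c::real_normed_vector) \<Rightarrow> bool" where
  "strongly_measurable M f \<longleftrightarrow>
     (\<exists>s. (\<forall>i::nat. simple_function M (s i)) \<and> (AE t in M. (\<lambda>i. s i t) \<longlonglongrightarrow> f t))"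

definition L1 :: "(real \<Rightarrow> 'a::{real_inner,banach}) set" where
  "L1 = {u. strongly_measurable (lebesgue_on {0..1}) u \<and>
            integrable (lebesgue_on {0..1}) (\<lambda>t. norm (u t))}"

definition L1_norm :: "(real \<Rightarrow> 'a::{real_inner,banach}) \<Rightarrow> real" where
  "L1_norm u = (LINT t|lebesgue_on {0..1}. norm (u t))"

text \<open>
  \<open>Gamma u = \<gamma> + \<gamma>\<^sup>(\<^sup>2\<^sup>)\<close> is the horizontal curve with left logarithmic derivative \<open>u\<close>.  The
  operator-valued integral may be taken in the operator norm: as the tensor norm dominates it, an
  integral in the tensor norm completion has the same value.
\<close>

definition Gamma1 :: "(real \<Rightarrow> 'a::{real_inner,banach}) \<Rightarrow> real \<Rightarrow> 'a" where
  "Gamma1 u t = integral {0..t} u"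

definition Gamma2 :: "(real \<Rightarrow> 'a::{real_inner,banach}) \<Rightarrow> real \<Rightarrow> 'a \<Rightarrow>\<^sub>L 'a" where
  "Gamma2 u t = (1/2) *\<^sub>R integral {0..t} (\<lambda>s. wedge (Gamma1 u s) (u s))"

definition Gamma :: "(real \<Rightarrow> 'a::{real_inner,banach}) \<Rightarrow> real \<Rightarrow> 'a \<times> ('a \<Rightarrow>\<^sub>L 'a)" where
  "Gamma u t = (Gamma1 u t, Gamma2 u t)"

definition cc_dist0 :: "'a::{real_inner,banach} \<times> ('a \<Rightarrow>\<^sub>L 'a) \<Rightarrow> ennreal" where
  "cc_dist0 x = (INF u \<in> {u \<in> L1. Gamma u 1 = x}. ennreal (L1_norm u))"

definition cc_dist ::
  "'a::{real_inner,banach} \<times> ('a \<Rightarrow>\<^sub>L 'a) \<Rightarrow> 'a \<times> ('a \<Rightarrow>\<^sub>L 'a) \<Rightarrow> ennreal" where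
  "cc_dist x y = cc_dist0 (g2_mult (g2_inv x) y)"

text \<open>The distance as a real number; meaningful only where \<open>cc_dist\<close> is finite.\<close>

definition cc_metric ::
  "'a::{real_inner,banach} \<times> ('a \<Rightarrow>\<^sub>L 'a) \<Rightarrow> 'a \<times> ('a \<Rightarrow>\<^sub>L 'a) \<Rightarrow> real" where
  "cc_metric x y = enn2real (cc_dist x y)"

text \<open>The homogeneous norm; meaningful on \<open>G2cc\<close>, where \<open>cc_norm\<close> is finite.\<close>

definition hom_norm :: "'a::{real_inner,banach} \<times> ('a \<Rightarrow>\<^sub>L 'a) \<Rightarrow> real" where
  "hom_norm x = max (norm (fst x)) (sqrt pi * sqrt (enn2real (cc_norm (snd x))))"


section \<open>Geodesic spaces\<close>

definition curve_length :: "('m \<Rightarrow> 'm \<Rightarrow> real) \<Rightarrow> (real \<Rightarrow> 'm) \<Rightarrow> real \<Rightarrow> real \<Rightarrow> ennreal" where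
  "curve_length d g a b =
     (SUP (n, p) \<in> {(n::nat, p). mono_on {..n} p \<and> p 0 = a \<and> p n = b}.
        ennreal (\<Sum>i<n. d (g (p i)) (g (p (Suc i)))))"

definition geodesic_space :: "'m set \<Rightarrow> ('m \<Rightarrow> 'm \<Rightarrow> real) \<Rightarrow> bool" where
  "geodesic_space M d \<longleftrightarrow>
     (\<forall>x\<in>M. \<forall>y\<in>M. \<exists>g.
        continuous_map (top_of_set {0..1}) (Metric_space.mtopology M d) g \<and>
        g 0 = x \<and> g 1 = y \<and>
        (\<forall>s t. 0 \<le> s \<and> s \<le> t \<and> t \<le> 1 \<longrightarrow>
           curve_length d g s t = ennreal (d (g s) (g t)) \<and>
           d (g s) (g t) = \<bar>t - s\<bar> * d (g 0) (g 1)))"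

end

theory Submission
  imports Defs
begin

text \<open>
  The theorem compares two descriptions of a point \<open>x + X\<close>: by the length of the controls that
  reach it, and by the singular values of its area \<open>X\<close>.  Both are related through one notion
  that avoids controls, the curves \<open>g\<close> with \<open>g 0 = 0\<close> whose increments \<open>g(s)\<^sup>-\<^sup>1 \<cdot> g(t)\<close> are of
  size \<open>L (t - s)\<close> in \<open>E\<close> and of size \<open>(L (t - s))\<^sup>2\<close> in the area component (\<open>horizontal\<close>).

  Parametrised by arc length, the curve generated by a control of norm
  \<open>L\<close> is horizontal with constant \<open>L\<close> (\<open>control_imp_horizontal\<close>).  Conversely, a horizontal curve
  determines a control (\<open>horizontal_imp_control\<close>): the dyadic difference quotients of its first
  component are a martingale bounded in \<open>L\<^sup>2\<close> and hence converge almost everywhere, and the areas of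
  inscribed polygons determine the second component (\<open>horizontal_polygon\<close>).  Horizontality is a
  family of bounds on increments, and group operations respect weak limits, so the bound survives
  pointwise weak limits, which exist by Tychonoff's theorem (\<open>horizontal_limit\<close>).  It follows that
  \<open>\<rho>(0,x) \<le> L\<close> holds exactly if a horizontal curve with constant \<open>L\<close> ends in \<open>x\<close>: the infimum is
  attained, and \<open>\<rho>(0,\<cdot>)\<close> is lower semicontinuous.  Attainment yields geodesics;
  semicontinuity, with the completeness of \<open>E\<close> and of the space of operators, yields completeness.

  For the lower bound, a compact skew-symmetric operator is \<open>X = \<Sum>j. \<sigma> j *\<^sub>R (e j \<and> f j)\<close> with an
  orthonormal frame (\<open>skew_normal_form_exists\<close>), and \<open>\<sigma>\<close> is its sequence of singular values
  (\<open>sing_val_eq\<close>).  The area of a polygon with \<open>2 K\<close> edges of length at most \<open>L / (2 K)\<close> is, in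
  antiperiodic discrete Fourier modes, \<open>\<Sum>k<K. a k \<and> b k\<close>, where \<open>\<parallel>a k\<parallel> \<parallel>b k\<parallel>\<close> is at most
  \<open>E k / (\<pi> (2 k + 1))\<close> and the total energy \<open>\<Sum>k. E k\<close> is at most \<open>L\<^sup>2 / 2\<close>.  A Ky Fan
  inequality (\<open>tail_le\<close>) bounds each tail of \<open>\<sigma>\<close> by the corresponding tail of
  \<open>\<parallel>a k\<parallel> \<parallel>b k\<parallel>\<close>.  Summing over all tails produces the weights \<open>j\<close> on the left and
  compensates the denominators on the right, which gives \<open>\<pi> \<Sum>j. j \<sigma> j \<le> L\<^sup>2\<close> in the limit
  (\<open>horizontal_area\<close>).

  For the upper bound, running \<open>j\<close> times through a circle of area \<open>\<sigma> j / j\<close> in the \<open>j\<close>-th plane, for all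
  \<open>j\<close> simultaneously, is a loop with area \<open>X\<close> and length \<open>2 \<surd>(\<pi> \<Sum>j. j \<sigma> j)\<close>
  (\<open>cc_dist0_vertical_le\<close>).  Following it by the segment from \<open>0\<close> to \<open>x\<close> gives the factor \<open>3 = 2 + 1\<close>.
\<close>

section \<open>The group and its horizontal curves\<close>

lemma wedge_apply: "wedge x y v = (x \<bullet> v) *\<^sub>R y - (y \<bullet> v) *\<^sub>R x"
  by (simp add: wedge_def blinfun.diff_left tensor_apply)

lemma wedge_add_left: "wedge (x + y) z = wedge x z + wedge y z"
  and wedge_add_right: "wedge z (x + y) = wedge z x + wedge z y"
  and wedge_diff_left: "wedge (x - y) z = wedge x z - wedge y z"
  and wedge_diff_right: "wedge z (x - y) = wedge z x - wedge z y"
  and wedge_scaleR_left: "wedge (c *\<^sub>R x) z = c *\<^sub>R wedge x z"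
  and wedge_scaleR_right: "wedge z (c *\<^sub>R x) = c *\<^sub>R wedge z x"
  and wedge_minus_left: "wedge (- x) z = - wedge x z"
  and wedge_minus_right: "wedge z (- x) = - wedge z x"
  and wedge_self [simp]: "wedge x x = 0"
  and wedge_zero_left [simp]: "wedge 0 x = 0"
  and wedge_zero_right [simp]: "wedge x 0 = 0"
  and wedge_swap: "wedge x z = - wedge z x"
  by (auto intro!: blinfun_eqI simp: wedge_apply blinfun.bilinear_simps algebra_simps)

lemma wedge_sum_left: "wedge (\<Sum>i\<in>I. f i) z = (\<Sum>i\<in>I. wedge (f i) z)"
  by (induction I rule: infinite_finite_induct) (auto simp: wedge_add_left)

lemma wedge_sum_right: "wedge z (\<Sum>i\<in>I. f i) = (\<Sum>i\<in>I. wedge z (f i))"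
  by (induction I rule: infinite_finite_induct) (auto simp: wedge_add_right)

lemma norm_tensor_le: "norm (tensor x y) \<le> norm x * norm y"
proof (rule norm_blinfun_bound)
  fix v
  have "\<bar>x \<bullet> v\<bar> * norm y \<le> (norm x * norm v) * norm y"
    by (intro mult_right_mono Cauchy_Schwarz_ineq2) auto
  then show "norm (tensor x y v) \<le> norm x * norm y * norm v"
    by (simp add: tensor_apply mult_ac)
qed auto

lemma norm_wedge_le: "norm (wedge x y) \<le> 2 * norm x * norm y"
  unfolding wedge_def
  by (rule order_trans[OF norm_triangle_ineq4])
     (use norm_tensor_le[of x y] norm_tensor_le[of y x] in \<open>simp add: mult_ac\<close>)

lemma inner_wedge: "wedge x y v \<bullet> w = (x \<bullet> v) * (y \<bullet> w) - (y \<bullet> v) * (x \<bullet> w)"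
  by (simp add: wedge_apply inner_diff_left)

lemma bounded_bilinear_wedge: "bounded_bilinear wedge"
  by (rule bounded_bilinear.intro)
     (auto simp: wedge_add_left wedge_add_right wedge_scaleR_left wedge_scaleR_right
       intro!: exI[of _ 2] order_trans[OF norm_wedge_le])

lemma g2_mult_assoc: "g2_mult (g2_mult x y) z = g2_mult x (g2_mult y z)"
  by (simp add: g2_mult_def wedge_add_left wedge_add_right algebra_simps)

lemma g2_mult_zero_left [simp]: "g2_mult 0 x = x"
  and g2_mult_zero_right [simp]: "g2_mult x 0 = x"
  and g2_inv_zero [simp]: "g2_inv 0 = 0"
  and g2_inv_inv [simp]: "g2_inv (g2_inv x) = x"
  by (simp_all add: g2_mult_def g2_inv_def)

lemma g2_inv_mult: "g2_inv (g2_mult x y) = g2_mult (g2_inv y) (g2_inv x)"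
  using wedge_swap[of "fst x" "fst y"]
  by (simp add: g2_mult_def g2_inv_def wedge_minus_left wedge_minus_right prod_eq_iff)

lemma g2_mult_inv_cancel [simp]: "g2_mult (g2_inv x) (g2_mult x y) = y"
  and g2_mult_cancel [simp]: "g2_mult x (g2_mult (g2_inv x) y) = y"
  by (simp_all add: g2_mult_assoc[symmetric] g2_inv_left g2_inv_right)

definition increment ::
  "'a::{real_inner,banach} \<times> ('a \<Rightarrow>\<^sub>L 'a) \<Rightarrow> 'a \<times> ('a \<Rightarrow>\<^sub>L 'a) \<Rightarrow> 'a \<times> ('a \<Rightarrow>\<^sub>L 'a)" where
  "increment x y = g2_mult (g2_inv x) y"

lemma fst_increment: "fst (increment x y) = fst y - fst x"
  and snd_increment: "snd (increment x y) = snd y - snd x - (1/2) *\<^sub>R wedge (fst x) (fst y)"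
  by (simp_all add: increment_def g2_mult_def g2_inv_def wedge_minus_left)

lemma increment_zero_left [simp]: "increment 0 x = x"
  and increment_self [simp]: "increment x x = 0"
  by (simp_all add: increment_def g2_inv_left)

lemma increment_trans: "g2_mult (increment x y) (increment y z) = increment x z"
  by (simp add: increment_def g2_mult_assoc)

lemma increment_inv: "g2_inv (increment x y) = increment y x"
  by (simp add: increment_def g2_inv_mult)

lemma increment_translate: "increment (g2_mult a x) (g2_mult a y) = increment x y"
  by (simp add: increment_def g2_inv_mult g2_mult_assoc)

lemma mult_increment: "g2_mult x (increment x y) = y"
  by (simp add: increment_def)

text \<open>
  Sets that absorb the increments of a rectifiable horizontal curve: a piece of length \<open>l\<close> moves
  by at most \<open>l\<close> in \<open>E\<close> and sweeps an area of order \<open>l\<^sup>2\<close>.  Any constant in front of \<open>l\<^sup>2\<close>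
  for which \<open>short_mult\<close> holds would do.
\<close>

definition short :: "real \<Rightarrow> ('a::{real_inner,banach} \<times> ('a \<Rightarrow>\<^sub>L 'a)) set" where
  "short l = {z. norm (fst z) \<le> l \<and> norm (snd z) \<le> l\<^sup>2}"

lemma zero_in_short [simp]: "0 \<le> l \<Longrightarrow> 0 \<in> short l"
  by (simp add: short_def)

lemma short_mono: "z \<in> short l \<Longrightarrow> l \<le> l' \<Longrightarrow> z \<in> short l'"
  unfolding short_def
  using order_trans[OF norm_ge_zero, of "fst z" l] power_mono[of l l' 2]
  by (auto elim: order_trans)

lemma short_mult:
  assumes "x \<in> short l" "y \<in> short l'"
  shows "g2_mult x y \<in> short (l + l')"
proof -
  have x: "norm (fst x) \<le> l" "norm (snd x) \<le> l\<^sup>2" and y: "norm (fst y) \<le> l'" "norm (snd y) \<le> l'\<^sup>2"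
    using assms by (auto simp: short_def)
  have "norm (fst x) * norm (fst y) \<le> l * l'"
    using x y by (intro mult_mono) (auto intro: order_trans[OF norm_ge_zero])
  then have "norm ((1/2) *\<^sub>R wedge (fst x) (fst y)) \<le> l * l'"
    using norm_wedge_le[of "fst x" "fst y"] by simp
  moreover have "0 \<le> l * l'"
    using x y by (intro mult_nonneg_nonneg) (auto intro: order_trans[OF norm_ge_zero])
  moreover have "norm (snd x + snd y + (1/2) *\<^sub>R wedge (fst x) (fst y))
      \<le> norm (snd x) + norm (snd y) + norm ((1/2) *\<^sub>R wedge (fst x) (fst y))"
    by (intro order_trans[OF norm_triangle_ineq] add_right_mono norm_triangle_ineq)
  ultimately have "norm (snd x + snd y + (1/2) *\<^sub>R wedge (fst x) (fst y)) \<le> (l + l')\<^sup>2"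
    using x y by (simp add: power2_sum)
  moreover have "norm (fst x + fst y) \<le> l + l'"
    using x y norm_triangle_ineq[of "fst x" "fst y"] by linarith
  ultimately show ?thesis by (simp add: short_def g2_mult_def)
qed

lemma short_inv: "x \<in> short l \<Longrightarrow> g2_inv x \<in> short l"
  by (simp add: short_def g2_inv_def)

text \<open>
  Lipschitz curves for the Carnot--Caratheodory metric, described without this metric and without
  derivatives.  That areas grow quadratically encodes horizontality.
\<close>

definition horizontal :: "real \<Rightarrow> (real \<Rightarrow> 'a::{real_inner,banach} \<times> ('a \<Rightarrow>\<^sub>L 'a)) \<Rightarrow> bool" where
  "horizontal L g \<longleftrightarrow>
     g 0 = 0 \<and> (\<forall>s t. 0 \<le> s \<and> s \<le> t \<and> t \<le> 1 \<longrightarrow> increment (g s) (g t) \<in> short (L * (t - s)))"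

lemma horizontalD:
  assumes "horizontal L g"
  shows "g 0 = 0" and "0 \<le> s \<Longrightarrow> s \<le> t \<Longrightarrow> t \<le> 1 \<Longrightarrow> increment (g s) (g t) \<in> short (L * (t - s))"
  using assms by (auto simp: horizontal_def)

lemma horizontal_mono: "horizontal L g \<Longrightarrow> L \<le> L' \<Longrightarrow> horizontal L' g"
  unfolding horizontal_def by (meson short_mono mult_right_mono diff_ge_0_iff_ge)

lemma horizontal_nonneg: "horizontal L g \<Longrightarrow> 0 \<le> L"
  using horizontalD(2)[of L g 0 1] by (auto simp: short_def intro: order_trans[OF norm_ge_zero])

lemma horizontal_end: "horizontal L g \<Longrightarrow> g 1 \<in> short L"
  using horizontalD(2)[of L g 0 1] by (simp add: horizontalD(1))

text \<open>
  The two curves are run one after the other, in times proportional to their constants.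
\<close>

lemma horizontal_concat:
  assumes g: "horizontal L g" and h: "horizontal L' h"
  obtains k where "horizontal (L + L') k" "k 1 = g2_mult (g 1) (h 1)"
proof (cases "L + L' = 0")
  case True
  then have "L = 0" "L' = 0"
    using horizontal_nonneg[OF g] horizontal_nonneg[OF h] by auto
  then have "h 1 = 0" using horizontal_end[OF h] by (simp add: short_def prod_eq_iff)
  then show ?thesis using that[of g] g \<open>L = 0\<close> \<open>L' = 0\<close> by simp
next
  case False
  have h0: "h 1 = 0" if "L' = 0"
    using horizontal_end[OF h] that by (simp add: short_def prod_eq_iff)
  from False have pos: "L + L' > 0" and nn: "0 \<le> L" "0 \<le> L'"
    using horizontal_nonneg[OF g] horizontal_nonneg[OF h] by auto
  define S where "S = L + L'"
  have S: "S > 0" "L \<le> S" "L' \<le> S" using pos nn by (auto simp: S_def)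
  \<comment> \<open>Clamped, one parameter rests while the other one moves; \<open>L = 0\<close> must not be divided by.\<close>
  define a where "a t = (if S * t \<le> L then (if L = 0 then 0 else S * t / L) else 1)" for t
  define b where "b t = (if S * t \<le> L then 0 else (S * t - L) / L')" for t
  define k where "k t = g2_mult (g (a t)) (h (b t))" for t
  have a: "0 \<le> a t" "a t \<le> 1" if "0 \<le> t" for t
    using that S nn by (auto simp: a_def divide_simps)
  have b: "0 \<le> b t" "b t \<le> 1" if "t \<le> 1" for t
  proof -
    have "S * t \<le> S" using that S by simp
    then show "0 \<le> b t" "b t \<le> 1" using nn by (auto simp: b_def divide_simps S_def)
  qed
  have La: "L * a t = min (S * t) L" if "0 \<le> t" for t
    using that S nn by (auto simp: a_def min_def mult_le_0_iff)
  have Lb: "L' * b t = max (S * t - L) 0" if "t \<le> 1" for t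
  proof -
    have "S * t \<le> S" using that S by simp
    then show ?thesis by (auto simp: b_def max_def S_def)
  qed
  have "increment (k s) (k t) \<in> short (S * (t - s))" if st: "0 \<le> s" "s \<le> t" "t \<le> 1" for s t
  proof -
    have mono: "S * s \<le> S * t" using st S by simp
    have ab: "a s \<le> a t" "b s \<le> b t"
    proof -
      have "S * t \<le> S" using st S by simp
      then show "b s \<le> b t" using mono nn by (auto simp: b_def divide_simps S_def)
      have "0 \<le> S * s" using st S by simp
      then show "a s \<le> a t" using mono nn by (auto simp: a_def divide_simps)
    qed
    have g_inc: "increment (g (a s)) (g (a t)) \<in> short (L * (a t - a s))"
      using horizontalD(2)[OF g] a ab st by force
    have h_inc: "increment (h (b s)) (h (b t)) \<in> short (L' * (b t - b s))"
      using horizontalD(2)[OF h] b ab st by force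
    consider "S * t \<le> L" | "L < S * s" | "S * s \<le> L" "L < S * t" by linarith
    then show ?thesis
    proof cases
      case 1
      then have [simp]: "b t = 0" "b s = 0" using mono by (auto simp: b_def)
      have "L * (a t - a s) = S * (t - s)"
        using La[of t] La[of s] 1 mono st by (simp add: algebra_simps)
      then show ?thesis using g_inc by (simp add: k_def horizontalD(1)[OF h])
    next
      case 2
      then have [simp]: "a t = 1" "a s = 1" using mono by (auto simp: a_def)
      have "L' * (b t - b s) = S * (t - s)"
        using Lb[of t] Lb[of s] 2 mono st by (simp add: algebra_simps)
      then show ?thesis using h_inc by (simp add: k_def increment_translate)
    next
      case 3
      then have [simp]: "b s = 0" "a t = 1" by (auto simp: a_def b_def)
      have "increment (k s) (k t) = g2_mult (increment (g (a s)) (g 1)) (increment (h 0) (h (b t)))"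
        by (simp add: k_def horizontalD(1)[OF h] increment_def g2_mult_assoc)
      also have "\<dots> \<in> short (L * (a t - a s) + L' * (b t - b s))"
        using g_inc h_inc by (intro short_mult) simp_all
      also have "L * (a t - a s) + L' * (b t - b s) = S * (t - s)"
        using La[of t] La[of s] Lb[of t] Lb[of s] 3 st by (simp add: algebra_simps)
      finally show ?thesis .
    qed
  qed
  moreover have "k 0 = 0"
    using nn by (simp add: k_def a_def b_def horizontalD(1)[OF g] horizontalD(1)[OF h])
  moreover have "k 1 = g2_mult (g 1) (h 1)"
    using nn pos h0 by (auto simp: k_def a_def b_def S_def horizontalD(1)[OF g] horizontalD(1)[OF h])
  ultimately show ?thesis using that[of k] by (auto simp: horizontal_def S_def)
qed

lemma horizontal_reverse:
  assumes g: "horizontal L g"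
  obtains h where "horizontal L h" "h 1 = g2_inv (g 1)"
proof
  define h where "h t = increment (g 1) (g (1 - t))" for t
  have "increment (h s) (h t) \<in> short (L * (t - s))" if "0 \<le> s" "s \<le> t" "t \<le> 1" for s t
  proof -
    have "increment (h s) (h t) = g2_inv (increment (g (1 - t)) (g (1 - s)))"
      by (simp add: h_def increment_def g2_inv_mult g2_mult_assoc)
    then show ?thesis
      using horizontalD(2)[OF g, of "1 - t" "1 - s"] that by (simp add: short_inv)
  qed
  then show "horizontal L h" by (auto simp: horizontal_def h_def)
  show "h 1 = g2_inv (g 1)"
    by (simp add: h_def increment_def horizontalD(1)[OF g])
qed

lemma horizontal_subcurve:
  assumes g: "horizontal L g" and st: "0 \<le> s" "s \<le> t" "t \<le> 1"
  shows "horizontal (L * (t - s)) (\<lambda>r. increment (g s) (g (s + r * (t - s))))"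
  unfolding horizontal_def
proof (intro conjI allI impI)
  fix p q :: real assume pq: "0 \<le> p \<and> p \<le> q \<and> q \<le> 1"
  have "s + q * (t - s) \<le> s + 1 * (t - s)"
    using pq st by (intro add_left_mono mult_right_mono) auto
  moreover have "s + p * (t - s) \<le> s + q * (t - s)"
    using pq st by (intro add_left_mono mult_right_mono) auto
  ultimately have "increment (g (s + p * (t - s))) (g (s + q * (t - s)))
      \<in> short (L * ((s + q * (t - s)) - (s + p * (t - s))))"
    using pq st by (intro horizontalD(2)[OF g]) auto
  then show "increment (increment (g s) (g (s + p * (t - s)))) (increment (g s) (g (s + q * (t - s))))
      \<in> short (L * (t - s) * (q - p))"
    unfolding increment_def[of "g s"] increment_translate by (simp add: algebra_simps)
qed simp

text \<open>
  The second component of a horizontal curve is determined by the first one, as the limit of the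
  areas of inscribed polygons: each of the \<open>M\<close> pieces contributes an error \<open>(L / M)\<^sup>2\<close>.
\<close>

lemma horizontal_polygon:
  assumes g: "horizontal L g" and M: "0 < (M::nat)"
  defines "x \<equiv> \<lambda>j. fst (g (real j / real M))"
  shows "norm (snd (g 1) - (1/2) *\<^sub>R (\<Sum>j<M. wedge (x j) (x (Suc j) - x j))) \<le> L\<^sup>2 / M"
proof -
  have "norm (snd (g (k / M)) - (1/2) *\<^sub>R (\<Sum>j<k. wedge (x j) (x (Suc j) - x j))) \<le> k * (L / M)\<^sup>2"
    if "k \<le> M" for k :: nat
    using that
  proof (induction k)
    case 0
    then show ?case by (simp add: horizontalD(1)[OF g])
  next
    case (Suc k)
    let ?i = "increment (g (real k / M)) (g (real (Suc k) / M))"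
    let ?A = "\<lambda>k. (1/2) *\<^sub>R (\<Sum>j<k. wedge (x j) (x (Suc j) - x j))"
    have "?i \<in> short (L * (real (Suc k) / M - real k / M))"
      using Suc.prems M by (intro horizontalD(2)[OF g]) (auto simp: divide_simps)
    also have "L * (real (Suc k) / M - real k / M) = L / M"
      using M by (simp add: field_simps)
    finally have i: "norm (snd ?i) \<le> (L / M)\<^sup>2" by (simp add: short_def)
    have "snd (g (real (Suc k) / M)) - ?A (Suc k) = snd ?i + (snd (g (real k / M)) - ?A k)"
      by (simp add: snd_increment x_def wedge_diff_right algebra_simps)
    then have "norm (snd (g (real (Suc k) / M)) - ?A (Suc k)) \<le> (L / M)\<^sup>2 + k * (L / M)\<^sup>2"
      using i Suc by (simp only:) (intro order_trans[OF norm_triangle_ineq] add_mono, auto)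
    also have "\<dots> = real (Suc k) * (L / M)\<^sup>2" by (simp add: algebra_simps)
    finally show ?case .
  qed
  from this[of M] show ?thesis using M by (simp add: power2_eq_square)
qed

section \<open>Weak limits\<close>

text \<open>
  The functional is represented by the minimiser of \<open>\<parallel>x\<parallel>\<^sup>2 - 2 f x\<close>; minimising sequences are
  Cauchy by the parallelogram law.
\<close>

lemma riesz_representation:
  fixes f :: "'a::{real_inner,banach} \<Rightarrow> real"
  assumes lin: "linear f" and bound: "\<And>x. \<bar>f x\<bar> \<le> c * norm x"
  obtains y where "\<And>x. f x = y \<bullet> x" "norm y \<le> \<bar>c\<bar>"
proof -
  define F where "F x = (norm x)\<^sup>2 - 2 * f x" for x
  have bdd: "F x \<ge> - c\<^sup>2" for x
  proof -
    have "0 \<le> (norm x - c)\<^sup>2" by simp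
    then have "2 * (c * norm x) - c\<^sup>2 \<le> (norm x)\<^sup>2" by (simp add: power2_diff mult_ac)
    then show ?thesis using bound[of x] by (simp add: F_def)
  qed
  define m where "m = (INF x. F x)"
  have bb: "bdd_below (range F)" using bdd by (intro bdd_belowI2) blast
  have m_le: "m \<le> F x" for x unfolding m_def by (rule cINF_lower[OF bb]) simp
  have "\<exists>x. F x < m + 1 / Suc n" for n
    using cINF_less_iff[OF _ bb, of "m + 1 / Suc n"] by (simp add: m_def)
  then obtain X where X: "\<And>n. F (X n) < m + 1 / Suc n" by metis
  have par: "(norm (x - y))\<^sup>2 \<le> 2 * (F x - m) + 2 * (F y - m)" for x y
  proof -
    have h: "(1/2) *\<^sub>R (x + y) = (1/2) *\<^sub>R x + (1/2) *\<^sub>R y" by (simp add: scaleR_add_right)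
    have "4 * F ((1/2) *\<^sub>R (x + y)) + (norm (x - y))\<^sup>2 = 2 * F x + 2 * F y"
      unfolding F_def power2_norm_eq_inner h linear_add[OF lin] linear_scale[OF lin]
      by (simp add: inner_add inner_diff inner_commute algebra_simps)
    moreover have "4 * m \<le> 4 * F ((1/2) *\<^sub>R (x + y))" using m_le by simp
    ultimately show ?thesis by (simp add: right_diff_distrib)
  qed
  have "Cauchy X"
  proof (rule metric_CauchyI)
    fix e :: real assume e: "e > 0"
    then obtain N :: nat where N: "N > 4 / e\<^sup>2" using reals_Archimedean2 by blast
    have "dist (X p) (X q) < e" if "p \<ge> N" "q \<ge> N" for p q
    proof -
      have "N > 0" using N e by (metis divide_pos_pos of_nat_0_less_iff order_less_trans zero_less_numeral zero_less_power)
      have "1 / Suc p \<le> 1 / N" "1 / Suc q \<le> 1 / N"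
        using that \<open>N > 0\<close> by (auto intro!: divide_left_mono)
      moreover have "4 / N < e\<^sup>2" using N e \<open>N > 0\<close> by (simp add: field_simps)
      ultimately have "(norm (X p - X q))\<^sup>2 < e\<^sup>2"
        using par[of "X p" "X q"] X[of p] X[of q] by simp
      then show ?thesis using e by (simp add: dist_norm power2_less_imp_less)
    qed
    then show "\<exists>N. \<forall>p\<ge>N. \<forall>q\<ge>N. dist (X p) (X q) < e" by blast
  qed
  then obtain y where y: "X \<longlonglongrightarrow> y" using Cauchy_convergent convergent_def by metis
  have bl: "bounded_linear f"
    by (rule bounded_linear_intro[where K = c])
       (use lin bound in \<open>auto simp: linear_add linear_scale mult.commute\<close>)
  have "(\<lambda>n. F (X n)) \<longlonglongrightarrow> F y"
    unfolding F_def by (intro tendsto_intros y bounded_linear.tendsto[OF bl])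
  moreover have "(\<lambda>n. m + 1 / Suc n) \<longlonglongrightarrow> m + 0"
    using tendsto_add[OF tendsto_const LIMSEQ_inverse_real_of_nat] by (simp add: inverse_eq_divide)
  ultimately have "F y \<le> m"
    using LIMSEQ_le[of "\<lambda>n. F (X n)" "F y" "\<lambda>n. m + 1 / Suc n" "m + 0"] X
    by (simp add: less_imp_le)
  then have min: "F y \<le> F x" for x using m_le order_trans by blast
  have f_eq: "f x = y \<bullet> x" for x
  proof (rule ccontr)
    define d where "d = y \<bullet> x - f x"
    assume "f x \<noteq> y \<bullet> x"
    then have d: "d \<noteq> 0" by (simp add: d_def)
    then have x0: "x \<noteq> 0" using linear_0[OF lin] by (auto simp: d_def)
    have "F (y + t *\<^sub>R x) = F y + 2 * t * d + t\<^sup>2 * (norm x)\<^sup>2" for t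
      unfolding F_def power2_norm_eq_inner linear_add[OF lin] linear_scale[OF lin] d_def
      by (simp add: inner_add inner_commute algebra_simps power2_eq_square)
    \<comment> \<open>the minimum of the quadratic polynomial in \<open>t\<close>\<close>
    from this[of "- d / (norm x)\<^sup>2"] have "F (y + (- d / (norm x)\<^sup>2) *\<^sub>R x) = F y - d\<^sup>2 / (norm x)\<^sup>2"
      using x0 by (simp add: field_simps power2_eq_square)
    moreover have "d\<^sup>2 / (norm x)\<^sup>2 > 0" using d x0 by simp
    ultimately show False using min[of "y + (- d / (norm x)\<^sup>2) *\<^sub>R x"] by simp
  qed
  have "norm y \<le> \<bar>c\<bar>"
  proof (cases "y = 0")
    case False
    have "norm y * norm y = f y" by (simp add: f_eq power2_norm_eq_inner[symmetric] power2_eq_square)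
    also have "\<dots> \<le> \<bar>c\<bar> * norm y"
      using bound[of y] mult_right_mono[OF abs_ge_self norm_ge_zero, of c y] by linarith
    finally show ?thesis using False by simp
  qed simp
  then show ?thesis using that f_eq by blast
qed

text \<open>
  Tychonoff's theorem, applied to a product of intervals, replaces the extraction of subsequences:
  along one and the same filter all
  of an arbitrary, possibly uncountable family of bounded sequences converge.
\<close>

lemma bounded_families_converge:
  fixes \<phi> :: "nat \<Rightarrow> 'i \<Rightarrow> real"
  assumes "\<And>n i. \<bar>\<phi> n i\<bar> \<le> c i"
  obtains F l where "F \<noteq> bot" "F \<le> sequentially" "\<And>i. ((\<lambda>n. \<phi> n i) \<longlongrightarrow> l i) F"
proof -
  have comp: "compact (PiE UNIV (\<lambda>i. {- c i .. c i}))"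
    using compactin_PiE[of "\<lambda>_. euclideanreal" UNIV "\<lambda>i. {- c i .. c i}"]
    by (simp add: euclidean_product_topology)
  have "eventually (\<lambda>p. p \<in> PiE UNIV (\<lambda>i. {- c i .. c i})) (filtermap \<phi> sequentially)"
    using assms by (auto simp: eventually_filtermap abs_le_iff minus_le_iff intro!: always_eventually)
  moreover have "filtermap \<phi> sequentially \<noteq> bot" by (simp add: filtermap_bot_iff)
  ultimately obtain l where l: "inf (nhds l) (filtermap \<phi> sequentially) \<noteq> bot"
    using comp[unfolded compact_filter, rule_format, of "filtermap \<phi> sequentially"] by blast
  define F where "F = inf (filtercomap \<phi> (nhds l)) sequentially"
  have lim: "filterlim \<phi> (nhds l) F"
    unfolding F_def by (rule filterlim_mono[OF filterlim_filtercomap order_refl]) simp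
  have "F \<noteq> bot"
  proof
    assume "F = bot"
    then have "eventually (\<lambda>_. False) F" by simp
    then obtain Q R where QR: "eventually Q (filtercomap \<phi> (nhds l))" "eventually R sequentially"
      "\<And>n. Q n \<Longrightarrow> R n \<Longrightarrow> False"
      unfolding F_def eventually_inf by blast
    then obtain P where P: "eventually P (nhds l)" "\<And>n. P (\<phi> n) \<Longrightarrow> Q n"
      unfolding eventually_filtercomap by blast
    have "eventually (\<lambda>p. \<not> P p) (filtermap \<phi> sequentially)"
      unfolding eventually_filtermap using QR(2) by eventually_elim (use QR P in blast)
    then have "eventually (\<lambda>_. False) (inf (nhds l) (filtermap \<phi> sequentially))"
      unfolding eventually_inf using P(1) by blast
    with l show False by (simp add: trivial_limit_def)
  qed
  moreover have "((\<lambda>n. \<phi> n i) \<longlongrightarrow> l i) F" for i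
    using continuous_on_tendsto_compose[OF continuous_on_product_coordinates[of i] lim]
    by simp
  ultimately show ?thesis using that[of F l] by (simp add: F_def)
qed

text \<open>
  Weak limits respect the group law, because the coefficients of \<open>x \<and> y\<close> are products of
  coefficients of \<open>x\<close> and \<open>y\<close>, and norms do not increase.  Hence a bound on the length of
  horizontal curves survives the limit of their end points.
\<close>

lemma horizontal_limit:
  assumes g: "\<And>n. horizontal (L n) (g n)" and L: "L \<longlonglongrightarrow> L'" and x: "(\<lambda>n. g n 1) \<longlonglongrightarrow> x"
  obtains h where "horizontal L' h" "h 1 = x"
proof -
  have "Bseq L" using L convergent_def convergent_imp_Bseq by blast
  then obtain c where c: "c > 0" "\<And>n. L n \<le> c"
    unfolding Bseq_def by (metis abs_le_D1 real_norm_def)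
  have gc: "norm (fst (g n s)) \<le> c" "norm (snd (g n s)) \<le> c\<^sup>2" if "0 \<le> s" "s \<le> 1" for n s
  proof -
    have "increment (g n 0) (g n s) \<in> short (L n * (s - 0))"
      by (rule horizontalD(2)[OF g]) (use that in auto)
    then have "g n s \<in> short (L n * s)" by (simp add: horizontalD(1)[OF g])
    moreover have "L n * s \<le> c"
      using mult_mono[of "L n" c s 1] c that horizontal_nonneg[OF g[of n]] by simp
    ultimately have "g n s \<in> short c" by (rule short_mono)
    then show "norm (fst (g n s)) \<le> c" "norm (snd (g n s)) \<le> c\<^sup>2" by (auto simp: short_def)
  qed
  define I where "I = {0..1::real}"
  define \<phi> where "\<phi> n i = (case i of Inl (s, v) \<Rightarrow> (if s \<in> I then fst (g n s) \<bullet> v else 0)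
      | Inr (s, v, w) \<Rightarrow> (if s \<in> I then snd (g n s) v \<bullet> w else 0))"
    for n and i :: "real \<times> 'a + real \<times> 'a \<times> 'a"
  define C where "C i = (case i of Inl (s, v) \<Rightarrow> c * norm v | Inr (s, v, w) \<Rightarrow> c\<^sup>2 * norm v * norm w)"
    for i :: "real \<times> 'a + real \<times> 'a \<times> 'a"
  have b1: "\<bar>fst (g n s) \<bullet> v\<bar> \<le> c * norm v" if "s \<in> I" for n s v
    using gc[of s n] that by (intro order_trans[OF Cauchy_Schwarz_ineq2] mult_right_mono) (auto simp: I_def)
  have b2: "\<bar>snd (g n s) v \<bullet> w\<bar> \<le> c\<^sup>2 * norm v * norm w" if "s \<in> I" for n s v w
    using gc[of s n] that
    by (intro order_trans[OF Cauchy_Schwarz_ineq2] mult_right_mono order_trans[OF norm_blinfun])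
       (auto simp: I_def)
  have "\<bar>\<phi> n i\<bar> \<le> C i" for n i
    using b1 b2 c by (auto simp: \<phi>_def C_def split: sum.splits prod.splits)
  then obtain F l where F: "F \<noteq> bot" "F \<le> sequentially" and l: "\<And>i. ((\<lambda>n. \<phi> n i) \<longlongrightarrow> l i) F"
    using bounded_families_converge[of \<phi> C] by metis
  have lim1: "((\<lambda>n. fst (g n s) \<bullet> v) \<longlongrightarrow> l (Inl (s, v))) F" if "s \<in> I" for s v
    using l[of "Inl (s, v)"] that by (simp add: \<phi>_def)
  have lim2: "((\<lambda>n. snd (g n s) v \<bullet> w) \<longlongrightarrow> l (Inr (s, v, w))) F" if "s \<in> I" for s v w
    using l[of "Inr (s, v, w)"] that by (simp add: \<phi>_def)
  have L_F: "(L \<longlongrightarrow> L') F" by (rule filterlim_mono[OF L order_refl F(2)])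
  have ex1: "\<exists>y. \<forall>v. ((\<lambda>n. fst (g n s) \<bullet> v) \<longlongrightarrow> y \<bullet> v) F" if s: "s \<in> I" for s
  proof -
    have "linear (\<lambda>v. l (Inl (s, v)))"
    proof (rule linearI)
      fix v w :: 'a and r :: real
      have "((\<lambda>n. fst (g n s) \<bullet> (v + w)) \<longlongrightarrow> l (Inl (s, v)) + l (Inl (s, w))) F"
        unfolding inner_add_right by (intro tendsto_add lim1 s)
      then show "l (Inl (s, v + w)) = l (Inl (s, v)) + l (Inl (s, w))"
        using tendsto_unique[OF F(1) lim1[OF s]] by blast
      have "((\<lambda>n. fst (g n s) \<bullet> (r *\<^sub>R v)) \<longlongrightarrow> r *\<^sub>R l (Inl (s, v))) F"
        unfolding inner_scaleR_right real_scaleR_def by (intro tendsto_mult tendsto_const lim1 s)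
      then show "l (Inl (s, r *\<^sub>R v)) = r *\<^sub>R l (Inl (s, v))"
        using tendsto_unique[OF F(1) lim1[OF s]] by blast
    qed
    moreover have "\<bar>l (Inl (s, v))\<bar> \<le> c * norm v" for v
      by (rule tendsto_upperbound[OF tendsto_rabs[OF lim1[OF s]] _ F(1)])
         (use b1[OF s] in \<open>auto intro: always_eventually\<close>)
    ultimately obtain y where "\<And>v. l (Inl (s, v)) = y \<bullet> v"
      using riesz_representation by blast
    then show ?thesis using lim1[OF s] by metis
  qed
  have ex2: "\<exists>Y. \<forall>v w. ((\<lambda>n. snd (g n s) v \<bullet> w) \<longlongrightarrow> blinfun_apply Y v \<bullet> w) F"
    if s: "s \<in> I" for s
  proof -
    let ?l = "\<lambda>v w. l (Inr (s, v, w))"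
    have uniq: "?l v w = z" if "((\<lambda>n. snd (g n s) v \<bullet> w) \<longlongrightarrow> z) F" for v w z
      using tendsto_unique[OF F(1) lim2[OF s] that] .
    have lb: "\<bar>?l v w\<bar> \<le> c\<^sup>2 * norm v * norm w" for v w
      by (rule tendsto_upperbound[OF tendsto_rabs[OF lim2[OF s]] _ F(1)])
         (use b2[OF s] in \<open>auto intro: always_eventually\<close>)
    have "\<exists>y. (\<forall>w. ?l v w = y \<bullet> w) \<and> norm y \<le> c\<^sup>2 * norm v" for v
    proof -
      have "linear (?l v)"
      proof (rule linearI)
        fix v' w :: 'a and r :: real
        show "?l v (v' + w) = ?l v v' + ?l v w"
          by (rule uniq) (unfold inner_add_right, intro tendsto_add lim2 s)
        show "?l v (r *\<^sub>R v') = r *\<^sub>R ?l v v'"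
          by (rule uniq) (unfold inner_scaleR_right real_scaleR_def, intro tendsto_mult tendsto_const lim2 s)
      qed
      then obtain y where "\<And>w. ?l v w = y \<bullet> w" "norm y \<le> \<bar>c\<^sup>2 * norm v\<bar>"
        using riesz_representation[OF _ lb[of v]] by blast
      then show ?thesis by auto
    qed
    then obtain Y where Y: "\<And>v w. ?l v w = Y v \<bullet> w" "\<And>v. norm (Y v) \<le> c\<^sup>2 * norm v" by metis
    have "bounded_linear Y"
    proof (rule bounded_linear_intro)
      fix v v' :: 'a and r :: real
      have "?l (v + v') w = ?l v w + ?l v' w" for w
        by (rule uniq) (unfold blinfun.add_right inner_add_left, intro tendsto_add lim2 s)
      then show "Y (v + v') = Y v + Y v'"
        unfolding Y(1) inner_add_left[symmetric] by (rule vector_eq_rdot[THEN iffD1, OF allI])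
      have "?l (r *\<^sub>R v) w = r * ?l v w" for w
        by (rule uniq) (unfold blinfun.scaleR_right inner_scaleR_left, intro tendsto_mult tendsto_const lim2 s)
      then show "Y (r *\<^sub>R v) = r *\<^sub>R Y v"
        unfolding Y(1) inner_scaleR_left[symmetric] by (rule vector_eq_rdot[THEN iffD1, OF allI])
      show "norm (Y v) \<le> norm v * c\<^sup>2" using Y by (simp add: mult.commute)
    qed
    then show ?thesis
      using lim2[OF s] unfolding Y(1)
      by (intro exI[of _ "Blinfun Y"]) (simp add: bounded_linear_Blinfun_apply)
  qed
  have "\<forall>s\<in>I. \<exists>y. \<forall>v. ((\<lambda>n. fst (g n s) \<bullet> v) \<longlongrightarrow> y \<bullet> v) F"
    using ex1 by blast
  from bchoice[OF this] obtain y where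
    y: "\<And>s v. s \<in> I \<Longrightarrow> ((\<lambda>n. fst (g n s) \<bullet> v) \<longlongrightarrow> y s \<bullet> v) F"
    by blast
  have "\<forall>s\<in>I. \<exists>Y. \<forall>v w.
      ((\<lambda>n. snd (g n s) v \<bullet> w) \<longlongrightarrow> blinfun_apply Y v \<bullet> w) F"
    using ex2 by blast
  from bchoice[OF this] obtain Y where
    Y: "\<And>s v w. s \<in> I \<Longrightarrow>
      ((\<lambda>n. snd (g n s) v \<bullet> w) \<longlongrightarrow> blinfun_apply (Y s) v \<bullet> w) F"
    by blast
  define h where "h s = (y s, Y s)" for s
  have h_eqI: "h s = z" if s: "s \<in> I" and "((\<lambda>n. g n s) \<longlongrightarrow> z) F" for s z
  proof -
    have "y s = fst z"
    proof (rule vector_eq_rdot[THEN iffD1, OF allI])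
      fix v
      have "((\<lambda>n. fst (g n s) \<bullet> v) \<longlongrightarrow> fst z \<bullet> v) F" by (intro tendsto_intros that)
      then show "y s \<bullet> v = fst z \<bullet> v" using tendsto_unique[OF F(1) y[OF s]] by blast
    qed
    moreover have "Y s = snd z"
    proof (rule blinfun_eqI, rule vector_eq_rdot[THEN iffD1, OF allI])
      fix v w
      have "((\<lambda>n. snd (g n s) v \<bullet> w) \<longlongrightarrow> snd z v \<bullet> w) F"
        by (intro tendsto_intros that)
      then show "Y s v \<bullet> w = snd z v \<bullet> w"
        using tendsto_unique[OF F(1) Y[OF s]] by blast
    qed
    ultimately show ?thesis by (simp add: h_def prod_eq_iff)
  qed
  have "h 0 = 0" by (rule h_eqI) (auto simp: I_def horizontalD(1)[OF g])
  moreover have "increment (h s) (h t) \<in> short (L' * (t - s))" if st: "0 \<le> s" "s \<le> t" "t \<le> 1" for s t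
  proof -
    have I: "s \<in> I" "t \<in> I" using st by (auto simp: I_def)
    have inc: "increment (g n s) (g n t) \<in> short (L n * (t - s))" for n
      by (rule horizontalD(2)[OF g st])
    have Lst: "L n * (t - s) \<ge> 0" for n using st horizontal_nonneg[OF g[of n]] by simp
    have L'st: "L' * (t - s) \<ge> 0"
      by (rule tendsto_lowerbound[OF tendsto_mult[OF L_F tendsto_const] _ F(1)])
         (use Lst in \<open>auto intro: always_eventually\<close>)
    have "norm (y t - y s) \<le> L' * (t - s)"
    proof (cases "y t - y s = 0")
      case False
      define v where "v = y t - y s"
      have "((\<lambda>n. (fst (g n t) - fst (g n s)) \<bullet> v) \<longlongrightarrow> v \<bullet> v) F"
        unfolding v_def inner_diff_left[of _ _ "y t - y s"] by (intro tendsto_intros y I)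
      moreover have "((\<lambda>n. L n * (t - s) * norm v) \<longlongrightarrow> L' * (t - s) * norm v) F"
        by (intro tendsto_intros L_F)
      moreover have "(fst (g n t) - fst (g n s)) \<bullet> v \<le> L n * (t - s) * norm v" for n
        using inc[of n]
        by (intro order_trans[OF norm_cauchy_schwarz] mult_right_mono) (auto simp: short_def fst_increment)
      ultimately have "v \<bullet> v \<le> L' * (t - s) * norm v"
        by (intro tendsto_le[OF F(1)]) (auto intro: always_eventually)
      then show ?thesis
        using False by (simp add: v_def power2_norm_eq_inner[symmetric] power2_eq_square)
    qed (use L'st in simp)
    moreover have "norm (Y t - Y s - (1/2) *\<^sub>R wedge (y s) (y t)) \<le> (L' * (t - s))\<^sup>2"
    proof (rule norm_blinfun_bound)
      fix v
      let ?B = "Y t - Y s - (1/2) *\<^sub>R wedge (y s) (y t)"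
      define w where "w = blinfun_apply ?B v"
      have "((\<lambda>n. (snd (increment (g n s) (g n t))) v \<bullet> w) \<longlongrightarrow> blinfun_apply ?B v \<bullet> w) F"
        unfolding snd_increment blinfun.diff_left blinfun.scaleR_left inner_diff_left inner_scaleR_left
          inner_wedge
        by (intro tendsto_intros y Y I)
      moreover have "((\<lambda>n. (L n * (t - s))\<^sup>2 * norm v * norm w) \<longlongrightarrow> (L' * (t - s))\<^sup>2 * norm v * norm w) F"
        by (intro tendsto_intros L_F)
      moreover have "(snd (increment (g n s) (g n t))) v \<bullet> w
          \<le> (L n * (t - s))\<^sup>2 * norm v * norm w" for n
        using inc[of n]
        by (intro order_trans[OF norm_cauchy_schwarz] mult_right_mono order_trans[OF norm_blinfun])
           (auto simp: short_def)
      ultimately have "blinfun_apply ?B v \<bullet> w \<le> (L' * (t - s))\<^sup>2 * norm v * norm w"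
        by (intro tendsto_le[OF F(1)]) (auto intro: always_eventually)
      then have "norm w * norm w \<le> (L' * (t - s))\<^sup>2 * norm v * norm w"
        by (simp add: w_def[symmetric] power2_norm_eq_inner[symmetric] power2_eq_square)
      then show "norm (blinfun_apply ?B v) \<le> (L' * (t - s))\<^sup>2 * norm v"
        by (cases "w = 0") (auto simp: w_def)
    qed simp
    ultimately show ?thesis by (simp add: short_def fst_increment snd_increment h_def)
  qed
  moreover have "h 1 = x"
    by (rule h_eqI) (auto simp: I_def intro!: filterlim_mono[OF x order_refl F(2)])
  ultimately show ?thesis using that[of h] by (simp add: horizontal_def)
qed

section \<open>Integrals of strongly measurable functions\<close>

abbreviation leb01 :: "real measure" where "leb01 \<equiv> lebesgue_on {0..1}"

lemma finite_measure_leb01: "finite_measure leb01"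
  by (rule finite_measureI) (simp add: emeasure_restrict_space)

lemma null_leb01_negligible: "N \<in> null_sets leb01 \<Longrightarrow> negligible N"
  by (simp add: negligible_iff_null_sets null_sets_restrict_space)

text \<open>
  For an integrable \<open>\<parallel>f - s\<parallel>\<close> the Riemann sums of \<open>f\<close> differ from those of \<open>s\<close> by
  no more than the Riemann sums of \<open>\<parallel>f - s\<parallel>\<close>, so Cauchy's criterion passes to limits in mean.
\<close>

lemma integrable_on_approx:
  fixes f :: "real \<Rightarrow> 'c::banach"
  assumes approx: "\<And>e. e > 0 \<Longrightarrow> \<exists>s. s integrable_on {a..b} \<and>
      (\<lambda>t. norm (f t - s t)) integrable_on {a..b} \<and> integral {a..b} (\<lambda>t. norm (f t - s t)) < e"
  shows "f integrable_on {a..b}"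
  unfolding box_real(2)[symmetric] integrable_Cauchy
proof (intro allI impI)
  fix e :: real assume e: "e > 0"
  then obtain s where s: "s integrable_on {a..b}" and h: "(\<lambda>t. norm (f t - s t)) integrable_on {a..b}"
    and small: "integral {a..b} (\<lambda>t. norm (f t - s t)) < e / 6"
    using approx[of "e / 6"] by auto
  obtain d1 where d1: "gauge d1" "\<And>D. D tagged_division_of cbox a b \<Longrightarrow> d1 fine D \<Longrightarrow>
      norm ((\<Sum>(x,K)\<in>D. measure lborel K *\<^sub>R s x) - integral {a..b} s) < e / 6"
    using integrable_integral[OF s, unfolded box_real(2)[symmetric] has_integral, rule_format, of "e / 6"] e
    by auto
  obtain d2 where d2: "gauge d2" "\<And>D. D tagged_division_of cbox a b \<Longrightarrow> d2 fine D \<Longrightarrow>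
      norm ((\<Sum>(x,K)\<in>D. measure lborel K *\<^sub>R norm (f x - s x)) - integral {a..b} (\<lambda>t. norm (f t - s t))) < e / 6"
    using integrable_integral[OF h, unfolded box_real(2)[symmetric] has_integral, rule_format, of "e / 6"] e
    by auto
  have main: "norm ((\<Sum>(x,K)\<in>D. measure lborel K *\<^sub>R f x) - integral {a..b} s) < e / 2"
    if D: "D tagged_division_of cbox a b" "(\<lambda>x. d1 x \<inter> d2 x) fine D" for D
  proof -
    have fine: "d1 fine D" "d2 fine D" using D(2) by (auto simp: fine_def)
    have "(\<Sum>(x,K)\<in>D. measure lborel K *\<^sub>R f x) - (\<Sum>(x,K)\<in>D. measure lborel K *\<^sub>R s x)
        = (\<Sum>(x,K)\<in>D. measure lborel K *\<^sub>R (f x - s x))"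
      by (simp add: sum_subtractf[symmetric] case_prod_unfold scaleR_diff_right)
    moreover have "norm (\<Sum>(x,K)\<in>D. measure lborel K *\<^sub>R (f x - s x)) \<le> (\<Sum>(x,K)\<in>D. measure lborel K *\<^sub>R norm (f x - s x))"
      by (rule sum_norm_le) (auto simp: case_prod_unfold)
    ultimately have "norm ((\<Sum>(x,K)\<in>D. measure lborel K *\<^sub>R f x) - integral {a..b} s)
        \<le> (\<Sum>(x,K)\<in>D. measure lborel K *\<^sub>R norm (f x - s x)) + norm ((\<Sum>(x,K)\<in>D. measure lborel K *\<^sub>R s x) - integral {a..b} s)"
      by (smt (verit, best) diff_add_cancel diff_diff_eq2 norm_triangle_ineq add_diff_eq)
    moreover have "(\<Sum>(x,K)\<in>D. measure lborel K *\<^sub>R norm (f x - s x)) < e / 3"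
      using d2(2)[OF D(1) fine(2)] small unfolding real_norm_def abs_less_iff by linarith
    ultimately show ?thesis using d1(2)[OF D(1) fine(1)] by linarith
  qed
  show "\<exists>\<gamma>. gauge \<gamma> \<and> (\<forall>\<D>1 \<D>2. \<D>1 tagged_division_of cbox a b \<and> \<gamma> fine \<D>1 \<and>
      \<D>2 tagged_division_of cbox a b \<and> \<gamma> fine \<D>2 \<longrightarrow>
      norm ((\<Sum>(x,K)\<in>\<D>1. measure lborel K *\<^sub>R f x) - (\<Sum>(x,K)\<in>\<D>2. measure lborel K *\<^sub>R f x)) < e)"
  proof (intro exI[of _ "\<lambda>x. d1 x \<inter> d2 x"] conjI allI impI)
    show "gauge (\<lambda>x. d1 x \<inter> d2 x)" using d1(1) d2(1) by (rule gauge_Int)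
  next
    fix D1 D2
    assume "D1 tagged_division_of cbox a b \<and> (\<lambda>x. d1 x \<inter> d2 x) fine D1 \<and>
      D2 tagged_division_of cbox a b \<and> (\<lambda>x. d1 x \<inter> d2 x) fine D2"
    then show "norm ((\<Sum>(x,K)\<in>D1. measure lborel K *\<^sub>R f x) - (\<Sum>(x,K)\<in>D2. measure lborel K *\<^sub>R f x)) < e"
      by (intro norm_triangle_half_l[OF main main]) auto
  qed
qed

lemma simple_function_integrable_on:
  fixes s :: "real \<Rightarrow> 'c::banach"
  assumes s: "simple_function leb01 s"
  shows "s integrable_on {0..1}"
proof -
  have fin: "finite (s ` {0..1})" and meas: "\<And>v. s -` {v} \<inter> {0..1} \<in> sets leb01"
    using simple_functionD[OF s] by simp_all
  have "(\<lambda>t. indicator (s -` {v} \<inter> {0..1}) t *\<^sub>R v) integrable_on {0..1}" for v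
  proof -
    have "integrable leb01 (indicator (s -` {v} \<inter> {0..1}) :: real \<Rightarrow> real)"
      using meas[of v] finite_measure.emeasure_finite[OF finite_measure_leb01]
      by (intro integrable_real_indicator) (auto simp: less_top)
    then have "(indicator (s -` {v} \<inter> {0..1}) :: real \<Rightarrow> real) integrable_on {0..1}"
      by (rule integrable_on_lebesgue_on) simp
    from integrable_linear[OF this bounded_linear_scaleR_left[of v]] show ?thesis
      by (simp add: o_def)
  qed
  then have "(\<lambda>t. \<Sum>v\<in>s ` {0..1}. indicator (s -` {v} \<inter> {0..1}) t *\<^sub>R v) integrable_on {0..1}"
    by (intro integrable_sum fin)
  moreover have "(\<Sum>v\<in>s ` {0..1}. indicator (s -` {v} \<inter> {0..1}) t *\<^sub>R v) = s t" if "t \<in> {0..1}" for t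
  proof -
    have "(\<Sum>v\<in>s ` {0..1}. indicator (s -` {v} \<inter> {0..1}) t *\<^sub>R v) = (\<Sum>v\<in>s ` {0..1}. if v = s t then v else 0)"
      using that by (intro sum.cong) (auto simp: indicator_def)
    then show ?thesis using that fin by simp
  qed
  ultimately show ?thesis by (rule integrable_eq) 
qed

lemma measurable_leb01_AE:
  fixes f g :: "real \<Rightarrow> real"
  assumes f: "f \<in> borel_measurable leb01" and N: "N \<in> null_sets leb01"
    and eq: "\<And>t. t \<in> {0..1} \<Longrightarrow> t \<notin> N \<Longrightarrow> f t = g t"
  shows "g \<in> borel_measurable leb01"
proof -
  have "(\<lambda>t. if t \<in> {0..1} then f t else 0) \<in> borel_measurable lebesgue"
    using borel_measurable_if[of "{0..1}" f] f by (simp del: atLeastAtMost_iff)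
  moreover have "AE t in lebesgue. (if t \<in> {0..1} then f t else 0) = (if t \<in> {0..1} then g t else 0)"
    by (rule AE_I'[of N]) (use N eq in \<open>auto simp: null_sets_restrict_space\<close>)
  ultimately have "(\<lambda>t. if t \<in> {0..1} then g t else 0) \<in> borel_measurable lebesgue"
    by (rule borel_measurable_AE)
  then show ?thesis using borel_measurable_if[of "{0..1}" g] by (simp del: atLeastAtMost_iff)
qed

lemma strongly_measurableE:
  assumes "strongly_measurable leb01 f"
  obtains s N where "\<And>i. simple_function leb01 (s i)" "N \<in> null_sets leb01"
    "\<And>t. t \<in> {0..1} \<Longrightarrow> t \<notin> N \<Longrightarrow> (\<lambda>i::nat. s i t) \<longlonglongrightarrow> f t"
proof -
  obtain s where s: "\<And>i. simple_function leb01 (s i)" "AE t in leb01. (\<lambda>i::nat. s i t) \<longlonglongrightarrow> f t"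
    using assms by (auto simp: strongly_measurable_def)
  show ?thesis
  proof (rule AE_E3[OF s(2)])
    fix N assume "\<And>t. t \<in> space leb01 - N \<Longrightarrow> (\<lambda>i::nat. s i t) \<longlonglongrightarrow> f t" and "N \<in> null_sets leb01"
    then show ?thesis by (intro that[of s N] s(1)) simp_all
  qed
qed

lemma null_set_pred: "N \<in> null_sets M \<Longrightarrow> {t \<in> space M. t \<in> N} \<in> sets M"
proof -
  assume "N \<in> null_sets M"
  then have "space M \<inter> N \<in> sets M" by (intro sets.Int sets.top null_setsD2)
  then show ?thesis by (simp add: Int_def)
qed

lemma simple_function_norm_measurable:
  fixes s :: "'b \<Rightarrow> 'c::real_normed_vector"
  assumes "simple_function M s"
  shows "(\<lambda>t. norm (s t)) \<in> borel_measurable M"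
  by (rule borel_measurable_simple_function, rule simple_function_compose1[OF assms])

text \<open>
  The simple functions converge only almost everywhere; completeness of Lebesgue measure still makes
  the limit measurable.
\<close>

lemma strongly_measurable_norm:
  fixes f :: "real \<Rightarrow> 'c::real_normed_vector"
  assumes "strongly_measurable leb01 f"
  shows "(\<lambda>t. norm (f t)) \<in> borel_measurable leb01"
proof -
  obtain s N where s: "\<And>i. simple_function leb01 (s i)" and N: "N \<in> null_sets leb01"
    and lim: "\<And>t. t \<in> {0..1} \<Longrightarrow> t \<notin> N \<Longrightarrow> (\<lambda>i::nat. s i t) \<longlonglongrightarrow> f t"
    using strongly_measurableE[OF assms] by blast
  have "(\<lambda>t. if t \<in> N then 0 else norm (f t)) \<in> borel_measurable leb01"
  proof (rule borel_measurable_LIMSEQ_real)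
    show "(\<lambda>i. if t \<in> N then 0 else norm (s i t)) \<longlonglongrightarrow> (if t \<in> N then 0 else norm (f t))"
      if "t \<in> space leb01" for t
      using lim[of t] that by (auto intro: tendsto_norm)
    show "(\<lambda>t. if t \<in> N then 0 else norm (s i t)) \<in> borel_measurable leb01" for i
      by (intro measurable_If simple_function_norm_measurable[OF s] null_set_pred[OF N]) simp
  qed
  then show ?thesis by (rule measurable_leb01_AE[OF _ N]) simp
qed

lemma strongly_measurable_simple: "simple_function M s \<Longrightarrow> strongly_measurable M s"
  unfolding strongly_measurable_def by (intro exI[of _ "\<lambda>_. s"]) auto

lemma strongly_measurable_compose2:
  assumes f: "strongly_measurable M f" and g: "strongly_measurable M g"
    and h: "\<And>s r x y. s \<longlonglongrightarrow> x \<Longrightarrow> r \<longlonglongrightarrow> y \<Longrightarrow> (\<lambda>i::nat. h (s i) (r i)) \<longlonglongrightarrow> h x y"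
  shows "strongly_measurable M (\<lambda>t. h (f t) (g t))"
proof -
  obtain s where s: "\<And>i. simple_function M (s i)" "AE t in M. (\<lambda>i::nat. s i t) \<longlonglongrightarrow> f t"
    using f by (auto simp: strongly_measurable_def)
  obtain r where r: "\<And>i. simple_function M (r i)" "AE t in M. (\<lambda>i::nat. r i t) \<longlonglongrightarrow> g t"
    using g by (auto simp: strongly_measurable_def)
  have "AE t in M. (\<lambda>i. h (s i t) (r i t)) \<longlonglongrightarrow> h (f t) (g t)"
    using s(2) r(2) by eventually_elim (rule h)
  moreover have "simple_function M (\<lambda>t. h (s i t) (r i t))" for i
    by (rule simple_function_compose2[OF s(1) r(1)])
  ultimately show ?thesis unfolding strongly_measurable_def
    by (intro exI[of _ "\<lambda>i t. h (s i t) (r i t)"] conjI allI)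
qed

lemma simple_function_grid: "simple_function leb01 (\<lambda>t. c (nat \<lfloor>real n * t\<rfloor>))"
proof -
  have "simple_function leb01 (\<lambda>t. nat \<lfloor>real n * t\<rfloor>)"
  proof (rule simple_function_borel_measurable)
    show "(\<lambda>t. nat \<lfloor>real n * t\<rfloor>) \<in> borel_measurable leb01"
      by (intro measurable_restrict_space1 measurable_completion) simp
    have "nat \<lfloor>real n * t\<rfloor> \<le> n" if "t \<in> {0..1}" for t :: real
    proof -
      have "real n * t \<le> real n" using that by (simp add: mult_left_le)
      then show ?thesis by linarith
    qed
    then have "(\<lambda>t. nat \<lfloor>real n * t\<rfloor>) ` space leb01 \<subseteq> {..n}" by force
    then show "finite ((\<lambda>t. nat \<lfloor>real n * t\<rfloor>) ` space leb01)"
      by (rule finite_subset) simp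
  qed
  then show ?thesis by (rule simple_function_compose1)
qed

text \<open>
  Sampling at the left end points of a grid.
\<close>

lemma strongly_measurable_continuous:
  assumes "continuous_on {0..1} f"
  shows "strongly_measurable leb01 f"
  unfolding strongly_measurable_def
proof (intro exI[of _ "\<lambda>n t. f (real (nat \<lfloor>real (Suc n) * t\<rfloor>) / real (Suc n))"] conjI allI)
  show "simple_function leb01 (\<lambda>t. f (real (nat \<lfloor>real (Suc n) * t\<rfloor>) / real (Suc n)))" for n
    by (rule simple_function_grid[of "\<lambda>k. f (real k / real (Suc n))"])
  have "(\<lambda>n. f (real (nat \<lfloor>real (Suc n) * t\<rfloor>) / real (Suc n))) \<longlonglongrightarrow> f t" if t: "t \<in> {0..1}" for t
  proof (rule continuous_on_tendsto_compose[OF assms _ t])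
    have b: "real (nat \<lfloor>real (Suc n) * t\<rfloor>) / real (Suc n) \<le> t"
      "t - 1 / real (Suc n) \<le> real (nat \<lfloor>real (Suc n) * t\<rfloor>) / real (Suc n)" for n
    proof -
      have "0 \<le> real (Suc n) * t" using t by simp
      then have "real (nat \<lfloor>real (Suc n) * t\<rfloor>) \<le> real (Suc n) * t"
        "real (Suc n) * t - 1 \<le> real (nat \<lfloor>real (Suc n) * t\<rfloor>)" by linarith+
      then show "real (nat \<lfloor>real (Suc n) * t\<rfloor>) / real (Suc n) \<le> t"
        "t - 1 / real (Suc n) \<le> real (nat \<lfloor>real (Suc n) * t\<rfloor>) / real (Suc n)"
        by (simp_all add: divide_simps mult.commute)
    qed
    have lo: "(\<lambda>n. t - 1 / real (Suc n)) \<longlonglongrightarrow> t"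
      using tendsto_diff[OF tendsto_const LIMSEQ_inverse_real_of_nat, of t] by (simp add: inverse_eq_divide)
    show "(\<lambda>n. real (nat \<lfloor>real (Suc n) * t\<rfloor>) / real (Suc n)) \<longlonglongrightarrow> t"
      by (rule tendsto_sandwich[OF always_eventually always_eventually lo tendsto_const]) (use b in blast)+
    show "\<forall>\<^sub>F n in sequentially. real (nat \<lfloor>real (Suc n) * t\<rfloor>) / real (Suc n) \<in> {0..1}"
    proof (intro always_eventually allI)
      fix n
      show "real (nat \<lfloor>real (Suc n) * t\<rfloor>) / real (Suc n) \<in> {0..1}"
        using order_trans[OF b(1)[of n], of 1] t by simp
    qed
  qed
  then show "AE t in leb01. (\<lambda>n. f (real (nat \<lfloor>real (Suc n) * t\<rfloor>) / real (Suc n))) \<longlonglongrightarrow> f t"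
    by (intro AE_I2) simp
qed

text \<open>
  Bochner integrable functions with values in an arbitrary Banach space are Henstock--Kurzweil
  integrable, as they are limits in mean of simple functions.
\<close>

lemma strongly_measurable_integrable_on:
  fixes f :: "real \<Rightarrow> 'c::banach"
  assumes f: "strongly_measurable leb01 f" and int: "integrable leb01 (\<lambda>t. norm (f t))"
  shows "f integrable_on {0..1}"
proof -
  obtain s N where s: "\<And>i. simple_function leb01 (s i)" and N: "N \<in> null_sets leb01"
    and lim: "\<And>t. t \<in> {0..1} \<Longrightarrow> t \<notin> N \<Longrightarrow> (\<lambda>i::nat. s i t) \<longlonglongrightarrow> f t"
    using strongly_measurableE[OF f] by blast
  note Nmeas = null_set_pred[OF N]
  define f' where "f' t = (if t \<in> N then 0 else f t)" for t
  \<comment> \<open>Cutting off where \<open>s i\<close> exceeds \<open>2 \<parallel>f\<parallel>\<close> keeps the pointwise limit and provides a majorant.\<close>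
  define r where "r i t = (if t \<in> N \<or> 2 * norm (f' t) < norm (s i t) then 0 else s i t)" for i t
  have f'_int: "integrable leb01 (\<lambda>t. norm (f' t))"
  proof -
    have "(\<lambda>t. if t \<in> N then 0 else norm (f t)) \<in> borel_measurable leb01"
      by (intro measurable_If borel_measurable_integrable[OF int] Nmeas) simp
    then show ?thesis
      by (intro Bochner_Integration.integrable_bound[OF int]) (auto simp: f'_def if_distrib cong: if_cong)
  qed
  have r_simple: "simple_function leb01 (r i)" for i
  proof -
    have "{t \<in> space leb01. 2 * norm (f' t) < norm (s i t)} \<in> sets leb01"
      by (intro borel_measurable_less simple_function_norm_measurable[OF s] borel_measurable_times
        borel_measurable_const borel_measurable_integrable[OF f'_int])
    then have "{t \<in> space leb01. t \<in> N \<or> 2 * norm (f' t) < norm (s i t)} \<in> sets leb01"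
      using Nmeas by (rule sets.sets_Collect_disj)
    then show ?thesis unfolding r_def by (intro simple_function_If s simple_function_const)
  qed
  have r_lim: "(\<lambda>i. r i t) \<longlonglongrightarrow> f' t" if t: "t \<in> {0..1}" for t
  proof (cases "t \<in> N \<or> f' t = 0")
    case True
    then have "r i t = 0" for i by (auto simp: r_def f'_def)
    then show ?thesis using True by (auto simp: f'_def)
  next
    case False
    then have l: "(\<lambda>i. s i t) \<longlonglongrightarrow> f' t" using lim[OF t] by (simp add: f'_def)
    have "norm (f' t) < 2 * norm (f' t)" using False by simp
    then have "\<forall>\<^sub>F i in sequentially. norm (s i t) < 2 * norm (f' t)"
      by (rule order_tendstoD(2)[OF tendsto_norm[OF l]])
    then have "\<forall>\<^sub>F i in sequentially. s i t = r i t"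
      by eventually_elim (use False in \<open>auto simp: r_def\<close>)
    then show ?thesis using l by (rule Lim_transform_eventually[rotated])
  qed
  have r_bound: "norm (f' t - r i t) \<le> 3 * norm (f' t)" for i t
    using norm_triangle_ineq4[of "f' t" "r i t"] by (auto simp: r_def)
  have diff_meas: "(\<lambda>t. norm (f' t - r i t)) \<in> borel_measurable leb01" for i
  proof (rule borel_measurable_LIMSEQ_real)
    show "(\<lambda>j. norm (r j t - r i t)) \<longlonglongrightarrow> norm (f' t - r i t)" if "t \<in> space leb01" for t
      using r_lim[of t] that by (intro tendsto_intros) simp
    show "(\<lambda>t. norm (r j t - r i t)) \<in> borel_measurable leb01" for j
      by (rule simple_function_norm_measurable[OF simple_function_compose2[OF r_simple r_simple]])
  qed
  have maj: "integrable leb01 (\<lambda>t. 3 * norm (f' t))" using f'_int by simp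
  have diff_int: "integrable leb01 (\<lambda>t. norm (f' t - r i t))" for i
    by (rule Bochner_Integration.integrable_bound[OF maj diff_meas]) (use r_bound in auto)
  have "(\<lambda>i. LINT t|leb01. norm (f' t - r i t)) \<longlonglongrightarrow> (LINT t|leb01. 0)"
  proof (rule integral_dominated_convergence[where w = "\<lambda>t. 3 * norm (f' t)"])
    show "AE t in leb01. (\<lambda>i. norm (f' t - r i t)) \<longlonglongrightarrow> 0"
    proof (intro AE_I2)
      fix t assume "t \<in> space leb01"
      then have "(\<lambda>i. norm (f' t - r i t)) \<longlonglongrightarrow> norm (f' t - f' t)"
        by (intro tendsto_intros r_lim) simp
      then show "(\<lambda>i. norm (f' t - r i t)) \<longlonglongrightarrow> 0" by simp
    qed
  qed (use maj diff_meas r_bound in auto)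
  then have small: "(\<lambda>i. LINT t|leb01. norm (f' t - r i t)) \<longlonglongrightarrow> 0" by simp
  have "f' integrable_on {0..1}"
  proof (rule integrable_on_approx)
    fix e :: real assume "e > 0"
    with small have "\<forall>\<^sub>F i in sequentially. (LINT t|leb01. norm (f' t - r i t)) < e"
      by (rule order_tendstoD(2))
    then obtain i where "(LINT t|leb01. norm (f' t - r i t)) < e"
      using eventually_happens'[OF sequentially_bot] by blast
    moreover have "(LINT t|leb01. norm (f' t - r i t)) = integral {0..1} (\<lambda>t. norm (f' t - r i t))"
      by (rule lebesgue_integral_eq_integral[OF diff_int]) simp
    ultimately show "\<exists>s. s integrable_on {0..1} \<and> (\<lambda>t. norm (f' t - s t)) integrable_on {0..1} \<and>
        integral {0..1} (\<lambda>t. norm (f' t - s t)) < e"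
      using simple_function_integrable_on[OF r_simple] integrable_on_lebesgue_on[OF diff_int]
      by (intro exI[of _ "r i"] conjI) auto
  qed
  then show ?thesis
    by (rule integrable_spike[OF _ null_leb01_negligible[OF N]]) (auto simp: f'_def)
qed

section \<open>Controls generate horizontal curves\<close>

lemma L1_integrable:
  assumes u: "u \<in> L1" and ab: "0 \<le> a" "b \<le> 1"
  shows "u integrable_on {a..b}" "(\<lambda>t. norm (u t)) integrable_on {a..b}"
proof -
  have "u integrable_on {0..1}" "(\<lambda>t. norm (u t)) integrable_on {0..1}"
    using u by (auto simp: L1_def intro: strongly_measurable_integrable_on integrable_on_lebesgue_on)
  then show "u integrable_on {a..b}" "(\<lambda>t. norm (u t)) integrable_on {a..b}"
    using ab by (auto intro: integrable_on_subinterval)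
qed

lemma L1_norm_eq: "u \<in> L1 \<Longrightarrow> L1_norm u = integral {0..1} (\<lambda>t. norm (u t))"
  unfolding L1_norm_def by (rule lebesgue_integral_eq_integral) (auto simp: L1_def)

definition arc_length :: "(real \<Rightarrow> 'a::{real_inner,banach}) \<Rightarrow> real \<Rightarrow> real" where
  "arc_length u t = integral {0..t} (\<lambda>s. norm (u s))"

lemma arc_length_diff:
  assumes "u \<in> L1" "0 \<le> a" "a \<le> b" "b \<le> 1"
  shows "arc_length u b - arc_length u a = integral {a..b} (\<lambda>s. norm (u s))"
    "norm (integral {a..b} u) \<le> arc_length u b - arc_length u a"
    "arc_length u a \<le> arc_length u b"
proof -
  show eq: "arc_length u b - arc_length u a = integral {a..b} (\<lambda>s. norm (u s))"
    using Henstock_Kurzweil_Integration.integral_combine[of 0 a b "\<lambda>s. norm (u s)"] L1_integrable(2)[of u 0 b] assms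
    by (simp add: arc_length_def)
  show "norm (integral {a..b} u) \<le> arc_length u b - arc_length u a"
    unfolding eq by (rule integral_norm_bound_integral) (use L1_integrable[of u a b] assms in auto)
  have "0 \<le> integral {a..b} (\<lambda>s. norm (u s))"
    by (rule integral_nonneg) (use L1_integrable[of u a b] assms in auto)
  then show "arc_length u a \<le> arc_length u b" using eq by simp
qed

lemma Gamma1_diff:
  assumes "u \<in> L1" "0 \<le> a" "a \<le> b" "b \<le> 1"
  shows "Gamma1 u b - Gamma1 u a = integral {a..b} u"
  using Henstock_Kurzweil_Integration.integral_combine[of 0 a b u] L1_integrable(1)[of u 0 b] assms
  by (simp add: Gamma1_def algebra_simps)

lemma continuous_on_Gamma1: "u \<in> L1 \<Longrightarrow> continuous_on {0..1} (Gamma1 u)"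
  unfolding Gamma1_def by (rule indefinite_integral_continuous_1) (rule L1_integrable, auto)

text \<open>
  The integrand is strongly measurable and dominated by a multiple of \<open>\<parallel>u\<parallel>\<close>, because \<open>\<gamma>\<close> is
  bounded.
\<close>

lemma wedge_Gamma1_integrable:
  assumes u: "u \<in> L1" and ab: "0 \<le> a" "b \<le> 1"
  shows "(\<lambda>s. wedge (Gamma1 u s) (u s)) integrable_on {a..b}"
proof -
  have sm: "strongly_measurable leb01 (\<lambda>s. wedge (Gamma1 u s) (u s))"
    by (rule strongly_measurable_compose2[OF strongly_measurable_continuous[OF continuous_on_Gamma1[OF u]] _
          bounded_bilinear.tendsto[OF bounded_bilinear_wedge]])
       (use u in \<open>auto simp: L1_def\<close>)
  have "compact (Gamma1 u ` {0..1})"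
    by (rule compact_continuous_image[OF continuous_on_Gamma1[OF u]]) simp
  then have "bounded (Gamma1 u ` {0..1})" by (rule compact_imp_bounded)
  then obtain C where "\<forall>y\<in>Gamma1 u ` {0..1}. norm y \<le> C" unfolding bounded_iff by blast
  then have C: "norm (Gamma1 u s) \<le> C" if "s \<in> {0..1}" for s using that by blast
  have "integrable leb01 (\<lambda>s. norm (u s))"
    using u by (simp add: L1_def)
  then have "integrable leb01 (\<lambda>s. (2 * C) * norm (u s))" by simp
  then have "integrable leb01 (\<lambda>s. norm (wedge (Gamma1 u s) (u s)))"
  proof (rule Bochner_Integration.integrable_bound[OF _ strongly_measurable_norm[OF sm]])
    have "norm (wedge (Gamma1 u s) (u s)) \<le> 2 * C * norm (u s)" if "s \<in> {0..1}" for s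
      using norm_wedge_le[of "Gamma1 u s" "u s"] mult_right_mono[OF C[OF that], of "norm (u s)"] by simp
    then show "AE s in leb01. norm (norm (wedge (Gamma1 u s) (u s))) \<le> norm (2 * C * norm (u s))"
      by (intro AE_I2) force
  qed
  from strongly_measurable_integrable_on[OF sm this] show ?thesis
    using ab by (auto intro: integrable_on_subinterval)
qed

text \<open>Seen from \<open>Gamma u a\<close>, the area swept between \<open>a\<close> and \<open>b\<close> is that of the translated curve.\<close>

lemma Gamma_increment:
  assumes u: "u \<in> L1" and ab: "0 \<le> a" "a \<le> b" "b \<le> 1"
  shows "increment (Gamma u a) (Gamma u b) \<in> short (arc_length u b - arc_length u a)"
proof -
  define l where "l = arc_length u b - arc_length u a"
  have l0: "0 \<le> l" using arc_length_diff(3)[OF u ab] by (simp add: l_def)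
  define \<gamma> where "\<gamma> = Gamma1 u"
  have wi: "(\<lambda>s. wedge (\<gamma> s) (u s)) integrable_on {a..b}" "(\<lambda>s. wedge (\<gamma> s) (u s)) integrable_on {0..b}"
    using wedge_Gamma1_integrable[OF u] ab by (auto simp: \<gamma>_def)
  have ui: "u integrable_on {a..b}" "(\<lambda>s. norm (u s)) integrable_on {a..b}"
    using L1_integrable[OF u] ab by auto
  have lin: "integral {a..b} (\<lambda>s. wedge (\<gamma> a) (u s)) = wedge (\<gamma> a) (integral {a..b} u)"
      "(\<lambda>s. wedge (\<gamma> a) (u s)) integrable_on {a..b}"
    using integral_linear[OF ui(1) bounded_bilinear.bounded_linear_right[OF bounded_bilinear_wedge, of "\<gamma> a"]]
      integrable_linear[OF ui(1) bounded_bilinear.bounded_linear_right[OF bounded_bilinear_wedge, of "\<gamma> a"]]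
    by (simp_all add: o_def)
  have "integral {0..a} (\<lambda>s. wedge (\<gamma> s) (u s)) + integral {a..b} (\<lambda>s. wedge (\<gamma> s) (u s))
      = integral {0..b} (\<lambda>s. wedge (\<gamma> s) (u s))"
    by (rule Henstock_Kurzweil_Integration.integral_combine) (use ab wi in auto)
  then have "integral {a..b} (\<lambda>s. wedge (\<gamma> s) (u s))
      = integral {0..b} (\<lambda>s. wedge (\<gamma> s) (u s)) - integral {0..a} (\<lambda>s. wedge (\<gamma> s) (u s))"
    by (simp add: eq_diff_eq add.commute)
  then have "Gamma2 u b - Gamma2 u a = (1/2) *\<^sub>R integral {a..b} (\<lambda>s. wedge (\<gamma> s) (u s))"
    by (simp add: Gamma2_def \<gamma>_def scaleR_diff_right)
  moreover have "wedge (\<gamma> a) (\<gamma> b) = integral {a..b} (\<lambda>s. wedge (\<gamma> a) (u s))"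
    unfolding lin(1) using Gamma1_diff[OF u ab, symmetric] by (simp add: \<gamma>_def wedge_diff_right)
  ultimately have "snd (increment (Gamma u a) (Gamma u b))
      = (1/2) *\<^sub>R (integral {a..b} (\<lambda>s. wedge (\<gamma> s) (u s)) - integral {a..b} (\<lambda>s. wedge (\<gamma> a) (u s)))"
    by (simp add: snd_increment Gamma_def \<gamma>_def scaleR_diff_right)
  also have "\<dots> = (1/2) *\<^sub>R integral {a..b} (\<lambda>s. wedge (\<gamma> s - \<gamma> a) (u s))"
    using integral_diff[OF wi(1) lin(2)] by (simp add: wedge_diff_left)
  finally have snd: "snd (increment (Gamma u a) (Gamma u b))
    = (1/2) *\<^sub>R integral {a..b} (\<lambda>s. wedge (\<gamma> s - \<gamma> a) (u s))" .
  have near: "norm (\<gamma> s - \<gamma> a) \<le> l" if "s \<in> {a..b}" for s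
  proof -
    have "norm (\<gamma> s - \<gamma> a) \<le> arc_length u s - arc_length u a"
      unfolding \<gamma>_def using that ab by (subst Gamma1_diff[OF u]) (auto intro: arc_length_diff(2)[OF u])
    also have "\<dots> \<le> l" unfolding l_def using arc_length_diff(3)[OF u, of s b] that ab by simp
    finally show ?thesis .
  qed
  have "norm (integral {a..b} (\<lambda>s. wedge (\<gamma> s - \<gamma> a) (u s))) \<le> integral {a..b} (\<lambda>s. 2 * l * norm (u s))"
  proof (rule integral_norm_bound_integral)
    show "(\<lambda>s. wedge (\<gamma> s - \<gamma> a) (u s)) integrable_on {a..b}"
      unfolding wedge_diff_left by (intro integrable_diff wi lin)
    show "(\<lambda>s. 2 * l * norm (u s)) integrable_on {a..b}" using ui(2) by (rule integrable_on_mult_right)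
    show "norm (wedge (\<gamma> s - \<gamma> a) (u s)) \<le> 2 * l * norm (u s)" if "s \<in> {a..b}" for s
      using norm_wedge_le[of "\<gamma> s - \<gamma> a" "u s"] mult_right_mono[OF near[OF that], of "norm (u s)"] by simp
  qed
  also have "\<dots> = 2 * l * l" using arc_length_diff(1)[OF u ab] by (simp add: l_def)
  finally have "norm (snd (increment (Gamma u a) (Gamma u b))) \<le> l\<^sup>2"
    unfolding snd by (simp add: power2_eq_square)
  moreover have "norm (fst (increment (Gamma u a) (Gamma u b))) \<le> l"
    using near[of b] ab by (simp add: fst_increment Gamma_def \<gamma>_def)
  ultimately show ?thesis by (simp add: short_def l_def)
qed

lemma Gamma_0 [simp]: "Gamma u 0 = 0"
  by (simp add: Gamma_def Gamma1_def Gamma2_def zero_prod_def)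

text \<open>
  Parametrisation proportional to arc length, by the intermediate value theorem.  For \<open>L = 0\<close> the
  parameters found in this way need not be ordered, but then the increments are trivial in either
  direction.
\<close>

lemma control_imp_horizontal:
  assumes u: "u \<in> L1"
  obtains g where "horizontal (L1_norm u) g" "g 1 = Gamma u 1"
proof -
  define L where "L = L1_norm u"
  have l1: "arc_length u 1 = L" "arc_length u 0 = 0"
    by (simp_all add: arc_length_def L_def L1_norm_eq[OF u])
  have cont: "continuous_on {0..1} (arc_length u)"
    unfolding arc_length_def by (rule indefinite_integral_continuous_1) (rule L1_integrable[OF u], auto)
  have L0: "0 \<le> L" using arc_length_diff(3)[OF u, of 0 1] l1 by simp
  have "\<exists>r\<in>{0..1}. arc_length u r = L * s" if "s \<in> {0..1}" for s
  proof -
    have "L * s \<le> L" using that L0 by (simp add: mult_left_le)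
    then show ?thesis
      using IVT'[of "arc_length u" 0 "L * s" 1] cont l1 L0 that by auto
  qed
  then obtain \<sigma> where \<sigma>: "\<And>s. s \<in> {0..1} \<Longrightarrow> \<sigma> s \<in> {0..1} \<and> arc_length u (\<sigma> s) = L * s" by metis
  define \<tau> where "\<tau> = \<sigma>(0 := 0, 1 := 1)"
  have \<tau>: "\<tau> s \<in> {0..1}" "arc_length u (\<tau> s) = L * s" if "s \<in> {0..1}" for s
    using \<sigma>[OF that] l1 by (auto simp: \<tau>_def)
  have "increment (Gamma u (\<tau> s)) (Gamma u (\<tau> t)) \<in> short (L * (t - s))"
    if st: "0 \<le> s" "s \<le> t" "t \<le> 1" for s t
  proof -
    have le: "L * s \<le> L * t" using st L0 by (simp add: mult_left_mono)
    have m: "\<tau> s \<in> {0..1}" "\<tau> t \<in> {0..1}" "arc_length u (\<tau> s) = L * s" "arc_length u (\<tau> t) = L * t"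
      using \<tau> st by auto
    show ?thesis
    proof (cases "\<tau> s \<le> \<tau> t")
      case True
      then show ?thesis using Gamma_increment[OF u, of "\<tau> s" "\<tau> t"] m by (simp add: algebra_simps)
    next
      case False
      then have "arc_length u (\<tau> t) \<le> arc_length u (\<tau> s)"
        using arc_length_diff(3)[OF u, of "\<tau> t" "\<tau> s"] m by simp
      then have "L * t = L * s" using m le by simp
      then have "arc_length u (\<tau> s) - arc_length u (\<tau> t) = L * (t - s)"
        unfolding m right_diff_distrib by linarith
      then have "increment (Gamma u (\<tau> t)) (Gamma u (\<tau> s)) \<in> short (L * (t - s))"
        using Gamma_increment[OF u, of "\<tau> t" "\<tau> s"] m False by (simp del: m(3,4))
      then show ?thesis using short_inv increment_inv by metis
    qed
  qed
  then have "horizontal L (\<lambda>s. Gamma u (\<tau> s))" by (simp add: horizontal_def \<tau>_def)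
  then show ?thesis using that[of "\<lambda>s. Gamma u (\<tau> s)"] by (simp add: L_def \<tau>_def)
qed

section \<open>Horizontal curves come from controls\<close>

lemma has_integral_grid:
  fixes f :: "real \<Rightarrow> 'c::banach"
  assumes n: "0 < (n::nat)" and f: "\<And>k t. k < K \<Longrightarrow> real k < real n * t \<Longrightarrow> real n * t < real (Suc k) \<Longrightarrow> f t = c k"
  shows "(f has_integral (\<Sum>k<K. (1 / real n) *\<^sub>R c k)) {0..real K / real n}"
  using f
proof (induction K)
  case 0
  then show ?case using has_integral_refl(2)[of f 0] by simp
next
  case (Suc K)
  let ?a = "real K / real n" and ?b = "real (Suc K) / real n"
  have le: "?a \<le> ?b" using n by (simp add: divide_right_mono)
  have "((\<lambda>_. c K) has_integral (?b - ?a) *\<^sub>R c K) {?a..?b}"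
    using has_integral_const_real[of "c K" ?a ?b] le by simp
  then have "(f has_integral (?b - ?a) *\<^sub>R c K) {?a..?b}"
    by (rule has_integral_spike_finite[where S = "{?a, ?b}", rotated 2])
       (use Suc.prems[of K] n in \<open>auto simp: divide_simps mult.commute\<close>)
  moreover have "?b - ?a = 1 / real n" using n by (simp add: field_simps)
  moreover have "(f has_integral (\<Sum>k<K. (1 / real n) *\<^sub>R c k)) {0..?a}"
    using Suc by simp
  ultimately show ?case
    using has_integral_combine[of 0 ?a ?b f, OF _ le] by simp
qed

text \<open>
  The dyadic difference quotients of a Lipschitz curve in a Hilbert space form a martingale
  bounded in \<open>L\<^sup>2\<close>.  Their limit serves as the derivative of the curve.
\<close>

locale lipschitz_curve =
  fixes x :: "real \<Rightarrow> 'a::{real_inner,banach}" and L :: real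
  assumes lip: "\<And>s t. 0 \<le> s \<Longrightarrow> s \<le> t \<Longrightarrow> t \<le> 1 \<Longrightarrow> norm (x t - x s) \<le> L * (t - s)"
    and x_0: "x 0 = 0"
begin

lemma L_nonneg: "0 \<le> L"
  using lip[of 0 1] by (auto intro: order_trans[OF norm_ge_zero])

text \<open>
  The value \<open>0\<close> beyond the last interval is met by \<open>step m t\<close> at \<open>t = 1\<close>.
\<close>

definition quot :: "nat \<Rightarrow> nat \<Rightarrow> 'a" where
  "quot m k = (if k < 2 ^ m then (2 ^ m) *\<^sub>R (x (real (Suc k) / 2 ^ m) - x (real k / 2 ^ m)) else 0)"

definition step :: "nat \<Rightarrow> real \<Rightarrow> 'a" where
  "step m t = quot m (nat \<lfloor>real (2 ^ m) * t\<rfloor>)"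

definition energy :: "nat \<Rightarrow> real" where
  "energy m = (\<Sum>k<2 ^ m. (1 / 2 ^ m) * (norm (quot m k))\<^sup>2)"

lemma step_simple: "simple_function leb01 (step m)"
  unfolding step_def by (rule simple_function_grid)

lemma norm_quot_le: "norm (quot m k) \<le> L"
proof (cases "k < 2 ^ m")
  case True
  then have "real (Suc k) \<le> real (2 ^ m)" by (simp only: of_nat_le_iff Suc_le_eq)
  then have "real (Suc k) / 2 ^ m \<le> 1" by simp
  then have "norm (x (real (Suc k) / 2 ^ m) - x (real k / 2 ^ m)) \<le> L * (real (Suc k) / 2 ^ m - real k / 2 ^ m)"
    by (intro lip) (auto simp: divide_right_mono)
  also have "\<dots> = L / 2 ^ m" by (simp add: field_simps)
  finally have "2 ^ m * norm (x (real (Suc k) / 2 ^ m) - x (real k / 2 ^ m)) \<le> L"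
    by (simp add: pos_le_divide_eq mult.commute)
  then show ?thesis using True by (simp add: quot_def del: of_nat_Suc)
qed (simp add: quot_def L_nonneg)

lemma norm_step_le: "norm (step m t) \<le> L"
  by (simp add: step_def norm_quot_le)

lemma step_coarse:
  assumes pq: "p \<le> q" and t: "real k < real (2 ^ q) * t" "real (2 ^ q) * t < real (Suc k)"
  shows "step p t = quot p (k div 2 ^ (q - p))"
proof -
  define r where "r = (2::nat) ^ (q - p)"
  have r: "0 < r" "real (2 ^ q) = real (2 ^ p) * real r"
    using pq by (simp_all add: r_def power_add[symmetric])
  have "r * (k div r) \<le> k" by simp
  moreover have "Suc k \<le> r * Suc (k div r)"
    using mod_less_divisor[OF r(1), of k] mult_div_mod_eq[of r k] unfolding mult_Suc_right by linarith
  ultimately have "real r * real (k div r) \<le> real k" "real (Suc k) \<le> real r * real (Suc (k div r))"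
    by (metis of_nat_le_iff of_nat_mult)+
  then have "real r * real (k div r) < real r * (real (2 ^ p) * t)"
    "real r * (real (2 ^ p) * t) < real r * real (Suc (k div r))"
    using t unfolding r(2) by (simp_all add: mult_ac)
  then have "real (k div r) < real (2 ^ p) * t" "real (2 ^ p) * t < real (Suc (k div r))"
    using r(1) by simp_all
  then have "nat \<lfloor>real (2 ^ p) * t\<rfloor> = k div r" by linarith
  then show ?thesis by (simp add: step_def r_def)
qed

lemma quot_sum: "K \<le> 2 ^ m \<Longrightarrow> (\<Sum>k<K. (1 / 2 ^ m) *\<^sub>R quot m k) = x (real K / 2 ^ m)"
  using sum_lessThan_telescope[of "\<lambda>k. x (real k / 2 ^ m)" K] by (simp add: quot_def x_0)

lemma step_integral:
  assumes "p \<le> q" "k \<le> 2 ^ p"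
  shows "(step q has_integral x (real k / 2 ^ p)) {0..real k / 2 ^ p}"
proof -
  define r where "r = (2::nat) ^ (q - p)"
  have r: "2 ^ q = 2 ^ p * r" "0 < r" using assms by (simp_all add: r_def power_add[symmetric])
  then have "k * r \<le> 2 ^ q" using assms by simp
  moreover have eq: "real (k * r) / 2 ^ q = real k / 2 ^ p"
  proof -
    have "(2::real) ^ q = 2 ^ p * real r" using r(1) by (metis of_nat_mult of_nat_numeral of_nat_power)
    then show ?thesis using r(2) by simp
  qed
  moreover have "(step q has_integral (\<Sum>j<k * r. (1 / real (2 ^ q)) *\<^sub>R quot q j)) {0..real (k * r) / real (2 ^ q)}"
    by (rule has_integral_grid) (use step_coarse[of q q] in auto)
  ultimately show ?thesis using quot_sum[of "k * r" q] by simp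
qed

lemma step_diff_integral:
  assumes "p \<le> q"
  shows "((\<lambda>t. norm (step q t - step p t)) has_integral
    (\<Sum>k<2 ^ q. (1 / 2 ^ q) * norm (quot q k - quot p (k div 2 ^ (q - p))))) {0..1}"
  using has_integral_grid[of "2 ^ q" "2 ^ q" "\<lambda>t. norm (step q t - step p t)"
      "\<lambda>k. norm (quot q k - quot p (k div 2 ^ (q - p)))"] step_coarse[of q q] step_coarse[OF assms]
  by simp

text \<open>
  Orthogonality of martingale increments: a block of fine difference quotients averages to the
  coarse one (\<open>block\<close>), so the mixed term equals the coarse energy.
\<close>

lemma energy_diff:
  assumes "p \<le> q"
  shows "(\<Sum>k<2 ^ q. (1 / 2 ^ q) * (norm (quot q k - quot p (k div 2 ^ (q - p))))\<^sup>2) = energy q - energy p"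
proof -
  define r where "r = (2::nat) ^ (q - p)"
  have r: "2 ^ q = 2 ^ p * r" "0 < r" "(2::real) ^ q = 2 ^ p * real r"
    using assms by (simp_all add: r_def power_add[symmetric])
  have group: "(\<Sum>k<2 ^ q. F k) = (\<Sum>i<2 ^ p. \<Sum>k\<in>{i * r..<i * r + r}. F k)" for F :: "nat \<Rightarrow> real"
    unfolding r(1) by (rule sum.nat_group[symmetric])
  have div: "k div r = i" if "k \<in> {i * r..<i * r + r}" for i k
    using that r(2) by (auto intro!: div_nat_eqI simp: mult.commute)
  have block: "(\<Sum>k\<in>{i * r..<i * r + r}. (1 / 2 ^ q) *\<^sub>R quot q k) = (1 / 2 ^ p) *\<^sub>R quot p i" if i: "i < 2 ^ p" for i
  proof -
    have "Suc i * r \<le> 2 ^ q" unfolding r(1) using i by (intro mult_right_mono) auto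
    then have b: "i * r + r \<le> 2 ^ q" by simp
    have ends: "real (i * r + r) / 2 ^ q = real (Suc i) / 2 ^ p" "real (i * r) / 2 ^ q = real i / 2 ^ p"
      using r by (simp_all add: field_simps)
    have "(\<Sum>k\<in>{i * r..<i * r + r}. (1 / 2 ^ q) *\<^sub>R quot q k)
        = (\<Sum>k<i * r + r. (1 / 2 ^ q) *\<^sub>R quot q k) - (\<Sum>k<i * r. (1 / 2 ^ q) *\<^sub>R quot q k)"
      by (simp add: lessThan_atLeast0 sum_diff_nat_ivl)
    also have "\<dots> = x (real (i * r + r) / 2 ^ q) - x (real (i * r) / 2 ^ q)"
      using b by (simp add: quot_sum)
    finally show ?thesis using i ends by (simp add: quot_def)
  qed
  have "(\<Sum>k<2 ^ q. (1 / 2 ^ q) * (quot q k \<bullet> quot p (k div r)))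
      = (\<Sum>i<2 ^ p. \<Sum>k\<in>{i * r..<i * r + r}. ((1 / 2 ^ q) *\<^sub>R quot q k) \<bullet> quot p i)"
    unfolding group by (intro sum.cong refl) (simp add: div)
  also have "\<dots> = (\<Sum>i<2 ^ p. ((1 / 2 ^ p) *\<^sub>R quot p i) \<bullet> quot p i)"
    by (intro sum.cong refl) (simp only: inner_sum_left[symmetric] block lessThan_iff)
  also have "\<dots> = energy p"
    by (simp add: energy_def power2_norm_eq_inner)
  finally have cross: "(\<Sum>k<2 ^ q. (1 / 2 ^ q) * (quot q k \<bullet> quot p (k div r))) = energy p" .
  have "(\<Sum>k<2 ^ q. (1 / 2 ^ q) * (norm (quot p (k div r)))\<^sup>2)
      = (\<Sum>i<2 ^ p. \<Sum>k\<in>{i * r..<i * r + r}. (1 / 2 ^ q) * (norm (quot p i))\<^sup>2)"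
    unfolding group by (intro sum.cong refl) (simp add: div)
  also have "\<dots> = energy p"
    unfolding energy_def by (intro sum.cong refl) (use r in \<open>simp add: field_simps\<close>)
  finally have coarse: "(\<Sum>k<2 ^ q. (1 / 2 ^ q) * (norm (quot p (k div r)))\<^sup>2) = energy p" .
  have expand: "(norm (a - b))\<^sup>2 = (norm a)\<^sup>2 + (norm b)\<^sup>2 - 2 * (a \<bullet> b)" for a b :: 'a
    by (simp add: power2_norm_eq_inner inner_diff inner_commute)
  have "(\<Sum>k<2 ^ q. (1 / 2 ^ q) * (norm (quot q k - quot p (k div r)))\<^sup>2)
     = (\<Sum>k<2 ^ q. (1 / 2 ^ q) * (norm (quot q k))\<^sup>2 + (1 / 2 ^ q) * (norm (quot p (k div r)))\<^sup>2
         - 2 * ((1 / 2 ^ q) * (quot q k \<bullet> quot p (k div r))))"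
    unfolding expand by (intro sum.cong refl) (simp add: algebra_simps)
  also have "\<dots> = energy q + energy p - 2 * energy p"
    unfolding sum_subtractf sum.distrib sum_distrib_left[symmetric, of 2] cross coarse
    by (simp add: energy_def)
  finally show ?thesis by (simp add: r_def)
qed

lemma step_dist_le:
  assumes "p \<le> q"
  shows "integral {0..1} (\<lambda>t. norm (step q t - step p t)) \<le> sqrt (energy q - energy p)"
proof -
  let ?d = "\<lambda>k. norm (quot q k - quot p (k div 2 ^ (q - p)))"
  have "(\<Sum>k<(2::nat) ^ q. ?d k)\<^sup>2 \<le> (\<Sum>k<(2::nat) ^ q. (?d k)\<^sup>2) * real (card {..<(2::nat) ^ q})"
    by (rule sum_squared_le_sum_of_squares)
  then have "((1 / 2 ^ q) * (\<Sum>k<2 ^ q. ?d k))\<^sup>2 \<le> (1 / 2 ^ q) * (\<Sum>k<2 ^ q. (?d k)\<^sup>2)"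
    by (simp add: power_mult_distrib power2_eq_square field_simps)
  then have "(integral {0..1} (\<lambda>t. norm (step q t - step p t)))\<^sup>2 \<le> energy q - energy p"
    using energy_diff[OF assms] integral_unique[OF step_diff_integral[OF assms]]
    by (simp add: sum_divide_distrib)
  then show ?thesis by (rule real_le_rsqrt)
qed

lemma energy_mono: "p \<le> q \<Longrightarrow> energy p \<le> energy q"
  using energy_diff[of p q] sum_nonneg[of "{..<2 ^ q}" "\<lambda>k. (1 / 2 ^ q) * (norm (quot q k - quot p (k div 2 ^ (q - p))))\<^sup>2"]
  by simp

lemma energy_le: "energy m \<le> L\<^sup>2"
proof -
  have "energy m \<le> (\<Sum>k<(2::nat) ^ m. (1 / 2 ^ m) * L\<^sup>2)"
    unfolding energy_def by (intro sum_mono mult_left_mono power_mono norm_quot_le) auto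
  then show ?thesis by simp
qed

text \<open>
  The energies increase to a limit.  Along a subsequence that exhausts them fast enough the
  difference quotients converge absolutely almost everywhere, and dominated convergence identifies
  the integral of the limit at dyadic points.
\<close>

lemma derivative_exists:
  obtains u where "u \<in> L1" "\<And>t. norm (u t) \<le> L"
    "\<And>p k. k \<le> 2 ^ p \<Longrightarrow> integral {0..real k / 2 ^ p} u = x (real k / 2 ^ p)"
proof -
  obtain l where "energy \<longlonglongrightarrow> l"
    by (rule incseq_convergent[of energy "L\<^sup>2"]) (auto simp: incseq_def energy_le energy_mono)
  then have "Cauchy energy" by (rule LIMSEQ_imp_Cauchy)
  then have "\<exists>M. \<forall>p\<ge>M. \<forall>q\<ge>M. dist (energy p) (energy q) < (1/4) ^ i" for i :: nat
    by (auto simp: Cauchy_def)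
  then obtain M where M: "\<And>i p q. p \<ge> M i \<Longrightarrow> q \<ge> M i \<Longrightarrow> dist (energy p) (energy q) < (1/4) ^ i"
    by metis
  \<comment> \<open>increasing, unbounded, and beyond \<open>M i\<close>\<close>
  define m where "m i = (\<Sum>j\<le>i. M j) + i" for i
  have m: "M i \<le> m i" "m i \<le> m (Suc i)" "i \<le> m i" for i
    using member_le_sum[of i "{..i}" M] by (auto simp: m_def)
  define V where "V i = step (m i)" for i
  have V_simple: "simple_function leb01 (V i)" for i by (simp add: V_def step_simple)
  have V_le: "norm (V i t) \<le> L" for i t by (simp add: V_def norm_step_le)
  define h where "h i t = norm (V (Suc i) t - V i t)" for i t
  have h_meas: "h i \<in> borel_measurable leb01" for i
    unfolding h_def by (rule simple_function_norm_measurable[OF simple_function_compose2[OF V_simple V_simple]])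
  have h_int: "integrable leb01 (h i)" for i
    by (rule finite_measure.integrable_const_bound[OF finite_measure_leb01 _ h_meas, of _ "2 * L"])
       (use V_le norm_triangle_ineq4 in \<open>auto simp: h_def intro!: AE_I2 order_trans[OF norm_triangle_ineq4] add_mono[of _ L _ L, simplified]\<close>)
  have h_small: "(LINT t|leb01. h i t) \<le> (1/2) ^ i" for i
  proof -
    have "(LINT t|leb01. h i t) = integral {0..1} (h i)"
      by (rule lebesgue_integral_eq_integral[OF h_int]) simp
    also have "\<dots> \<le> sqrt (energy (m (Suc i)) - energy (m i))"
      unfolding h_def V_def by (rule step_dist_le[OF m(2)])
    also have "\<dots> \<le> sqrt ((1/4) ^ i)"
      using M[of i "m i" "m (Suc i)"] m[of i] by (intro real_sqrt_le_mono) (auto simp: dist_real_def)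
    also have "\<dots> = (1/2) ^ i" by (simp add: real_sqrt_power real_sqrt_divide)
    finally show ?thesis .
  qed
  have "AE t in leb01. (\<Sum>i. ennreal (h i t)) \<noteq> \<infinity>"
  proof (rule nn_integral_noteq_infinite)
    show "(\<lambda>t. \<Sum>i. ennreal (h i t)) \<in> borel_measurable leb01" using h_meas by simp
    have "(\<integral>\<^sup>+ t. (\<Sum>i. ennreal (h i t)) \<partial>leb01) = (\<Sum>i. \<integral>\<^sup>+ t. ennreal (h i t) \<partial>leb01)"
      by (rule nn_integral_suminf) (use h_meas in simp)
    also have "\<dots> = (\<Sum>i. ennreal (LINT t|leb01. h i t))"
      by (intro suminf_cong nn_integral_eq_integral h_int) (simp add: h_def)
    also have "\<dots> \<le> (\<Sum>i. ennreal ((1/2) ^ i))"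
      by (intro suminf_le ennreal_leI h_small) auto
    also have "\<dots> = ennreal (\<Sum>i. (1/2) ^ i)" by (intro suminf_ennreal2 summable_geometric) auto
    also have "\<dots> < \<infinity>" by simp
    finally show "(\<integral>\<^sup>+ t. (\<Sum>i. ennreal (h i t)) \<partial>leb01) \<noteq> \<infinity>" by simp
  qed
  then have V_conv: "AE t in leb01. convergent (\<lambda>i. V i t)"
  proof eventually_elim
    case (elim t)
    then have "summable (\<lambda>i. h i t)" by (intro summable_suminf_not_top) (auto simp: h_def)
    then have "summable (\<lambda>i. V (Suc i) t - V i t)" unfolding h_def by (rule summable_norm_cancel)
    then have "convergent (\<lambda>n. \<Sum>i<n. V (Suc i) t - V i t)" by (simp add: summable_iff_convergent)
    then have "convergent (\<lambda>n. (\<Sum>i<n. V (Suc i) t - V i t) + V 0 t)" by (intro convergent_add convergent_const)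
    moreover have "(\<Sum>i<n. V (Suc i) t - V i t) + V 0 t = V n t" for n
      by (subst sum_lessThan_telescope) simp
    ultimately show ?case by simp
  qed
  define u where "u t = (if convergent (\<lambda>i. V i t) then lim (\<lambda>i. V i t) else 0)" for t
  have V_lim: "AE t in leb01. (\<lambda>i. V i t) \<longlonglongrightarrow> u t"
    using V_conv by eventually_elim (simp add: u_def convergent_LIMSEQ_iff)
  have u_sm: "strongly_measurable leb01 u"
    unfolding strongly_measurable_def using V_simple V_lim by blast
  have u_le: "norm (u t) \<le> L" for t
  proof (cases "convergent (\<lambda>i. V i t)")
    case True
    then have "(\<lambda>i. V i t) \<longlonglongrightarrow> u t" by (simp add: u_def convergent_LIMSEQ_iff)
    then show ?thesis
      by (rule tendsto_upperbound[OF tendsto_norm]) (auto simp: V_le intro: always_eventually)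
  qed (simp add: u_def L_nonneg)
  have "integrable leb01 (\<lambda>t. norm (u t))"
    by (rule finite_measure.integrable_const_bound[OF finite_measure_leb01 _ strongly_measurable_norm[OF u_sm], of L])
       (auto simp: u_le)
  then have u: "u \<in> L1" using u_sm by (simp add: L1_def)
  have d_meas: "(\<lambda>t. norm (u t - V i t)) \<in> borel_measurable leb01" for i
    by (rule strongly_measurable_norm[OF strongly_measurable_compose2[OF u_sm strongly_measurable_simple[OF V_simple]]])
       (rule tendsto_diff)
  have d_le: "norm (u t - V i t) \<le> 2 * L" for i t
    using norm_triangle_ineq4[of "u t" "V i t"] u_le[of t] V_le[of i t] by linarith
  have d_int: "integrable leb01 (\<lambda>t. norm (u t - V i t))" for i
    by (rule finite_measure.integrable_const_bound[OF finite_measure_leb01 _ d_meas, of _ "2 * L"]) (auto simp: d_le)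
  have "(\<lambda>i. LINT t|leb01. norm (u t - V i t)) \<longlonglongrightarrow> (LINT t|leb01. 0)"
  proof (rule integral_dominated_convergence[where w = "\<lambda>t. 2 * L"])
    show "AE t in leb01. (\<lambda>i. norm (u t - V i t)) \<longlonglongrightarrow> 0"
      using V_lim
    proof eventually_elim
      case (elim t)
      then have "(\<lambda>i. norm (u t - V i t)) \<longlonglongrightarrow> norm (u t - u t)" by (intro tendsto_intros)
      then show ?case by simp
    qed
  qed (use d_meas d_le finite_measure.integrable_const[OF finite_measure_leb01] in auto)
  then have d_lim: "(\<lambda>i. integral {0..1} (\<lambda>t. norm (u t - V i t))) \<longlonglongrightarrow> 0"
    by (simp add: lebesgue_integral_eq_integral[OF d_int])
  have "integral {0..real k / 2 ^ p} u = x (real k / 2 ^ p)" if k: "k \<le> 2 ^ p" for p k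
  proof -
    let ?b = "real k / 2 ^ p"
    have "real k \<le> real (2 ^ p)" using k by (simp only: of_nat_le_iff)
    then have b: "0 \<le> ?b" "?b \<le> 1" by auto
    have "norm (integral {0..?b} u - x ?b) \<le> integral {0..1} (\<lambda>t. norm (u t - V i t))" if "i \<ge> p" for i
    proof -
      have "p \<le> m i" using that m(3)[of i] by simp
      then have V_int: "(V i has_integral x ?b) {0..?b}" unfolding V_def by (rule step_integral[OF _ k])
      have ui: "u integrable_on {0..?b}" using L1_integrable[OF u, of 0 ?b] b by simp
      have di: "(\<lambda>t. norm (u t - V i t)) integrable_on {0..1}"
        by (rule integrable_on_lebesgue_on[OF d_int]) simp
      have "{0..?b} \<subseteq> {0..1}" using b(2) unfolding atLeastatMost_subset_iff by blast
      with di have dib: "(\<lambda>t. norm (u t - V i t)) integrable_on {0..?b}"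
        by (rule integrable_on_subinterval)
      have "integral {0..?b} u - x ?b = integral {0..?b} (\<lambda>t. u t - V i t)"
        using integral_diff[OF ui has_integral_integrable[OF V_int]] integral_unique[OF V_int] by simp
      also have "norm \<dots> \<le> integral {0..?b} (\<lambda>t. norm (u t - V i t))"
        by (rule integral_norm_bound_integral[OF integrable_diff[OF ui has_integral_integrable[OF V_int]] dib]) simp
      also have "\<dots> \<le> integral {0..1} (\<lambda>t. norm (u t - V i t))"
        by (rule integral_subset_le[OF _ dib di]) (use b in auto)
      finally show ?thesis .
    qed
    then have "\<forall>\<^sub>F i in sequentially. norm (integral {0..?b} u - x ?b) \<le> integral {0..1} (\<lambda>t. norm (u t - V i t))"
      by (auto simp: eventually_sequentially)
    then have "norm (integral {0..?b} u - x ?b) \<le> 0"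
      by (rule tendsto_lowerbound[OF d_lim]) simp
    then show ?thesis by simp
  qed
  then show ?thesis using that[OF u u_le] by blast
qed

end

text \<open>
  \<open>Gamma u\<close> and \<open>g\<close> are both horizontal and share their dyadic polygons, whose areas approximate
  the second components of both.
\<close>

lemma horizontal_imp_control:
  assumes g: "horizontal L g"
  obtains u where "u \<in> L1" "L1_norm u \<le> L" "Gamma u 1 = g 1"
proof -
  have "lipschitz_curve (\<lambda>t. fst (g t)) L"
    using horizontalD[OF g] by unfold_locales (auto simp: short_def fst_increment)
  then interpret lipschitz_curve "\<lambda>t. fst (g t)" L .
  obtain u where u: "u \<in> L1" "\<And>t. norm (u t) \<le> L"
    and grid: "\<And>p k. k \<le> 2 ^ p \<Longrightarrow> Gamma1 u (real k / 2 ^ p) = fst (g (real k / 2 ^ p))"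
    using derivative_exists unfolding Gamma1_def by metis
  have al: "arc_length u t - arc_length u s \<le> L * (t - s)" if "0 \<le> s" "s \<le> t" "t \<le> 1" for s t
  proof -
    have "integral {s..t} (\<lambda>r. norm (u r)) \<le> integral {s..t} (\<lambda>r. L)"
      by (rule integral_le) (use L1_integrable[OF u(1), of s t] u(2) that in auto)
    then show ?thesis using arc_length_diff(1)[OF u(1) that] that by (simp add: mult.commute)
  qed
  have hu: "horizontal L (Gamma u)"
    using short_mono[OF Gamma_increment[OF u(1)] al] by (auto simp: horizontal_def)
  have "norm (snd (Gamma u 1) - snd (g 1)) \<le> 2 * L\<^sup>2 * (1/2) ^ p" for p :: nat
  proof -
    let ?x = "\<lambda>k. fst (g (real k / real (2 ^ p)))"
    let ?A = "(1/2) *\<^sub>R (\<Sum>j<2 ^ p. wedge (?x j) (?x (Suc j) - ?x j))"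
    have "norm (snd (g 1) - ?A) \<le> L\<^sup>2 / real (2 ^ p)"
      by (rule horizontal_polygon[OF g]) simp
    moreover have "norm (snd (Gamma u 1) - ?A) \<le> L\<^sup>2 / real (2 ^ p)"
    proof -
      let ?y = "\<lambda>k. fst (Gamma u (real k / real (2 ^ p)))"
      have eq: "?y k = ?x k" if "k \<le> 2 ^ p" for k using grid[OF that] by (simp add: Gamma_def)
      have "(\<Sum>j<2 ^ p. wedge (?y j) (?y (Suc j) - ?y j)) = (\<Sum>j<2 ^ p. wedge (?x j) (?x (Suc j) - ?x j))"
        by (intro sum.cong refl) (simp only: lessThan_iff eq less_imp_le Suc_leI)
      then show ?thesis using horizontal_polygon[OF hu, of "2 ^ p"] by simp
    qed
    ultimately have "norm (snd (Gamma u 1) - snd (g 1)) \<le> L\<^sup>2 / real (2 ^ p) + L\<^sup>2 / real (2 ^ p)"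
      by (smt (verit) norm_diff_triangle_ineq norm_minus_commute norm_triangle_ineq diff_add_cancel add_diff_eq diff_diff_eq2)
    then show ?thesis by (simp add: power_divide)
  qed
  moreover have "(\<lambda>p. 2 * L\<^sup>2 * (1/2) ^ p) \<longlonglongrightarrow> 2 * L\<^sup>2 * 0"
    by (intro tendsto_intros LIMSEQ_power_zero) simp
  ultimately have "norm (snd (Gamma u 1) - snd (g 1)) \<le> 2 * L\<^sup>2 * 0"
    by (intro LIMSEQ_le_const) auto
  then have "snd (Gamma u 1) = snd (g 1)" by simp
  moreover have "fst (Gamma u 1) = fst (g 1)" using grid[of 1 0] by (simp add: Gamma_def)
  moreover have "L1_norm u \<le> L"
    using al[of 0 1] by (simp add: L1_norm_eq[OF u(1)] arc_length_def)
  ultimately show ?thesis using that[OF u(1)] by (simp add: prod_eq_iff)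
qed

section \<open>The Carnot--Caratheodory distance\<close>

text \<open>
  A bound on the distance is the same as a horizontal curve with this constant; it is the limit of
  the curves of almost optimal controls.  All properties of the distance are read off from this.
\<close>

lemma horizontal_imp_cc_dist0_le: "horizontal L g \<Longrightarrow> cc_dist0 (g 1) \<le> ennreal L"
proof -
  assume "horizontal L g"
  then obtain u where "u \<in> L1" "L1_norm u \<le> L" "Gamma u 1 = g 1" by (rule horizontal_imp_control)
  then have "cc_dist0 (g 1) \<le> ennreal (L1_norm u)"
    unfolding cc_dist0_def by (intro INF_lower) simp
  also have "\<dots> \<le> ennreal L" by (rule ennreal_leI) fact
  finally show ?thesis .
qed

lemma cc_dist0_le_imp_horizontal:
  assumes le: "cc_dist0 x \<le> ennreal L" and L: "0 \<le> L"
  obtains g where "horizontal L g" "g 1 = x"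
proof -
  have "\<exists>g. horizontal (L + 1 / Suc n) g \<and> g 1 = x" for n
  proof -
    have "cc_dist0 x < ennreal (L + 1 / Suc n)"
      using le by (rule order.strict_trans1) (use L in \<open>simp add: ennreal_less_iff\<close>)
    then obtain u where u: "u \<in> L1" "Gamma u 1 = x" "ennreal (L1_norm u) < ennreal (L + 1 / Suc n)"
      unfolding cc_dist0_def INF_less_iff by blast
    obtain g where g: "horizontal (L1_norm u) g" "g 1 = Gamma u 1"
      by (rule control_imp_horizontal[OF u(1)])
    have "L1_norm u \<le> L + 1 / Suc n"
      using u(3) horizontal_nonneg[OF g(1)] by (simp add: ennreal_less_iff)
    then show ?thesis using horizontal_mono[OF g(1)] g(2) u(2) by blast
  qed
  then obtain g where g: "\<And>n. horizontal (L + 1 / Suc n) (g n)" "\<And>n. g n 1 = x" by metis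
  have lim: "(\<lambda>n. L + 1 / Suc n) \<longlonglongrightarrow> L"
    using tendsto_add[OF tendsto_const LIMSEQ_inverse_real_of_nat, of L] by (simp add: inverse_eq_divide)
  show ?thesis by (rule horizontal_limit[OF g(1) lim, of x]) (auto simp: g(2) intro: that)
qed

lemma cc_dist_eq: "cc_dist x y = cc_dist0 (increment x y)"
  by (simp add: cc_dist_def increment_def)

lemma cc_dist_zero_left: "cc_dist 0 x = cc_dist0 x"
  by (simp add: cc_dist_eq)

lemma ennreal_finite_cases:
  assumes "(x::ennreal) < \<infinity>"
  obtains r where "0 \<le> r" "x = ennreal r"
  using assms by (cases x) auto

lemma cc_dist0_triangle: "cc_dist0 (g2_mult x y) \<le> cc_dist0 x + cc_dist0 y"
proof (cases "cc_dist0 x < \<infinity> \<and> cc_dist0 y < \<infinity>")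
  case True
  then obtain a b where ab: "0 \<le> a" "cc_dist0 x = ennreal a" "0 \<le> b" "cc_dist0 y = ennreal b"
    by (metis ennreal_finite_cases)
  obtain g where g: "horizontal a g" "g 1 = x"
    by (rule cc_dist0_le_imp_horizontal[of x a]) (use ab in auto)
  obtain h where h: "horizontal b h" "h 1 = y"
    by (rule cc_dist0_le_imp_horizontal[of y b]) (use ab in auto)
  obtain k where "horizontal (a + b) k" "k 1 = g2_mult (g 1) (h 1)"
    by (rule horizontal_concat[OF g(1) h(1)])
  then show ?thesis using horizontal_imp_cc_dist0_le[of "a + b" k] g h ab by (simp add: ennreal_plus)
next
  case False
  then have "cc_dist0 x + cc_dist0 y = top" by (auto simp: less_top[symmetric])
  then show ?thesis by (simp only: top_greatest)
qed

lemma cc_dist0_inv_le: "cc_dist0 (g2_inv x) \<le> cc_dist0 x"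
proof (cases "cc_dist0 x < \<infinity>")
  case True
  then obtain a where a: "0 \<le> a" "cc_dist0 x = ennreal a" by (rule ennreal_finite_cases)
  obtain g where g: "horizontal a g" "g 1 = x"
    by (rule cc_dist0_le_imp_horizontal[of x a]) (use a in auto)
  obtain h where "horizontal a h" "h 1 = g2_inv (g 1)" by (rule horizontal_reverse[OF g(1)])
  then show ?thesis using horizontal_imp_cc_dist0_le[of a h] g a by simp
qed (auto simp: less_top[symmetric])

lemma cc_dist_commute: "cc_dist x y = cc_dist y x"
  unfolding cc_dist_eq
  using cc_dist0_inv_le[of "increment x y"] cc_dist0_inv_le[of "increment y x"]
  by (simp add: increment_inv)

lemma cc_dist_triangle: "cc_dist x z \<le> cc_dist x y + cc_dist y z"
  unfolding cc_dist_eq using cc_dist0_triangle[of "increment x y" "increment y z"]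
  by (simp add: increment_trans)

lemma cc_dist_le_imp_short:
  assumes "cc_dist x y \<le> ennreal L" "0 \<le> L"
  shows "increment x y \<in> short L"
proof -
  obtain g where "horizontal L g" "g 1 = increment x y"
    by (rule cc_dist0_le_imp_horizontal[of "increment x y" L]) (use assms in \<open>auto simp: cc_dist_eq\<close>)
  then show ?thesis using horizontal_end by metis
qed

lemma increment_eq_0_iff: "increment x y = 0 \<longleftrightarrow> x = y"
  using mult_increment[of x y] by auto

lemma cc_dist_self [simp]: "cc_dist x x = 0"
proof -
  have "horizontal 0 (\<lambda>_. 0 :: 'a \<times> ('a \<Rightarrow>\<^sub>L 'a))"
    by (simp add: horizontal_def)
  then have "cc_dist0 (0 :: 'a \<times> ('a \<Rightarrow>\<^sub>L 'a)) \<le> ennreal 0" by (rule horizontal_imp_cc_dist0_le)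
  then show ?thesis by (simp add: cc_dist_eq)
qed

lemma cc_dist_eq_0_iff: "cc_dist x y = 0 \<longleftrightarrow> x = y"
proof
  assume "cc_dist x y = 0"
  then have "increment x y \<in> short 0" by (intro cc_dist_le_imp_short) auto
  then have "increment x y = 0" by (simp add: short_def prod_eq_iff)
  then show "x = y" by (simp add: increment_eq_0_iff)
qed simp

text \<open>
  This set turns out to be \<open>G2cc\<close>, but the metric structure depends only on the distances being
  finite.
\<close>

definition finite_part :: "('a::{real_inner,banach} \<times> ('a \<Rightarrow>\<^sub>L 'a)) set" where
  "finite_part = {x. cc_dist 0 x < \<infinity>}"

lemma cc_dist_finite: "x \<in> finite_part \<Longrightarrow> y \<in> finite_part \<Longrightarrow> cc_dist x y < \<infinity>"
proof -
  assume "x \<in> finite_part" "y \<in> finite_part"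
  then have "cc_dist x 0 + cc_dist 0 y < \<infinity>"
    by (simp add: finite_part_def cc_dist_commute[of x])
  then show ?thesis using cc_dist_triangle[of x y 0] by (rule order.strict_trans1[rotated])
qed

lemma cc_metric_eq: "x \<in> finite_part \<Longrightarrow> y \<in> finite_part \<Longrightarrow> cc_dist x y = ennreal (cc_metric x y)"
  using cc_dist_finite[of x y] by (simp add: cc_metric_def)

lemma cc_metric_nonneg [simp]: "0 \<le> cc_metric x y"
  by (simp add: cc_metric_def)

lemma Metric_space_finite_part: "Metric_space finite_part cc_metric"
proof
  show "cc_metric x y = cc_metric y x" for x y :: "'a \<times> ('a \<Rightarrow>\<^sub>L 'a)"
    by (simp add: cc_metric_def cc_dist_commute)
  fix x y z :: "'a \<times> ('a \<Rightarrow>\<^sub>L 'a)"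
  assume xy: "x \<in> finite_part" "y \<in> finite_part"
  show "cc_metric x y = 0 \<longleftrightarrow> x = y"
    using cc_metric_eq[OF xy] cc_dist_eq_0_iff[of x y] by (auto simp: cc_metric_def)
  assume z: "z \<in> finite_part"
  have "ennreal (cc_metric x z) \<le> ennreal (cc_metric x y + cc_metric y z)"
    using cc_dist_triangle[of x z y] xy z by (simp add: cc_metric_eq[symmetric] ennreal_plus)
  then show "cc_metric x z \<le> cc_metric x y + cc_metric y z"
    by (subst (asm) ennreal_le_iff) simp_all
qed simp

text \<open>
  A \<open>\<rho>\<close>-Cauchy sequence converges in norm; by lower semicontinuity of \<open>\<rho>\<close> under convergence
  in norm it converges to the same limit with respect to \<open>\<rho>\<close>.
\<close>

lemma mcomplete_finite_part: "Metric_space.mcomplete (finite_part :: ('a::{real_inner,banach} \<times> _) set) cc_metric"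
proof -
  interpret Metric_space "finite_part :: ('a \<times> ('a \<Rightarrow>\<^sub>L 'a)) set" cc_metric
    by (rule Metric_space_finite_part)
  show ?thesis
    unfolding mcomplete_def
  proof (intro allI impI)
    fix X :: "nat \<Rightarrow> 'a \<times> ('a \<Rightarrow>\<^sub>L 'a)"
    assume "MCauchy X"
    then have XM: "\<And>n. X n \<in> finite_part"
      and XC: "\<And>e. e > 0 \<Longrightarrow> \<exists>N. \<forall>p\<ge>N. \<forall>q\<ge>N. cc_metric (X p) (X q) < e"
      unfolding MCauchy_def by auto
    have short: "increment (X p) (X q) \<in> short e" if "cc_metric (X p) (X q) < e" for p q e
    proof (rule cc_dist_le_imp_short)
      show "cc_dist (X p) (X q) \<le> ennreal e"
        using that by (simp add: cc_metric_eq[OF XM XM] ennreal_leI)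
      show "0 \<le> e" using that cc_metric_nonneg[of "X p" "X q"] by linarith
    qed
    have "Cauchy (\<lambda>n. fst (X n))"
    proof (rule CauchyI)
      fix e :: real assume "0 < e"
      then obtain N where "\<forall>p\<ge>N. \<forall>q\<ge>N. cc_metric (X p) (X q) < e / 2" using XC[of "e / 2"] by auto
      then have "norm (fst (X p) - fst (X q)) < e" if "p \<ge> N" "q \<ge> N" for p q
        using short[of q p "e / 2"] that \<open>0 < e\<close> by (force simp: short_def fst_increment)
      then show "\<exists>N. \<forall>p\<ge>N. \<forall>q\<ge>N. norm (fst (X p) - fst (X q)) < e" by blast
    qed
    then obtain a where a: "(\<lambda>n. fst (X n)) \<longlonglongrightarrow> a" using Cauchy_convergent convergent_def by metis
    then obtain C where C: "0 < C" "\<And>n. norm (fst (X n)) \<le> C"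
      using convergent_imp_Bseq[of "\<lambda>n. fst (X n)"] unfolding convergent_def Bseq_def by metis
    have "Cauchy (\<lambda>n. snd (X n))"
    proof (rule CauchyI)
      fix e :: real assume e: "0 < e"
      \<comment> \<open>The error is at most \<open>d\<^sup>2\<close> from the increment and \<open>C d\<close> from the wedge product.\<close>
      define d where "d = min 1 (e / (2 * (1 + C)))"
      have "d \<le> e / (2 * (1 + C))" by (simp add: d_def)
      then have "d * (2 * (1 + C)) \<le> e" by (subst (asm) pos_le_divide_eq) (use C(1) in auto)
      then have "d * (1 + C) \<le> e / 2" by (simp add: algebra_simps)
      then have d: "0 < d" "d \<le> 1" "d * (1 + C) \<le> e / 2" using e C(1) by (simp_all add: d_def)
      obtain N where N: "\<forall>p\<ge>N. \<forall>q\<ge>N. cc_metric (X p) (X q) < d" using XC[of d] d by auto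
      have "norm (snd (X p) - snd (X q)) < e" if "p \<ge> N" "q \<ge> N" for p q
      proof -
        have i: "increment (X q) (X p) \<in> short d" using short N that by blast
        have w: "wedge (fst (X q)) (fst (X p)) = wedge (fst (X q)) (fst (X p) - fst (X q))"
          by (simp add: wedge_diff_right)
        have "norm (wedge (fst (X q)) (fst (X p))) \<le> 2 * norm (fst (X q)) * norm (fst (X p) - fst (X q))"
          unfolding w by (rule norm_wedge_le)
        also have "\<dots> \<le> 2 * C * d"
          using i less_imp_le[OF C(1)] C(2) by (intro mult_mono) (auto simp: short_def fst_increment)
        finally have "norm ((1/2) *\<^sub>R wedge (fst (X q)) (fst (X p))) \<le> C * d" by simp
        moreover have "norm (snd (increment (X q) (X p))) \<le> d"
          using i d power_decreasing[of 1 2 d] by (auto simp: short_def)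
        moreover have "snd (X p) - snd (X q) = snd (increment (X q) (X p)) + (1/2) *\<^sub>R wedge (fst (X q)) (fst (X p))"
          by (simp add: snd_increment)
        ultimately have "norm (snd (X p) - snd (X q)) \<le> d * (1 + C)"
          using norm_triangle_ineq[of "snd (increment (X q) (X p))" "(1/2) *\<^sub>R wedge (fst (X q)) (fst (X p))"]
          by (simp add: algebra_simps)
        then show ?thesis using d e by simp
      qed
      then show "\<exists>N. \<forall>p\<ge>N. \<forall>q\<ge>N. norm (snd (X p) - snd (X q)) < e" by blast
    qed
    then obtain b where b: "(\<lambda>n. snd (X n)) \<longlonglongrightarrow> b" using Cauchy_convergent convergent_def by metis
    define x where "x = (a, b)"
    have inc_lim: "(\<lambda>q. increment (X p) (X q)) \<longlonglongrightarrow> increment (X p) x" for p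
    proof -
      have "(\<lambda>q. (fst (X q) - fst (X p), snd (X q) - snd (X p) - (1/2) *\<^sub>R wedge (fst (X p)) (fst (X q))))
          \<longlonglongrightarrow> (a - fst (X p), b - snd (X p) - (1/2) *\<^sub>R wedge (fst (X p)) a)"
        by (intro tendsto_intros a b bounded_bilinear.tendsto[OF bounded_bilinear_wedge])
      moreover have "increment y z = (fst z - fst y, snd z - snd y - (1/2) *\<^sub>R wedge (fst y) (fst z))"
        for y z :: "'a \<times> ('a \<Rightarrow>\<^sub>L 'a)"
        by (simp add: prod_eq_iff fst_increment snd_increment)
      ultimately show ?thesis by (simp add: x_def)
    qed
    have close: "cc_dist (X p) x \<le> ennreal e" if e: "0 < e" and N: "\<forall>p\<ge>N. \<forall>q\<ge>N. cc_metric (X p) (X q) < e" "p \<ge> N"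
      for e N p
    proof -
      have "\<exists>g. horizontal e g \<and> g 1 = increment (X p) (X (N + n))" for n
      proof -
        have "cc_dist0 (increment (X p) (X (N + n))) \<le> ennreal e"
          unfolding cc_dist_eq[symmetric] cc_metric_eq[OF XM XM]
          by (intro ennreal_leI less_imp_le) (use N in simp)
        then show ?thesis using e by (rule_tac cc_dist0_le_imp_horizontal) auto
      qed
      then obtain g where g: "\<And>n. horizontal e (g n)" "\<And>n. g n 1 = increment (X p) (X (N + n))" by metis
      have "(\<lambda>n. g n 1) \<longlonglongrightarrow> increment (X p) x"
        unfolding g(2) using LIMSEQ_ignore_initial_segment[OF inc_lim[of p], of N] by (simp add: add.commute)
      then obtain h where "horizontal e h" "h 1 = increment (X p) x"
        by (rule horizontal_limit[OF g(1) tendsto_const])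
      then show ?thesis using horizontal_imp_cc_dist0_le by (metis cc_dist_eq)
    qed
    obtain N1 where N1: "\<forall>p\<ge>N1. \<forall>q\<ge>N1. cc_metric (X p) (X q) < 1" using XC[of 1] by auto
    have "cc_dist 0 x \<le> cc_dist 0 (X N1) + cc_dist (X N1) x" by (rule cc_dist_triangle)
    also have "\<dots> < \<infinity>"
      using close[OF _ N1, of N1] XM[of N1] by (auto simp: finite_part_def ennreal_add_less_top less_top[symmetric] top_unique)
    finally have xM: "x \<in> finite_part" by (simp add: finite_part_def)
    have "\<exists>N. \<forall>n\<ge>N. cc_metric (X n) x < e" if e: "0 < e" for e
    proof -
      obtain N where N: "\<forall>p\<ge>N. \<forall>q\<ge>N. cc_metric (X p) (X q) < e / 2" using XC[of "e / 2"] e by auto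
      have "cc_metric (X n) x \<le> e / 2" if "n \<ge> N" for n
        using close[OF _ N that] e cc_metric_eq[OF XM xM, of n] by (simp add: ennreal_le_iff)
      then show ?thesis using e by (intro exI[of _ N]) force
    qed
    then have "limitin mtopology X x sequentially"
      unfolding limitin_metric eventually_sequentially using xM XM by blast
    then show "\<exists>x. limitin mtopology X x sequentially" by blast
  qed
qed

text \<open>A horizontal curve realising the distance, translated to the starting point, is a geodesic.\<close>

lemma geodesic_space_finite_part: "geodesic_space (finite_part :: ('a::{real_inner,banach} \<times> _) set) cc_metric"
  unfolding geodesic_space_def
proof (intro ballI)
  fix x y :: "'a \<times> ('a \<Rightarrow>\<^sub>L 'a)"
  assume x: "x \<in> finite_part" and y: "y \<in> finite_part"
  interpret Metric_space "finite_part :: ('a \<times> ('a \<Rightarrow>\<^sub>L 'a)) set" cc_metric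
    by (rule Metric_space_finite_part)
  define D where "D = cc_metric x y"
  have D: "0 \<le> D" "cc_dist0 (increment x y) = ennreal D"
    using cc_metric_eq[OF x y] by (auto simp: D_def cc_dist_eq)
  obtain h where h: "horizontal D h" "h 1 = increment x y"
    by (rule cc_dist0_le_imp_horizontal[of "increment x y" D]) (use D in auto)
  define g where "g t = g2_mult x (h t)" for t
  have g01: "g 0 = x" "g 1 = y"
    by (simp_all add: g_def h(2) horizontalD(1)[OF h(1)] mult_increment)
  have le: "cc_dist (g s) (g t) \<le> ennreal (D * (t - s))" if "0 \<le> s" "s \<le> t" "t \<le> 1" for s t
    using horizontal_imp_cc_dist0_le[OF horizontal_subcurve[OF h(1) that]]
    by (simp add: cc_dist_eq g_def increment_translate)
  have gM: "g t \<in> finite_part" if "0 \<le> t" "t \<le> 1" for t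
  proof -
    have "cc_dist 0 (g t) \<le> cc_dist 0 x + cc_dist x (g t)" by (rule cc_dist_triangle)
    also have "\<dots> \<le> cc_dist 0 x + ennreal (D * (t - 0))"
      using le[of 0 t] that g01 by (intro add_left_mono) auto
    also have "\<dots> < \<infinity>" using x by (simp add: finite_part_def ennreal_add_less_top less_top[symmetric] top_unique)
    finally show ?thesis by (simp add: finite_part_def)
  qed
  have m_le: "cc_metric (g s) (g t) \<le> D * (t - s)" if "0 \<le> s" "s \<le> t" "t \<le> 1" for s t
    using le[OF that] cc_metric_eq[OF gM gM, of s t] that D by (simp add: ennreal_le_iff)
  have m_eq: "cc_metric (g s) (g t) = D * (t - s)" if st: "0 \<le> s" "s \<le> t" "t \<le> 1" for s t
  proof -
    have "D \<le> cc_metric (g 0) (g s) + cc_metric (g s) (g 1)"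
      unfolding D_def using triangle[of x "g s" y] x y gM[of s] st by (simp add: g01)
    also have "cc_metric (g s) (g 1) \<le> cc_metric (g s) (g t) + cc_metric (g t) (g 1)"
      using triangle[of "g s" "g t" "g 1"] gM st by simp
    finally have "D \<le> D * (s - 0) + cc_metric (g s) (g t) + D * (1 - t)"
      using m_le[of 0 s] m_le[of t 1] st by simp
    then have "D * (t - s) \<le> cc_metric (g s) (g t)" by (simp add: algebra_simps)
    then show ?thesis using m_le[OF st] by simp
  qed
  have len: "curve_length cc_metric g s t = ennreal (D * (t - s))" if st: "0 \<le> s" "s \<le> t" "t \<le> 1" for s t
  proof -
    let ?P = "{(n::nat, p). mono_on {..n} p \<and> p 0 = s \<and> p n = t}"
    have "(\<Sum>i<n. cc_metric (g (p i)) (g (p (Suc i)))) = D * (t - s)"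
      if p: "mono_on {..n} p" "p 0 = s" "p n = t" for n p
    proof -
      have "cc_metric (g (p i)) (g (p (Suc i))) = D * p (Suc i) - D * p i" if "i < n" for i
      proof -
        have "p 0 \<le> p i" "p i \<le> p (Suc i)" "p (Suc i) \<le> p n"
          using that by (auto intro!: mono_onD[OF p(1)])
        then show ?thesis using m_eq[of "p i" "p (Suc i)"] p st by (simp add: right_diff_distrib)
      qed
      then have "(\<Sum>i<n. cc_metric (g (p i)) (g (p (Suc i)))) = (\<Sum>i<n. D * p (Suc i) - D * p i)" by simp
      also have "\<dots> = D * (t - s)" by (subst sum_lessThan_telescope) (simp add: p right_diff_distrib)
      finally show ?thesis .
    qed
    then have "curve_length cc_metric g s t = (SUP z\<in>?P. ennreal (D * (t - s)))"
      unfolding curve_length_def by (intro SUP_cong refl) auto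
    moreover have "(1, \<lambda>i. if i = 0 then s else t) \<in> ?P"
      using st by (auto simp: mono_on_def)
    then have "(SUP z\<in>?P. ennreal (D * (t - s))) = ennreal (D * (t - s))"
      by (intro SUP_const) blast
    ultimately show ?thesis by simp
  qed
  have "continuous_map (top_of_set {0..1}) mtopology g"
    unfolding continuous_map_to_metric
  proof (intro ballI allI impI)
    fix t e :: real assume "t \<in> topspace (top_of_set {0..1})" and e: "0 < e"
    then have t: "0 \<le> t" "t \<le> 1" by auto
    define U where "U = {0..1} \<inter> ball t (e / (D + 1))"
    have "g r \<in> mball (g t) e" if r: "r \<in> U" for r
    proof -
      have r01: "0 \<le> r" "r \<le> 1" and "\<bar>r - t\<bar> < e / (D + 1)" using r by (auto simp: U_def dist_real_def)
      then have "(D + 1) * \<bar>r - t\<bar> < e" using D(1) by (simp add: field_simps)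
      then have "D * \<bar>r - t\<bar> < e" using D(1) by (simp add: distrib_right)
      moreover have "cc_metric (g t) (g r) = D * \<bar>r - t\<bar>"
        using m_eq[of t r] m_eq[of r t] t r01 commute[of "g t" "g r"] by (cases "t \<le> r") auto
      ultimately show ?thesis using gM t r01 by simp
    qed
    moreover have "openin (top_of_set {0..1}) U" unfolding U_def by (intro openin_open_Int) simp
    moreover have "t \<in> U" using t e D(1) by (simp add: U_def)
    ultimately show "\<exists>U. openin (top_of_set {0..1}) U \<and> t \<in> U \<and> (\<forall>y\<in>U. g y \<in> mball (g t) e)" by blast
  qed
  then show "\<exists>g. continuous_map (top_of_set {0..1}) mtopology g \<and> g 0 = x \<and> g 1 = y \<and>
      (\<forall>s t. 0 \<le> s \<and> s \<le> t \<and> t \<le> 1 \<longrightarrow>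
        curve_length cc_metric g s t = ennreal (cc_metric (g s) (g t)) \<and>
        cc_metric (g s) (g t) = \<bar>t - s\<bar> * cc_metric (g 0) (g 1))"
    using g01 m_eq len by (intro exI[of _ g]) (auto simp: D_def)
qed

section \<open>Compact operators\<close>

lemma compact_op_iff: "compact_op T \<longleftrightarrow> (\<exists>K. compact K \<and> T ` cball 0 1 \<subseteq> K)"
proof
  assume "\<exists>K. compact K \<and> T ` cball 0 1 \<subseteq> K"
  then obtain K where K: "compact K" "T ` cball 0 1 \<subseteq> K" by blast
  then have "closure (T ` cball 0 1) \<subseteq> K"
    by (intro closure_minimal compact_imp_closed)
  then have "K \<inter> closure (T ` cball 0 1) = closure (T ` cball 0 1)" by blast
  then show "compact_op T"
    unfolding compact_op_def using compact_Int_closed[OF K(1) closed_closure] by metis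
qed (auto simp: compact_op_def intro!: exI[of _ "closure (T ` cball 0 1)"] closure_subset[THEN subsetD])

lemma compact_op_add:
  assumes "compact_op S" "compact_op T"
  shows "compact_op (S + T)"
proof -
  obtain K K' where K: "compact K" "S ` cball 0 1 \<subseteq> K" "compact K'" "T ` cball 0 1 \<subseteq> K'"
    using assms by (auto simp: compact_op_iff)
  have "(S + T) ` cball 0 1 \<subseteq> {x + y |x y. x \<in> K \<and> y \<in> K'}"
    using K by (fastforce simp: blinfun.add_left)
  then show ?thesis using compact_sums[OF K(1,3)] by (auto simp: compact_op_iff)
qed

lemma compact_op_scaleR:
  assumes "compact_op T"
  shows "compact_op (c *\<^sub>R T)"
proof -
  obtain K where K: "compact K" "T ` cball 0 1 \<subseteq> K"
    using assms by (auto simp: compact_op_iff)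
  have "(c *\<^sub>R T) ` cball 0 1 \<subseteq> (\<lambda>x. c *\<^sub>R x) ` K"
    using K by (auto simp: blinfun.scaleR_left)
  then show ?thesis using compact_scaling[OF K(1)] by (auto simp: compact_op_iff)
qed

lemma compact_op_0: "compact_op 0"
  by (auto simp: compact_op_iff intro!: exI[of _ "{0}"])

lemma compact_op_sum: "(\<And>i. i \<in> I \<Longrightarrow> compact_op (T i)) \<Longrightarrow> compact_op (\<Sum>i\<in>I. T i)"
  by (induction I rule: infinite_finite_induct) (auto intro: compact_op_0 compact_op_add)

lemma compact_op_tensor: "compact_op (tensor x y)"
proof -
  have "(tensor x y) ` cball 0 1 \<subseteq> (\<lambda>c. c *\<^sub>R y) ` {- norm x .. norm x}"
  proof
    fix w assume "w \<in> (tensor x y) ` cball 0 1"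
    then obtain v where v: "norm v \<le> 1" "w = (x \<bullet> v) *\<^sub>R y" by (auto simp: tensor_apply)
    have "\<bar>x \<bullet> v\<bar> \<le> norm x * norm v" by (rule Cauchy_Schwarz_ineq2)
    also have "\<dots> \<le> norm x" using v(1) by (simp add: mult_left_le)
    finally show "w \<in> (\<lambda>c. c *\<^sub>R y) ` {- norm x .. norm x}" using v(2) by (auto simp: abs_le_iff)
  qed
  moreover have "compact ((\<lambda>c. c *\<^sub>R y) ` {- norm x .. norm x})"
    by (intro compact_continuous_image continuous_intros) simp
  ultimately show ?thesis by (auto simp: compact_op_iff)
qed

lemma compact_op_wedge: "compact_op (wedge x y)"
  using compact_op_add[OF compact_op_tensor[of x y] compact_op_scaleR[OF compact_op_tensor[of y x], of "-1"]]
  by (simp add: wedge_def)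

text \<open>
  The image of the ball under the limit is totally bounded, as it is uniformly close to totally
  bounded sets.
\<close>

lemma compact_op_limit:
  fixes T :: "'a::{real_inner,banach} \<Rightarrow>\<^sub>L 'a"
  assumes X: "\<And>n. compact_op (X n)" and lim: "X \<longlonglongrightarrow> T"
  shows "compact_op T"
  unfolding compact_op_def compact_eq_totally_bounded
proof (intro conjI allI impI)
  show "complete (closure (T ` cball 0 1))" by (simp add: complete_eq_closed)
  fix e :: real assume e: "0 < e"
  then obtain n where "dist (X n) T < e / 4"
    using lim[unfolded LIMSEQ_def, rule_format, of "e / 4"] by auto
  then have n: "norm (X n - T) < e / 4" by (simp add: dist_norm)
  obtain k where k: "finite k" "closure ((X n) ` cball 0 1) \<subseteq> (\<Union>x\<in>k. ball x (e / 4))"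
    using X[of n] e unfolding compact_op_def compact_eq_totally_bounded by (meson divide_pos_pos zero_less_numeral)
  have "T ` cball 0 1 \<subseteq> (\<Union>x\<in>k. cball x (e / 2))"
  proof
    fix w assume "w \<in> T ` cball 0 1"
    then obtain v where v: "norm v \<le> 1" "w = T v" by auto
    have "X n v \<in> closure ((X n) ` cball 0 1)"
      using v(1) closure_subset by fastforce
    then obtain x where x: "x \<in> k" "dist x (X n v) < e / 4" using k(2) by auto
    have "dist (X n v) w \<le> norm (X n - T) * norm v"
      unfolding v(2) dist_norm blinfun.diff_left[symmetric] by (rule norm_blinfun)
    also have "\<dots> \<le> e / 4"
      using mult_mono[of "norm (X n - T)" "e / 4" "norm v" 1] n v(1) e by simp
    finally have "dist x w \<le> e / 2" using x(2) dist_triangle[of x w "X n v"] by simp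
    then show "w \<in> (\<Union>x\<in>k. cball x (e / 2))" using x(1) by auto
  qed
  then have "closure (T ` cball 0 1) \<subseteq> (\<Union>x\<in>k. cball x (e / 2))"
    using k(1) by (intro closure_minimal closed_UN) auto
  also have "\<dots> \<subseteq> (\<Union>x\<in>k. ball x e)" using e by fastforce
  finally show "\<exists>k. finite k \<and> closure (T ` cball 0 1) \<subseteq> (\<Union>x\<in>k. ball x e)"
    using k(1) by blast
qed

lemma compact_op_subseq:
  assumes T: "compact_op T" and v: "\<And>n::nat. norm (v n) \<le> 1"
  obtains r l where "strict_mono r" "(\<lambda>n. T (v (r n))) \<longlonglongrightarrow> l"
proof -
  obtain K where K: "compact K" "T ` cball 0 1 \<subseteq> K" using T by (auto simp: compact_op_iff)
  have "\<forall>n. T (v n) \<in> K" using K(2) v by auto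
  from seq_compactE[OF K(1)[unfolded compact_eq_seq_compact_metric] this] that show ?thesis
    by (auto simp: o_def)
qed

section \<open>Normal form of compact skew-symmetric operators\<close>

lemma skewD: "skew X \<Longrightarrow> X x \<bullet> y = - (x \<bullet> X y)"
  by (simp add: skew_def)

lemma skew_add: "skew X \<Longrightarrow> skew Y \<Longrightarrow> skew (X + Y)"
  and skew_scaleR: "skew X \<Longrightarrow> skew (c *\<^sub>R X)"
  and skew_0: "skew 0"
  by (auto simp: skew_def blinfun.add_left blinfun.scaleR_left inner_add_left inner_add_right)

lemma skew_wedge: "skew (wedge x y)"
  by (simp add: skew_def wedge_apply inner_diff_left inner_diff_right inner_commute mult.commute)

lemma skew_sum: "(\<And>i. i \<in> I \<Longrightarrow> skew (T i)) \<Longrightarrow> skew (\<Sum>i\<in>I. T i)"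
  by (induction I rule: infinite_finite_induct) (auto intro: skew_0 skew_add)

lemma skew_limit:
  assumes X: "\<And>n. skew (X n)" and lim: "X \<longlonglongrightarrow> T"
  shows "skew T"
  unfolding skew_def
proof (intro allI)
  fix x y
  have "(\<lambda>n. X n x \<bullet> y) \<longlonglongrightarrow> T x \<bullet> y" by (intro tendsto_intros lim)
  moreover have "(\<lambda>n. - (x \<bullet> X n y)) \<longlonglongrightarrow> - (x \<bullet> T y)" by (intro tendsto_intros lim)
  ultimately show "T x \<bullet> y = - (x \<bullet> T y)"
    unfolding skewD[OF X] by (rule LIMSEQ_unique)
qed

text \<open>
  Compactness makes a maximising sequence of \<open>v \<mapsto> \<parallel>X v\<parallel>\<close> on the unit sphere converge; its limit
  is an eigenvector of \<open>X\<^sup>2\<close>.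
\<close>

lemma skew_norm_attained:
  assumes comp: "compact_op X" and sk: "skew X" and nz: "X \<noteq> 0"
  shows "\<exists>e. norm e = 1 \<and> X (X e) = - ((norm X)\<^sup>2 *\<^sub>R e)"
proof -
  define s where "s = norm X"
  have s: "0 < s" using nz by (simp add: s_def)
  have "\<exists>v. norm v = 1 \<and> s * (1 - 1 / real (Suc n)) < norm (X v)" for n
  proof (rule ccontr)
    assume none: "\<not> ?thesis"
    have "norm X \<le> s * (1 - 1 / real (Suc n))"
    proof (rule norm_blinfun_bound)
      show "0 \<le> s * (1 - 1 / real (Suc n))" using s by simp
      fix x
      show "norm (X x) \<le> s * (1 - 1 / real (Suc n)) * norm x"
      proof (cases "x = 0")
        case False
        then have "norm (X (x /\<^sub>R norm x)) \<le> s * (1 - 1 / real (Suc n))"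
          using none by (intro leI notI) (auto intro: exI[of _ "x /\<^sub>R norm x"])
        then show ?thesis using False by (simp add: blinfun.scaleR_right divide_simps)
      qed (simp add: blinfun.zero_right)
    qed
    then show False using s by (simp add: s_def[symmetric])
  qed
  then obtain v where v: "\<And>n. norm (v n) = 1" "\<And>n. s * (1 - 1 / real (Suc n)) < norm (X (v n))"
    by metis
  obtain r l where r: "strict_mono r" and l: "(\<lambda>n. X (v (r n))) \<longlonglongrightarrow> l"
    using compact_op_subseq[OF comp, of v] v by (metis order_refl)
  let ?u = "\<lambda>n. v (r n)"
  let ?X = "blinfun_apply X"
  have "(\<lambda>n. 1 - 1 / Suc n) \<longlonglongrightarrow> (1 - 0 :: real)"
    using tendsto_diff[OF tendsto_const LIMSEQ_inverse_real_of_nat] by (simp add: inverse_eq_divide)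
  from LIMSEQ_subseq_LIMSEQ[OF this r] have "(\<lambda>n. s * (1 - 1 / Suc (r n))) \<longlonglongrightarrow> s * 1"
    by (intro tendsto_mult tendsto_const) (simp add: o_def)
  then have lo: "(\<lambda>n. s * (1 - 1 / Suc (r n))) \<longlonglongrightarrow> s" by simp
  have "norm (?X (?u n)) \<le> s" for n
    using norm_blinfun[of X "?u n"] v(1)[of "r n"] by (simp add: s_def)
  then have "(\<lambda>n. norm (?X (?u n))) \<longlonglongrightarrow> s"
    by (intro tendsto_sandwich[OF always_eventually always_eventually lo tendsto_const] allI
        less_imp_le[OF v(2)])
  then have "(\<lambda>n. s\<^sup>2 * (s\<^sup>2 - (norm (?X (?u n)))\<^sup>2)) \<longlonglongrightarrow> s\<^sup>2 * (s\<^sup>2 - s\<^sup>2)" by (intro tendsto_intros)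
  then have up: "(\<lambda>n. s\<^sup>2 * (s\<^sup>2 - (norm (?X (?u n)))\<^sup>2)) \<longlonglongrightarrow> 0" by simp
  have le: "(norm (?X (?X (?u n)) + s\<^sup>2 *\<^sub>R ?u n))\<^sup>2 \<le> s\<^sup>2 * (s\<^sup>2 - (norm (?X (?u n)))\<^sup>2)" for n
  proof -
    let ?w = "?X (?u n)"
    have "(norm (?X ?w + s\<^sup>2 *\<^sub>R ?u n))\<^sup>2 = (norm (?X ?w))\<^sup>2 + 2 * s\<^sup>2 * (?X ?w \<bullet> ?u n) + s\<^sup>2 * s\<^sup>2 * (?u n \<bullet> ?u n)"
      by (simp add: power2_norm_eq_inner inner_add inner_commute algebra_simps)
    also have "?X ?w \<bullet> ?u n = - (norm ?w)\<^sup>2" by (simp add: skewD[OF sk] power2_norm_eq_inner)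
    also have "?u n \<bullet> ?u n = 1" using v(1)[of "r n"] by (simp add: power2_norm_eq_inner[symmetric])
    also have "(norm (?X ?w))\<^sup>2 \<le> (s * norm ?w)\<^sup>2"
      using norm_blinfun[of X ?w] by (intro power_mono) (auto simp: s_def)
    finally show ?thesis by (simp add: power_mult_distrib algebra_simps)
  qed
  have "(\<lambda>n. (norm (?X (?X (?u n)) + s\<^sup>2 *\<^sub>R ?u n))\<^sup>2) \<longlonglongrightarrow> 0"
    by (rule tendsto_sandwich[OF always_eventually always_eventually tendsto_const up]) (intro allI zero_le_power2 le)+
  from tendsto_real_sqrt[OF this] have "(\<lambda>n. norm (?X (?X (?u n)) + s\<^sup>2 *\<^sub>R ?u n)) \<longlonglongrightarrow> 0" by simp
  then have w: "(\<lambda>n. ?X (?X (?u n)) + s\<^sup>2 *\<^sub>R ?u n) \<longlonglongrightarrow> 0" by (rule tendsto_norm_zero_cancel)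
  have Xl: "(\<lambda>n. ?X (?X (?u n))) \<longlonglongrightarrow> ?X l" by (intro tendsto_intros l)
  have "(\<lambda>n. (1 / s\<^sup>2) *\<^sub>R ((?X (?X (?u n)) + s\<^sup>2 *\<^sub>R ?u n) - ?X (?X (?u n)))) \<longlonglongrightarrow> (1 / s\<^sup>2) *\<^sub>R (0 - ?X l)"
    by (intro tendsto_intros w Xl)
  then obtain e where e: "?u \<longlonglongrightarrow> e" using s by auto
  have "(\<lambda>n. norm (?u n)) \<longlonglongrightarrow> norm e" by (intro tendsto_norm e)
  then have "norm e = 1" using v(1) by (simp add: LIMSEQ_const_iff)
  moreover have "(\<lambda>n. ?X (?X (?u n)) + s\<^sup>2 *\<^sub>R ?u n) \<longlonglongrightarrow> ?X (?X e) + s\<^sup>2 *\<^sub>R e" by (intro tendsto_intros e)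
  then have "?X (?X e) + s\<^sup>2 *\<^sub>R e = 0" using LIMSEQ_unique w by blast
  ultimately show ?thesis by (auto simp: s_def eq_neg_iff_add_eq_0)
qed

text \<open>
  The expansion \<open>X = \<Sum>i. \<sigma> i *\<^sub>R (e i \<and> f i)\<close> over orthonormal planes.  For \<open>\<sigma> i = 0\<close> the vectors
  \<open>e i\<close> and \<open>f i\<close> are \<open>0\<close>; with this convention operators of finite rank have the same form as
  all others, also when \<open>E\<close> has finite dimension.
\<close>

locale skew_normal_form =
  fixes X :: "'a::{real_inner,banach} \<Rightarrow>\<^sub>L 'a" and \<sigma> :: "nat \<Rightarrow> real" and e f :: "nat \<Rightarrow> 'a"
  assumes antimono: "antimono \<sigma>" and nonneg: "\<And>i. 0 \<le> \<sigma> i" and lim: "\<sigma> \<longlonglongrightarrow> 0"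
    and ee: "\<And>i j. e i \<bullet> e j = (if i = j \<and> 0 < \<sigma> i then 1 else 0)"
    and ff: "\<And>i j. f i \<bullet> f j = (if i = j \<and> 0 < \<sigma> i then 1 else 0)"
    and ef: "\<And>i j. e i \<bullet> f j = 0"
    and approx: "\<And>n. norm (X - (\<Sum>m<n. \<sigma> m *\<^sub>R wedge (e m) (f m))) \<le> \<sigma> n"

text \<open>One step of the construction splits off a plane on which the norm is attained.\<close>

definition top_vector :: "('a::{real_inner,banach} \<Rightarrow>\<^sub>L 'a) \<Rightarrow> 'a" where
  "top_vector Y = (if Y = 0 then 0
     else (SOME e. norm e = 1 \<and> Y (Y e) = - ((norm Y)\<^sup>2 *\<^sub>R e)))"

definition top_partner :: "('a::{real_inner,banach} \<Rightarrow>\<^sub>L 'a) \<Rightarrow> 'a" where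
  "top_partner Y = (1 / norm Y) *\<^sub>R Y (top_vector Y)"

definition deflate :: "('a::{real_inner,banach} \<Rightarrow>\<^sub>L 'a) \<Rightarrow> 'a \<Rightarrow>\<^sub>L 'a" where
  "deflate Y = Y - norm Y *\<^sub>R wedge (top_vector Y) (top_partner Y)"

context
  fixes Y :: "'a::{real_inner,banach} \<Rightarrow>\<^sub>L 'a"
  assumes comp: "compact_op Y" and sk: "skew Y"
begin

lemma top_props:
  shows "Y (top_vector Y) = norm Y *\<^sub>R top_partner Y"
    "Y (top_partner Y) = - (norm Y *\<^sub>R top_vector Y)"
    "top_vector Y \<bullet> top_vector Y = (if 0 < norm Y then 1 else 0)"
    "top_partner Y \<bullet> top_partner Y = (if 0 < norm Y then 1 else 0)"
    "top_vector Y \<bullet> top_partner Y = 0"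
proof -
  let ?Y = "blinfun_apply Y" and ?e = "top_vector Y" and ?f = "top_partner Y"
  have "norm ?e = 1 \<and> ?Y (?Y ?e) = - ((norm Y)\<^sup>2 *\<^sub>R ?e)" if "Y \<noteq> 0"
    using someI_ex[OF skew_norm_attained[OF comp sk that]] that by (simp add: top_vector_def)
  then have e: "Y \<noteq> 0 \<Longrightarrow> ?e \<bullet> ?e = 1" and YY: "?Y (?Y ?e) = - ((norm Y)\<^sup>2 *\<^sub>R ?e)"
    by (cases "Y = 0"; auto simp: power2_norm_eq_inner[symmetric] top_vector_def)+
  show "?Y ?e = norm Y *\<^sub>R ?f" by (auto simp: top_partner_def)
  show "?Y ?f = - (norm Y *\<^sub>R ?e)"
    by (auto simp: top_partner_def blinfun.scaleR_right YY power2_eq_square)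
  show "?e \<bullet> ?e = (if 0 < norm Y then 1 else 0)" using e by (auto simp: top_vector_def)
  have "?Y ?e \<bullet> ?Y ?e = (norm Y)\<^sup>2 * (?e \<bullet> ?e)" by (simp add: skewD[OF sk] YY)
  then show "?f \<bullet> ?f = (if 0 < norm Y then 1 else 0)"
    using e by (auto simp: top_partner_def power2_eq_square)
  have "?Y ?e \<bullet> ?e = - (?e \<bullet> ?Y ?e)" by (rule skewD[OF sk])
  then have "?e \<bullet> ?Y ?e = 0" by (simp add: inner_commute)
  then show "?e \<bullet> ?f = 0" by (simp add: top_partner_def)
qed

text \<open>
  The plane that is split off lies in the range of \<open>Y\<close>, which is orthogonal to the kernel.  Thus it
  is orthogonal to all planes split off before.
\<close>

lemma top_orthogonal_kernel:
  assumes "Y z = 0"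
  shows "top_vector Y \<bullet> z = 0" "top_partner Y \<bullet> z = 0"
proof -
  have "norm Y *\<^sub>R (top_partner Y \<bullet> z) = 0" "norm Y *\<^sub>R (top_vector Y \<bullet> z) = 0"
    using skewD[OF sk, of "top_vector Y" z] skewD[OF sk, of "top_partner Y" z] assms
    by (simp_all add: top_props)
  then show "top_vector Y \<bullet> z = 0" "top_partner Y \<bullet> z = 0"
    by (auto simp: top_partner_def top_vector_def)
qed

lemma deflate_props:
  shows "compact_op (deflate Y)" "skew (deflate Y)"
    "deflate Y (top_vector Y) = 0" "deflate Y (top_partner Y) = 0"
    "Y z = 0 \<Longrightarrow> deflate Y z = 0"
    "norm (deflate Y) \<le> norm Y"
proof -
  let ?e = "top_vector Y" and ?f = "top_partner Y"
  have eq: "deflate Y = Y + (- norm Y) *\<^sub>R wedge ?e ?f" by (simp add: deflate_def)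
  show "compact_op (deflate Y)" unfolding eq by (intro compact_op_add comp compact_op_scaleR compact_op_wedge)
  show "skew (deflate Y)" unfolding eq by (intro skew_add sk skew_scaleR skew_wedge)
  have app: "deflate Y v = Y v - norm Y *\<^sub>R ((?e \<bullet> v) *\<^sub>R ?f - (?f \<bullet> v) *\<^sub>R ?e)" for v
    by (simp add: deflate_def blinfun.diff_left blinfun.scaleR_left wedge_apply)
  show "deflate Y ?e = 0" "deflate Y ?f = 0"
    by (auto simp: app top_props inner_commute[of ?f ?e])
  show "Y z = 0 \<Longrightarrow> deflate Y z = 0"
    by (simp add: app top_orthogonal_kernel)
  show "norm (deflate Y) \<le> norm Y"
  proof (rule norm_blinfun_bound)
    fix v
    let ?v = "v - (?e \<bullet> v) *\<^sub>R ?e - (?f \<bullet> v) *\<^sub>R ?f"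
    have "deflate Y v = Y ?v"
      by (simp add: app blinfun.diff_right blinfun.add_right blinfun.scaleR_right top_props algebra_simps)
    moreover have "(norm ?v)\<^sup>2 \<le> (norm v)\<^sup>2"
    proof -
      have "(norm ?v)\<^sup>2 = (norm v)\<^sup>2 - (2 - ?e \<bullet> ?e) * (?e \<bullet> v)\<^sup>2 - (2 - ?f \<bullet> ?f) * (?f \<bullet> v)\<^sup>2"
        using top_props(5) unfolding power2_norm_eq_inner
        by (simp add: inner_diff inner_commute algebra_simps power2_eq_square)
      moreover have "0 \<le> (2 - ?e \<bullet> ?e) * (?e \<bullet> v)\<^sup>2" "0 \<le> (2 - ?f \<bullet> ?f) * (?f \<bullet> v)\<^sup>2"
        by (simp_all add: top_props)
      ultimately show ?thesis by linarith
    qed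
    then have "norm ?v \<le> norm v" by (rule power2_le_imp_le) simp
    ultimately show "norm (deflate Y v) \<le> norm Y * norm v"
      using norm_blinfun[of Y ?v] mult_left_mono[of "norm ?v" "norm v" "norm Y"] by simp
  qed simp
qed

end

text \<open>
  Iterated deflation.  The norms \<open>\<sigma> n\<close> of the remainders decrease, and they tend to \<open>0\<close> because
  otherwise the orthogonal vectors \<open>X (e n) = \<sigma> n *\<^sub>R f n\<close> would have no convergent subsequence,
  contrary to compactness.
\<close>

theorem skew_normal_form_exists:
  assumes comp: "compact_op X" and sk: "skew X"
  obtains \<sigma> e f where "skew_normal_form X \<sigma> e f"
proof
  define R where "R n = (deflate ^^ n) X" for n
  define \<sigma> where "\<sigma> n = norm (R n)" for n
  define e where "e n = top_vector (R n)" for n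
  define f where "f n = top_partner (R n)" for n
  have R_Suc: "R (Suc n) = deflate (R n)" for n by (simp add: R_def)
  have R: "compact_op (R n)" "skew (R n)" for n
    by (induction n) (auto simp: R_Suc deflate_props, auto simp: R_def comp sk)
  have R_ker: "R n (e m) = 0 \<and> R n (f m) = 0" if "m < n" for m n
    using that
  proof (induction n)
    case (Suc n)
    then show ?case
      by (cases "m = n") (auto simp: R_Suc e_def f_def deflate_props(3,4)[OF R] intro!: deflate_props(5)[OF R])
  qed simp
  have orth: "e n \<bullet> e m = 0 \<and> e n \<bullet> f m = 0 \<and> f n \<bullet> e m = 0 \<and> f n \<bullet> f m = 0" if "m < n" for m n
    using R_ker[OF that] top_orthogonal_kernel[OF R(1) R(2), of n] by (auto simp: e_def f_def)
  have ee: "e i \<bullet> e j = (if i = j \<and> 0 < \<sigma> i then 1 else 0)" for i j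
    using orth[of i j] orth[of j i] top_props(3)[OF R, of i]
    by (cases i j rule: linorder_cases) (auto simp: e_def \<sigma>_def inner_commute)
  have ff: "f i \<bullet> f j = (if i = j \<and> 0 < \<sigma> i then 1 else 0)" for i j
    using orth[of i j] orth[of j i] top_props(4)[OF R, of i]
    by (cases i j rule: linorder_cases) (auto simp: f_def \<sigma>_def inner_commute)
  have ef: "e i \<bullet> f j = 0" for i j
    using orth[of i j] orth[of j i] top_props(5)[OF R, of i]
    by (cases i j rule: linorder_cases) (auto simp: e_def f_def inner_commute)
  have anti: "antimono \<sigma>"
    by (rule decseq_SucI) (simp add: \<sigma>_def R_Suc deflate_props(6)[OF R])
  have sum: "X - (\<Sum>m<n. \<sigma> m *\<^sub>R wedge (e m) (f m)) = R n" for n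
    by (induction n) (auto simp: R_Suc deflate_def \<sigma>_def e_def f_def algebra_simps, simp add: R_def)
  have Xe: "X (e n) = \<sigma> n *\<^sub>R f n" for n
  proof -
    have "(\<Sum>m<n. \<sigma> m *\<^sub>R wedge (e m) (f m)) (e n) = 0"
      by (auto simp: blinfun.sum_left blinfun.scaleR_left wedge_apply ee ef[symmetric] inner_commute[of "f _"] ef
          intro!: sum.neutral)
    then have "X (e n) = R n (e n)"
      using sum[of n] by (metis blinfun.diff_left diff_zero)
    then show ?thesis by (simp add: top_props(1)[OF R] e_def f_def \<sigma>_def)
  qed
  have nn: "0 \<le> \<sigma> n" for n by (simp add: \<sigma>_def)
  have small: "\<exists>n. \<sigma> n < c" if c: "0 < c" for c
  proof (rule ccontr)
    assume "\<not> (\<exists>n. \<sigma> n < c)"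
    then have ge: "c \<le> \<sigma> n" for n by (simp add: not_less)
    have "norm (e n) \<le> 1" for n
      using ee[of n n] by (auto simp: norm_eq_sqrt_inner)
    then obtain r l where r: "strict_mono r" and l: "(\<lambda>n. X (e (r n))) \<longlonglongrightarrow> l"
      using compact_op_subseq[OF comp, of e] by metis
    obtain M where M: "\<And>p q. p \<ge> M \<Longrightarrow> q \<ge> M \<Longrightarrow> norm (X (e (r p)) - X (e (r q))) < c"
      using CauchyD[OF LIMSEQ_imp_Cauchy[OF l] c] by blast
    let ?p = "r M" and ?q = "r (Suc M)"
    have "?p \<noteq> ?q" using r by (simp add: strict_mono_eq)
    then have "(norm (X (e ?p) - X (e ?q)))\<^sup>2 = (\<sigma> ?p)\<^sup>2 + (\<sigma> ?q)\<^sup>2"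
      using ge[of ?p] ge[of ?q] c unfolding power2_norm_eq_inner Xe
      by (simp add: inner_diff ff power2_eq_square)
    moreover have "c\<^sup>2 \<le> (\<sigma> ?p)\<^sup>2" using ge[of ?p] c by (intro power_mono) auto
    ultimately have "c\<^sup>2 \<le> (norm (X (e ?p) - X (e ?q)))\<^sup>2"
      using zero_le_power2[of "\<sigma> ?q"] by linarith
    then have "c \<le> norm (X (e ?p) - X (e ?q))"
      by (rule power2_le_imp_le) simp
    then show False using M[of M "Suc M"] by simp
  qed
  have "\<sigma> \<longlonglongrightarrow> 0"
  proof (intro LIMSEQ_I)
    fix c :: real assume "0 < c"
    with small obtain N where "\<sigma> N < c" by blast
    then have "norm (\<sigma> n - 0) < c" if "N \<le> n" for n
      using decseqD[OF anti that] nn[of n] by simp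
    then show "\<exists>N. \<forall>n\<ge>N. norm (\<sigma> n - 0) < c" by blast
  qed
  then show "skew_normal_form X \<sigma> e f"
    by unfold_locales (use anti nn ee ff ef sum in \<open>auto simp: \<sigma>_def\<close>)
qed

section \<open>Singular values\<close>

text \<open>
  Where two monotone sequences differ for the first time, the larger of the two values is attained
  more often by the sequence that takes it there.
\<close>

lemma eigenvalue_seq_unique:
  assumes l: "eigenvalue_seq P l" and k: "eigenvalue_seq P k"
  shows "l = k"
proof -
  have not_less: "\<not> k n < l n" if l: "eigenvalue_seq P l" and k: "eigenvalue_seq P k"
    and eq: "\<And>m. m < n \<Longrightarrow> l m = k m" for l k n
  proof
    assume lt: "k n < l n"
    define \<mu> where "\<mu> = l n"
    have pos: "0 < \<mu>" using lt k by (auto simp: \<mu>_def eigenvalue_seq_def intro: le_less_trans)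
    have anti: "antimono k" using k by (simp add: eigenvalue_seq_def)
    have "{m. k m = \<mu>} \<subset> {m. l m = \<mu>}"
    proof
      show "{m. k m = \<mu>} \<subseteq> {m. l m = \<mu>}"
      proof
        fix m assume m: "m \<in> {m. k m = \<mu>}"
        then have "m < n" using antimonoD[OF anti, of n m] lt by (force simp: \<mu>_def not_less[symmetric])
        then show "m \<in> {m. l m = \<mu>}" using m eq by simp
      qed
      have "n \<in> {m. l m = \<mu>}" "n \<notin> {m. k m = \<mu>}" using lt by (auto simp: \<mu>_def)
      then show "{m. k m = \<mu>} \<noteq> {m. l m = \<mu>}" by blast
    qed
    then have "card {m. k m = \<mu>} < card {m. l m = \<mu>}"
      using l pos by (intro psubset_card_mono) (auto simp: eigenvalue_seq_def)
    then show False using l k pos by (simp add: eigenvalue_seq_def)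
  qed
  have "l n = k n" for n
  proof (induction n rule: less_induct)
    case (less n)
    have "\<not> k n < l n" by (rule not_less[OF l k less])
    moreover have "\<not> l n < k n" by (rule not_less[OF k l]) (simp add: less)
    ultimately show ?case by linarith
  qed
  then show ?thesis by blast
qed

lemma bessel_inequality:
  fixes g :: "'i \<Rightarrow> 'a::real_inner"
  assumes fin: "finite I"
    and g: "\<And>i j. i \<in> I \<Longrightarrow> j \<in> I \<Longrightarrow> i \<noteq> j \<Longrightarrow> g i \<bullet> g j = 0" "\<And>i. i \<in> I \<Longrightarrow> g i \<bullet> g i \<le> 1"
  shows "(\<Sum>i\<in>I. (g i \<bullet> v)\<^sup>2) \<le> (norm v)\<^sup>2"
    "(norm (\<Sum>i\<in>I. c i *\<^sub>R g i))\<^sup>2 \<le> (\<Sum>i\<in>I. (c i)\<^sup>2)"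
proof -
  have sq: "(norm (\<Sum>i\<in>I. c i *\<^sub>R g i))\<^sup>2 = (\<Sum>i\<in>I. (c i)\<^sup>2 * (g i \<bullet> g i))" for c
  proof -
    have "(norm (\<Sum>i\<in>I. c i *\<^sub>R g i))\<^sup>2 = (\<Sum>i\<in>I. \<Sum>j\<in>I. c i * (c j * (g j \<bullet> g i)))"
      by (simp add: power2_norm_eq_inner inner_sum_left inner_sum_right sum_distrib_left) 
    also have "\<dots> = (\<Sum>i\<in>I. \<Sum>j\<in>I. if j = i then (c i)\<^sup>2 * (g i \<bullet> g i) else 0)"
      by (intro sum.cong refl) (auto simp: g(1) power2_eq_square)
    finally show ?thesis using fin by simp
  qed
  then show le: "(norm (\<Sum>i\<in>I. c i *\<^sub>R g i))\<^sup>2 \<le> (\<Sum>i\<in>I. (c i)\<^sup>2)" for c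
    by (auto intro!: sum_mono simp: mult_left_le g(2))
  define w where "w = (\<Sum>i\<in>I. (g i \<bullet> v) *\<^sub>R g i)"
  have "w \<bullet> v = (\<Sum>i\<in>I. (g i \<bullet> v)\<^sup>2)" by (simp add: w_def inner_sum_left power2_eq_square)
  moreover have "(norm w)\<^sup>2 \<le> (\<Sum>i\<in>I. (g i \<bullet> v)\<^sup>2)" unfolding w_def by (rule le)
  moreover have "0 \<le> (norm (v - w))\<^sup>2" by simp
  ultimately show "(\<Sum>i\<in>I. (g i \<bullet> v)\<^sup>2) \<le> (norm v)\<^sup>2"
    by (simp add: power2_norm_eq_inner inner_diff inner_commute)
qed

lemma sum_pair_family:
  "(\<Sum>i\<in>I \<times> (UNIV :: bool set). h i) = (\<Sum>m\<in>I. h (m, True) + h (m, False))"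
proof -
  have "(\<Sum>i\<in>I \<times> (UNIV :: bool set). h i) = (\<Sum>m\<in>I. \<Sum>b\<in>UNIV. h (m, b))"
    by (simp add: sum.cartesian_product)
  then show ?thesis by (simp add: UNIV_bool add.commute)
qed

context skew_normal_form
begin

text \<open>
  The vectors \<open>e i\<close> and \<open>f i\<close> as one family, to which Bessel's inequality applies.
\<close>

definition frame :: "nat \<times> bool \<Rightarrow> 'a" where
  "frame = (\<lambda>(m, b). if b then e m else f m)"

lemma frame_orth: "i \<noteq> j \<Longrightarrow> frame i \<bullet> frame j = 0" and frame_le: "frame i \<bullet> frame i \<le> 1"
  by (auto simp: frame_def ee ff ef inner_commute[of "f _" "e _"] split: prod.splits)

lemma bessel_frame: "finite I \<Longrightarrow> (\<Sum>m\<in>I. (e m \<bullet> v)\<^sup>2 + (f m \<bullet> v)\<^sup>2) \<le> (norm v)\<^sup>2"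
  using bessel_inequality(1)[of "I \<times> UNIV" frame v] frame_orth frame_le
  by (simp add: sum_pair_family) (simp add: frame_def)

lemma norm_frame_sum_le:
  "finite I \<Longrightarrow> (norm (\<Sum>m\<in>I. a m *\<^sub>R e m + b m *\<^sub>R f m))\<^sup>2 \<le> (\<Sum>m\<in>I. (a m)\<^sup>2 + (b m)\<^sup>2)"
  using bessel_inequality(2)[of "I \<times> UNIV" frame "\<lambda>(m, c). if c then a m else b m"] frame_orth frame_le
  by (simp add: sum_pair_family) (simp add: frame_def)

definition part :: "nat \<Rightarrow> 'a \<Rightarrow>\<^sub>L 'a" where
  "part n = (\<Sum>m<n. \<sigma> m *\<^sub>R wedge (e m) (f m))"

lemma part_lim: "part \<longlonglongrightarrow> X"
proof -
  have "(\<lambda>n. norm (X - part n)) \<longlonglongrightarrow> 0"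
    by (rule tendsto_sandwich[OF always_eventually always_eventually tendsto_const lim])
       (use approx in \<open>auto simp: part_def\<close>)
  then have "(\<lambda>n. X - part n) \<longlonglongrightarrow> 0" by (rule tendsto_norm_zero_cancel)
  from tendsto_diff[OF tendsto_const this] have "(\<lambda>n. X - (X - part n)) \<longlonglongrightarrow> X - 0" .
  then show ?thesis by simp
qed

lemma part_apply: "part n v = (\<Sum>m<n. \<sigma> m *\<^sub>R ((e m \<bullet> v) *\<^sub>R f m - (f m \<bullet> v) *\<^sub>R e m))"
  by (simp add: part_def blinfun.sum_left blinfun.scaleR_left wedge_apply)

lemma vanish: "\<sigma> i = 0 \<Longrightarrow> e i = 0 \<and> f i = 0"
  using ee[of i i] ff[of i i] by simp

lemma part_e: "i < n \<Longrightarrow> part n (e i) = \<sigma> i *\<^sub>R f i"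
  and part_f: "i < n \<Longrightarrow> part n (f i) = - (\<sigma> i *\<^sub>R e i)"
proof -
  assume i: "i < n"
  have "part n (e i) = (\<Sum>m<n. if m = i then \<sigma> i *\<^sub>R f i else 0)"
    unfolding part_apply
    by (intro sum.cong refl) (use nonneg[of i] vanish[of i] in \<open>auto simp: ee ef inner_commute[of "f _" "e _"] order_le_less\<close>)
  then show "part n (e i) = \<sigma> i *\<^sub>R f i" using i by simp
  have "part n (f i) = (\<Sum>m<n. if m = i then - (\<sigma> i *\<^sub>R e i) else 0)"
    unfolding part_apply
    by (intro sum.cong refl) (use nonneg[of i] vanish[of i] in \<open>auto simp: ff ef order_le_less\<close>)
  then show "part n (f i) = - (\<sigma> i *\<^sub>R e i)" using i by simp
qed

lemma X_e: "X (e i) = \<sigma> i *\<^sub>R f i"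
  and X_f: "X (f i) = - (\<sigma> i *\<^sub>R e i)"
proof -
  have "(\<lambda>n. part n (e i)) \<longlonglongrightarrow> X (e i)" by (intro tendsto_intros part_lim)
  moreover have "\<forall>\<^sub>F n in sequentially. part n (e i) = \<sigma> i *\<^sub>R f i"
    using eventually_gt_at_top[of i] by eventually_elim (rule part_e)
  ultimately show "X (e i) = \<sigma> i *\<^sub>R f i"
    using LIMSEQ_unique tendsto_eventually by metis
  have "(\<lambda>n. part n (f i)) \<longlonglongrightarrow> X (f i)" by (intro tendsto_intros part_lim)
  moreover have "\<forall>\<^sub>F n in sequentially. part n (f i) = - (\<sigma> i *\<^sub>R e i)"
    using eventually_gt_at_top[of i] by eventually_elim (rule part_f)
  ultimately show "X (f i) = - (\<sigma> i *\<^sub>R e i)"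
    using LIMSEQ_unique tendsto_eventually by metis
qed

lemma skew_X: "skew X"
  by (rule skew_limit[OF _ part_lim]) (auto simp: part_def intro!: skew_sum skew_scaleR skew_wedge)

definition modulus_part :: "nat \<Rightarrow> 'a \<Rightarrow>\<^sub>L 'a" where
  "modulus_part n = (\<Sum>m<n. \<sigma> m *\<^sub>R (tensor (e m) (e m) + tensor (f m) (f m)))"

lemma modulus_part_apply:
  "modulus_part n v = (\<Sum>m<n. \<sigma> m *\<^sub>R ((e m \<bullet> v) *\<^sub>R e m + (f m \<bullet> v) *\<^sub>R f m))"
  by (simp add: modulus_part_def blinfun.sum_left blinfun.scaleR_left blinfun.add_left tensor_apply)

lemma modulus_part_e: "i < n \<Longrightarrow> modulus_part n (e i) = \<sigma> i *\<^sub>R e i"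
  and modulus_part_f: "i < n \<Longrightarrow> modulus_part n (f i) = \<sigma> i *\<^sub>R f i"
proof -
  assume i: "i < n"
  have "modulus_part n (e i) = (\<Sum>m<n. if m = i then \<sigma> i *\<^sub>R e i else 0)"
    unfolding modulus_part_apply
    by (intro sum.cong refl) (use nonneg[of i] vanish[of i] in \<open>auto simp: ee ef inner_commute[of "f _" "e _"] order_le_less\<close>)
  then show "modulus_part n (e i) = \<sigma> i *\<^sub>R e i" using i by simp
  have "modulus_part n (f i) = (\<Sum>m<n. if m = i then \<sigma> i *\<^sub>R f i else 0)"
    unfolding modulus_part_apply
    by (intro sum.cong refl) (use nonneg[of i] vanish[of i] in \<open>auto simp: ff ef order_le_less\<close>)
  then show "modulus_part n (f i) = \<sigma> i *\<^sub>R f i" using i by simp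
qed

text \<open>
  On each plane \<open>- X\<^sup>2\<close> and the square of the modulus are both multiplication by \<open>(\<sigma> m)\<^sup>2\<close>.
\<close>

lemma modulus_part_square:
  "modulus_part n (modulus_part n v) = - part n (part n v)"
proof -
  have "modulus_part n (modulus_part n v)
      = (\<Sum>m<n. \<sigma> m *\<^sub>R ((e m \<bullet> v) *\<^sub>R \<sigma> m *\<^sub>R e m + (f m \<bullet> v) *\<^sub>R \<sigma> m *\<^sub>R f m))"
    by (subst (2) modulus_part_apply)
       (simp add: blinfun.sum_right blinfun.scaleR_right blinfun.add_right modulus_part_e modulus_part_f)
  moreover have "part n (part n v)
      = (\<Sum>m<n. \<sigma> m *\<^sub>R ((e m \<bullet> v) *\<^sub>R (- (\<sigma> m *\<^sub>R e m)) - (f m \<bullet> v) *\<^sub>R \<sigma> m *\<^sub>R f m))"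
    by (subst (2) part_apply)
       (simp add: blinfun.sum_right blinfun.scaleR_right blinfun.diff_right part_e part_f)
  ultimately show ?thesis
    by (simp add: sum_negf[symmetric] scaleR_diff_right scaleR_add_right add.commute)
qed

lemma modulus_part_Cauchy: "Cauchy modulus_part"
proof (rule CauchyI')
  fix c :: real assume "0 < c"
  then obtain N where N: "\<sigma> N < c"
    using lim by (metis LIMSEQ_D le_refl diff_zero abs_of_nonneg nonneg real_norm_def)
  have "norm (modulus_part p - modulus_part q) < c" if pq: "N \<le> p" "p < q" for p q
  proof -
    have "norm (modulus_part q - modulus_part p) \<le> \<sigma> N"
    proof (rule norm_blinfun_bound[OF nonneg])
      fix v
      have "(modulus_part q - modulus_part p) v
          = (\<Sum>m\<in>{p..<q}. (\<sigma> m * (e m \<bullet> v)) *\<^sub>R e m + (\<sigma> m * (f m \<bullet> v)) *\<^sub>R f m)"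
        using pq by (simp add: blinfun.diff_left modulus_part_apply scaleR_add_right sum_diff_nat_ivl lessThan_atLeast0)
      then have "(norm ((modulus_part q - modulus_part p) v))\<^sup>2
          \<le> (\<Sum>m\<in>{p..<q}. (\<sigma> m * (e m \<bullet> v))\<^sup>2 + (\<sigma> m * (f m \<bullet> v))\<^sup>2)"
        using norm_frame_sum_le[of "{p..<q}"] by simp
      also have "\<dots> \<le> (\<Sum>m\<in>{p..<q}. (\<sigma> N)\<^sup>2 * ((e m \<bullet> v)\<^sup>2 + (f m \<bullet> v)\<^sup>2))"
      proof (rule sum_mono)
        fix m assume "m \<in> {p..<q}"
        then have "(\<sigma> m)\<^sup>2 \<le> (\<sigma> N)\<^sup>2" using antimonoD[OF antimono, of N m] pq nonneg by (intro power_mono) auto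
        then have "(\<sigma> m)\<^sup>2 * ((e m \<bullet> v)\<^sup>2 + (f m \<bullet> v)\<^sup>2) \<le> (\<sigma> N)\<^sup>2 * ((e m \<bullet> v)\<^sup>2 + (f m \<bullet> v)\<^sup>2)"
          by (rule mult_right_mono) simp
        then show "(\<sigma> m * (e m \<bullet> v))\<^sup>2 + (\<sigma> m * (f m \<bullet> v))\<^sup>2 \<le> (\<sigma> N)\<^sup>2 * ((e m \<bullet> v)\<^sup>2 + (f m \<bullet> v)\<^sup>2)"
          by (simp add: power_mult_distrib distrib_left)
      qed
      also have "\<dots> \<le> (\<sigma> N)\<^sup>2 * (norm v)\<^sup>2"
        unfolding sum_distrib_left[symmetric] by (intro mult_left_mono bessel_frame) auto
      finally have "(norm ((modulus_part q - modulus_part p) v))\<^sup>2 \<le> (\<sigma> N * norm v)\<^sup>2"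
        by (simp add: power_mult_distrib)
      then show "norm ((modulus_part q - modulus_part p) v) \<le> \<sigma> N * norm v"
        by (rule power2_le_imp_le) (simp add: nonneg)
    qed
    then show ?thesis using N by (simp add: norm_minus_commute)
  qed
  then show "\<exists>M. \<forall>m\<ge>M. \<forall>n>m. dist (modulus_part m) (modulus_part n) < c"
    unfolding dist_norm by blast
qed

definition modulus :: "'a \<Rightarrow>\<^sub>L 'a" where
  "modulus = lim modulus_part"

lemma modulus_lim: "modulus_part \<longlonglongrightarrow> modulus"
  using Cauchy_convergent[OF modulus_part_Cauchy] by (simp add: modulus_def convergent_LIMSEQ_iff)

lemma modulus_e: "modulus (e i) = \<sigma> i *\<^sub>R e i"
  and modulus_f: "modulus (f i) = \<sigma> i *\<^sub>R f i"
proof -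
  have "(\<lambda>n. modulus_part n (e i)) \<longlonglongrightarrow> modulus (e i)" by (intro tendsto_intros modulus_lim)
  moreover have "\<forall>\<^sub>F n in sequentially. modulus_part n (e i) = \<sigma> i *\<^sub>R e i"
    using eventually_gt_at_top[of i] by eventually_elim (rule modulus_part_e)
  ultimately show "modulus (e i) = \<sigma> i *\<^sub>R e i"
    using LIMSEQ_unique tendsto_eventually by metis
  have "(\<lambda>n. modulus_part n (f i)) \<longlonglongrightarrow> modulus (f i)" by (intro tendsto_intros modulus_lim)
  moreover have "\<forall>\<^sub>F n in sequentially. modulus_part n (f i) = \<sigma> i *\<^sub>R f i"
    using eventually_gt_at_top[of i] by eventually_elim (rule modulus_part_f)
  ultimately show "modulus (f i) = \<sigma> i *\<^sub>R f i"
    using LIMSEQ_unique tendsto_eventually by metis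
qed

lemma modulus_symmetric: "modulus x \<bullet> y = x \<bullet> modulus y"
proof -
  have "(\<lambda>n. modulus_part n x \<bullet> y) \<longlonglongrightarrow> modulus x \<bullet> y"
    by (intro tendsto_intros modulus_lim)
  moreover have "(\<lambda>n. x \<bullet> modulus_part n y) \<longlonglongrightarrow> x \<bullet> modulus y"
    by (intro tendsto_intros modulus_lim)
  moreover have "modulus_part n x \<bullet> y = x \<bullet> modulus_part n y" for n
    by (simp add: modulus_part_apply inner_sum_left inner_sum_right inner_add_left inner_add_right
        inner_commute[of x] mult_ac)
  ultimately show ?thesis using LIMSEQ_unique by simp
qed

lemma positive_modulus: "positive_op modulus"
  unfolding positive_op_def
proof (intro conjI allI)
  fix x
  have "(\<lambda>n. modulus_part n x \<bullet> x) \<longlonglongrightarrow> modulus x \<bullet> x"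
    by (intro tendsto_intros modulus_lim)
  moreover have "0 \<le> modulus_part n x \<bullet> x" for n
    by (auto simp: modulus_part_apply inner_sum_left inner_add_left nonneg intro!: sum_nonneg mult_nonneg_nonneg)
  ultimately show "0 \<le> modulus x \<bullet> x" by (intro LIMSEQ_le_const) auto
qed (rule modulus_symmetric)

lemma modulus_square: "modulus o\<^sub>L modulus = - (X o\<^sub>L X)"
proof (rule blinfun_eqI)
  fix v
  have "(\<lambda>n. modulus_part n (modulus_part n v))
      \<longlonglongrightarrow> modulus (modulus v)"
    by (intro tendsto_intros modulus_lim)
  moreover have "(\<lambda>n. - part n (part n v)) \<longlonglongrightarrow> - X (X v)"
    by (intro tendsto_intros part_lim)
  ultimately show "(modulus o\<^sub>L modulus) v = (- (X o\<^sub>L X)) v"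
    using LIMSEQ_unique by (simp add: modulus_part_square blinfun.minus_left)
qed

text \<open>
  A positive square root \<open>Q\<close> of \<open>- X\<^sup>2\<close> agrees with \<open>modulus\<close> on the frame, and off the frame
  both are small because \<open>\<parallel>Q v\<parallel> = \<parallel>X v\<parallel>\<close>.
\<close>

lemma modulus_unique:
  assumes pos: "positive_op Q" and sq: "Q o\<^sub>L Q = - (X o\<^sub>L X)"
  shows "Q = modulus"
proof (rule blinfun_eqI)
  fix v
  let ?Q = "blinfun_apply Q" and ?X = "blinfun_apply X"
  have QQ: "?Q (?Q x) = - ?X (?X x)" for x
    using arg_cong[OF sq, of "\<lambda>T. blinfun_apply T x"] by (simp add: blinfun.minus_left)
  have norm: "norm (?Q x) = norm (?X x)" for x
  proof -
    have "?Q x \<bullet> ?Q x = x \<bullet> ?Q (?Q x)" using pos by (simp add: positive_op_def)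
    also have "\<dots> = ?X x \<bullet> ?X x" using skewD[OF skew_X, of x "?X x"] by (simp add: QQ)
    finally show ?thesis by (simp add: norm_eq_sqrt_inner)
  qed
  have eig: "?Q z = s *\<^sub>R z" if z: "?X (?X z) = - (s\<^sup>2 *\<^sub>R z)" and s: "0 < s" for z s
  proof -
    let ?w = "?Q z - s *\<^sub>R z"
    have "?Q ?w = - (s *\<^sub>R ?w)"
      by (simp add: blinfun.diff_right blinfun.scaleR_right QQ z scaleR_diff_right power2_eq_square)
    moreover have "0 \<le> ?Q ?w \<bullet> ?w" using pos unfolding positive_op_def by blast
    ultimately have "s * (?w \<bullet> ?w) \<le> 0" by simp
    moreover have "a \<le> 0" if "s * a \<le> 0" for a using that s by (simp add: mult_le_0_iff)
    ultimately have "?w \<bullet> ?w \<le> 0" by blast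
    then have "?w \<bullet> ?w = 0" by (rule antisym) (rule inner_ge_zero)
    then show ?thesis by (simp only: inner_eq_zero_iff right_minus_eq)
  qed
  have Qe: "?Q (e i) = \<sigma> i *\<^sub>R e i" for i
  proof (cases "\<sigma> i = 0")
    case False
    then show ?thesis using nonneg[of i]
      by (intro eig) (auto simp: X_e X_f blinfun.scaleR_right power2_eq_square)
  qed (simp add: vanish blinfun.zero_right)
  have Qf: "?Q (f i) = \<sigma> i *\<^sub>R f i" for i
  proof (cases "\<sigma> i = 0")
    case False
    then show ?thesis using nonneg[of i]
      by (intro eig) (auto simp: X_e X_f blinfun.scaleR_right blinfun.minus_right power2_eq_square)
  qed (simp add: vanish blinfun.zero_right)
  define p where "p n = (\<Sum>m<n. (e m \<bullet> v) *\<^sub>R e m + (f m \<bullet> v) *\<^sub>R f m)" for n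
  have Qp: "?Q (p n) = modulus_part n v" for n
    by (simp add: p_def blinfun.sum_right blinfun.add_right blinfun.scaleR_right Qe Qf modulus_part_apply
        scaleR_add_right mult.commute)
  have Xp: "?X (p n) = part n v" for n
    by (simp add: p_def blinfun.sum_right blinfun.add_right blinfun.scaleR_right X_e X_f part_apply
        scaleR_diff_right mult.commute)
  have "norm (?Q v - modulus_part n v) \<le> \<sigma> n * norm v" for n
  proof -
    have "norm (?Q v - modulus_part n v) = norm (?X (v - p n))"
      unfolding Qp[symmetric] blinfun.diff_right[symmetric] by (rule norm)
    also have "\<dots> = norm ((X - part n) v)" by (simp add: blinfun.diff_right blinfun.diff_left Xp)
    also have "\<dots> \<le> norm (X - part n) * norm v" by (rule norm_blinfun)
    also have "\<dots> \<le> \<sigma> n * norm v" using approx[of n] by (intro mult_right_mono) (auto simp: part_def)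
    finally show ?thesis .
  qed
  moreover have "(\<lambda>n. \<sigma> n * norm v) \<longlonglongrightarrow> 0 * norm v" by (intro tendsto_intros lim)
  then have z: "(\<lambda>n. \<sigma> n * norm v) \<longlonglongrightarrow> 0" by simp
  ultimately have "(\<lambda>n. norm (?Q v - modulus_part n v)) \<longlonglongrightarrow> 0"
    by (intro tendsto_sandwich[OF always_eventually always_eventually tendsto_const z] allI norm_ge_zero)
  moreover have "(\<lambda>n. norm (?Q v - modulus_part n v)) \<longlonglongrightarrow> norm (?Q v - modulus v)"
    by (intro tendsto_intros modulus_lim)
  ultimately have "norm (?Q v - modulus v) = 0" using LIMSEQ_unique by blast
  then show "?Q v = modulus v" by simp
qed

lemma abs_op_eq: "abs_op X = modulus"
  unfolding abs_op_def
proof (rule the_equality)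
  show "positive_op modulus \<and> modulus o\<^sub>L modulus = - (X o\<^sub>L X)"
    using positive_modulus modulus_square by blast
  show "Q = modulus" if "positive_op Q \<and> Q o\<^sub>L Q = - (X o\<^sub>L X)" for Q
    using that by (elim conjE) (rule modulus_unique)
qed

lemma level_finite: "0 < \<mu> \<Longrightarrow> finite {i. \<sigma> i = \<mu>}"
proof -
  assume "0 < \<mu>"
  then obtain N where "\<And>n. n \<ge> N \<Longrightarrow> \<sigma> n < \<mu>"
    using order_tendstoD(2)[OF lim] unfolding eventually_sequentially by blast
  then have "{i. \<sigma> i = \<mu>} \<subseteq> {..<N}" by (metis (mono_tags) lessThan_iff less_irrefl mem_Collect_eq not_le subsetI)
  then show ?thesis by (rule finite_subset) simp
qed

text \<open>
  An eigenvector, minus its components in the planes with \<open>\<sigma> i = \<mu>\<close>, is orthogonal to the whole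
  frame, where the modulus vanishes.
\<close>

lemma eigenspace:
  assumes \<mu>: "0 < \<mu>"
  defines "I \<equiv> {i. \<sigma> i = \<mu>}"
  shows "{v. modulus v = \<mu> *\<^sub>R v} = span (e ` I \<union> f ` I)"
proof
  have fin: "finite I" unfolding I_def by (rule level_finite[OF \<mu>])
  show "span (e ` I \<union> f ` I) \<subseteq> {v. modulus v = \<mu> *\<^sub>R v}"
  proof (rule span_minimal)
    show "e ` I \<union> f ` I \<subseteq> {v. modulus v = \<mu> *\<^sub>R v}"
      by (auto simp: I_def modulus_e modulus_f)
    show "subspace {v. modulus v = \<mu> *\<^sub>R v}"
      by (auto simp: subspace_def blinfun.zero_right blinfun.add_right blinfun.scaleR_right scaleR_add_right)
  qed
  show "{v. modulus v = \<mu> *\<^sub>R v} \<subseteq> span (e ` I \<union> f ` I)"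
  proof
    fix v assume "v \<in> {v. modulus v = \<mu> *\<^sub>R v}"
    then have v: "modulus v = \<mu> *\<^sub>R v" by simp
    define p where "p = (\<Sum>m\<in>I. (e m \<bullet> v) *\<^sub>R e m + (f m \<bullet> v) *\<^sub>R f m)"
    have Pp: "modulus p = \<mu> *\<^sub>R p"
      unfolding p_def blinfun.sum_right scaleR_sum_right
      by (intro sum.cong refl) (auto simp: I_def blinfun.add_right blinfun.scaleR_right modulus_e modulus_f
          scaleR_add_right mult.commute)
    have ortho: "e j \<bullet> (v - p) = 0 \<and> f j \<bullet> (v - p) = 0" for j
    proof (cases "j \<in> I")
      case True
      then have "0 < \<sigma> j" using \<mu> by (simp add: I_def)
      have "e j \<bullet> p = (\<Sum>m\<in>I. if m = j then e j \<bullet> v else 0)"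
        unfolding p_def inner_sum_right by (intro sum.cong refl) (use \<open>0 < \<sigma> j\<close> in \<open>auto simp: inner_add_right ee ef\<close>)
      moreover have "f j \<bullet> p = (\<Sum>m\<in>I. if m = j then f j \<bullet> v else 0)"
        unfolding p_def inner_sum_right
        by (intro sum.cong refl) (use \<open>0 < \<sigma> j\<close> in \<open>auto simp: inner_add_right ff inner_commute[of "f _" "e _"] ef\<close>)
      ultimately show ?thesis using True fin by (simp add: inner_diff_right)
    next
      case False
      then have ne: "\<sigma> j \<noteq> \<mu>" by (simp add: I_def)
      have "\<sigma> j * (e j \<bullet> v) = \<mu> * (e j \<bullet> v)" "\<sigma> j * (f j \<bullet> v) = \<mu> * (f j \<bullet> v)"
        using modulus_symmetric[of "e j" v] modulus_symmetric[of "f j" v] by (simp_all add: v modulus_e modulus_f)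
      then have "e j \<bullet> v = 0" "f j \<bullet> v = 0" using ne by auto
      moreover have "e j \<bullet> p = 0" "f j \<bullet> p = 0"
        unfolding p_def inner_sum_right using False
        by (auto intro!: sum.neutral simp: inner_add_right ee ff ef inner_commute[of "f _" "e _"])
      ultimately show ?thesis by (simp add: inner_diff_right)
    qed
    have "modulus_part n (v - p) = 0" for n by (simp add: modulus_part_apply ortho)
    moreover have "(\<lambda>n. modulus_part n (v - p)) \<longlonglongrightarrow> modulus (v - p)"
      by (intro tendsto_intros modulus_lim)
    ultimately have "modulus (v - p) = 0" by (simp add: LIMSEQ_const_iff)
    then have "\<mu> *\<^sub>R (v - p) = 0" by (simp add: blinfun.diff_right v Pp scaleR_diff_right)
    then have "v = p" using \<mu> by simp
    also have "p \<in> span (e ` I \<union> f ` I)"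
      unfolding p_def by (intro span_sum span_add span_scale span_base) auto
    finally show "v \<in> span (e ` I \<union> f ` I)" .
  qed
qed

text \<open>
  The indices \<open>2 i\<close> and \<open>2 i + 1\<close> account for the eigenvectors \<open>e i\<close> and \<open>f i\<close>.
\<close>

lemma eigenvalue_seq_abs_op: "eigenvalue_seq (abs_op X) (\<lambda>n. \<sigma> (n div 2))"
  unfolding eigenvalue_seq_def
proof (intro conjI allI impI)
  show "antimono (\<lambda>n. \<sigma> (n div 2))"
    by (intro antimonoI antimonoD[OF antimono] div_le_mono)
  show "0 \<le> \<sigma> (n div 2)" for n by (rule nonneg)
  fix \<mu> :: real assume \<mu>: "0 < \<mu>"
  define I where "I = {i. \<sigma> i = \<mu>}"
  have fin: "finite I" unfolding I_def by (rule level_finite[OF \<mu>])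
  have idx: "{n. \<sigma> (n div 2) = \<mu>} = (\<lambda>i. 2 * i) ` I \<union> (\<lambda>i. 2 * i + 1) ` I"
  proof (intro set_eqI iffI)
    fix n assume "n \<in> {n. \<sigma> (n div 2) = \<mu>}"
    then have "n div 2 \<in> I" by (simp add: I_def)
    moreover have "n = 2 * (n div 2) \<or> n = 2 * (n div 2) + 1" by linarith
    ultimately show "n \<in> (\<lambda>i. 2 * i) ` I \<union> (\<lambda>i. 2 * i + 1) ` I" by blast
  qed (auto simp: I_def)
  then show "finite {n. \<sigma> (n div 2) = \<mu>}" using fin by simp
  have "card {n. \<sigma> (n div 2) = \<mu>} = card ((\<lambda>i. 2 * i) ` I) + card ((\<lambda>i. 2 * i + 1) ` I)"
    unfolding idx by (rule card_Un_disjoint) (use fin in \<open>auto, presburger\<close>)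
  also have "\<dots> = card I + card I"
    by (intro arg_cong2[where f = "(+)"] card_image) (auto simp: inj_on_def)
  finally have card: "card {n. \<sigma> (n div 2) = \<mu>} = card I + card I" .
  have e1: "e i \<bullet> e j = (if i = j then 1 else 0)" "f i \<bullet> f j = (if i = j then 1 else 0)" if "i \<in> I" for i j
    using that \<mu> by (auto simp: ee ff I_def)
  have inj: "inj_on e I" "inj_on f I"
    by (auto simp: inj_on_def) (metis e1 zero_neq_one)+
  have disj: "e ` I \<inter> f ` I = {}"
    using e1 ef by (auto) (metis e1(1) ef zero_neq_one)
  have "independent (e ` I \<union> f ` I)"
  proof (rule pairwise_orthogonal_independent)
    show "pairwise orthogonal (e ` I \<union> f ` I)"
      by (auto simp: pairwise_def orthogonal_def ee ff ef inner_commute[of "f _" "e _"])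
    show "0 \<notin> e ` I \<union> f ` I"
      using e1 by (auto) (metis e1 inner_zero_left zero_neq_one)+
  qed
  then have "dim (span (e ` I \<union> f ` I)) = card (e ` I \<union> f ` I)"
    by (rule dim_span_eq_card_independent)
  also have "\<dots> = card I + card I"
    using fin disj inj by (simp add: card_Un_disjoint card_image)
  finally show "card {n. \<sigma> (n div 2) = \<mu>} = dim {v. abs_op X v = \<mu> *\<^sub>R v}"
    unfolding card abs_op_eq eigenspace[OF \<mu>] I_def by simp
qed

lemma sing_val_eq: "sing_val X = \<sigma>"
  unfolding sing_val_def
proof (rule the_equality)
  show "eigenvalue_seq (abs_op X) (\<lambda>n. \<sigma> (n div 2))" by (rule eigenvalue_seq_abs_op)
  fix s assume "eigenvalue_seq (abs_op X) (\<lambda>n. s (n div 2))"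
  from eigenvalue_seq_unique[OF this eigenvalue_seq_abs_op] have "s (2 * i div 2) = \<sigma> (2 * i div 2)" for i
    by (rule fun_cong)
  then show "s = \<sigma>" by auto
qed

lemma cc_norm_eq: "cc_norm X = (\<Sum>j. ennreal (real (Suc j) * \<sigma> j))"
  by (simp add: cc_norm_def sing_val_eq)

end

section \<open>Tails of singular values\<close>

text \<open>
  The span of the first \<open>n\<close> planes is a complex vector space with the complex structure \<open>J\<close>;
  \<open>R\<close> is the projection onto it.
\<close>

locale skew_normal_form_block = skew_normal_form +
  fixes n :: nat
  assumes pos: "\<And>i. i < n \<Longrightarrow> 0 < \<sigma> i"
begin

definition J :: "'a \<Rightarrow>\<^sub>L 'a" where
  "J = (\<Sum>i<n. wedge (e i) (f i))"

definition R :: "'a \<Rightarrow>\<^sub>L 'a" where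
  "R = (\<Sum>i<n. tensor (e i) (e i) + tensor (f i) (f i))"

lemma J_apply: "J x = (\<Sum>i<n. (e i \<bullet> x) *\<^sub>R f i - (f i \<bullet> x) *\<^sub>R e i)"
  by (simp add: J_def blinfun.sum_left wedge_apply)

lemma R_apply: "R x = (\<Sum>i<n. (e i \<bullet> x) *\<^sub>R e i + (f i \<bullet> x) *\<^sub>R f i)"
  by (simp add: R_def blinfun.sum_left blinfun.add_left tensor_apply)

lemma J_e: "i < n \<Longrightarrow> J (e i) = f i"
  and J_f: "i < n \<Longrightarrow> J (f i) = - e i"
  and R_e: "i < n \<Longrightarrow> R (e i) = e i"
  and R_f: "i < n \<Longrightarrow> R (f i) = f i"
proof -
  assume i: "i < n"
  have "J (e i) = (\<Sum>m<n. if m = i then f i else 0)"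
    unfolding J_apply by (intro sum.cong refl) (use pos[OF i] in \<open>auto simp: ee ef inner_commute[of "f _" "e _"]\<close>)
  then show "J (e i) = f i" using i by simp
  have "J (f i) = (\<Sum>m<n. if m = i then - e i else 0)"
    unfolding J_apply by (intro sum.cong refl) (use pos[OF i] in \<open>auto simp: ff ef\<close>)
  then show "J (f i) = - e i" using i by simp
  have "R (e i) = (\<Sum>m<n. if m = i then e i else 0)"
    unfolding R_apply by (intro sum.cong refl) (use pos[OF i] in \<open>auto simp: ee ef inner_commute[of "f _" "e _"]\<close>)
  then show "R (e i) = e i" using i by simp
  have "R (f i) = (\<Sum>m<n. if m = i then f i else 0)"
    unfolding R_apply by (intro sum.cong refl) (use pos[OF i] in \<open>auto simp: ff ef\<close>)
  then show "R (f i) = f i" using i by simp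
qed

lemma R_R: "R (R x) = R x"
  by (subst (2) R_apply)
     (simp add: blinfun.sum_right blinfun.add_right blinfun.scaleR_right R_e R_f, simp add: R_apply)

lemma R_J: "R (J x) = J x"
  by (subst J_apply)
     (simp add: blinfun.sum_right blinfun.diff_right blinfun.scaleR_right R_e R_f, simp add: J_apply)

lemma J_J: "J (J x) = - R x"
  by (subst (2) J_apply)
     (simp add: blinfun.sum_right blinfun.diff_right blinfun.scaleR_right J_e J_f,
      simp add: R_apply sum_negf[symmetric] add.commute)

lemma J_R: "J (R x) = J x"
  by (subst R_apply)
     (simp add: blinfun.sum_right blinfun.add_right blinfun.scaleR_right J_e J_f, simp add: J_apply)

lemma J_skew: "J x \<bullet> y = - (x \<bullet> J y)"
  by (rule skewD) (auto simp: J_def intro!: skew_sum skew_wedge)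

lemma R_symmetric: "R x \<bullet> y = x \<bullet> R y"
  by (simp add: R_apply inner_sum_left inner_sum_right inner_add_left inner_add_right inner_commute[of x] mult_ac)

lemma norm_e: "i < n \<Longrightarrow> norm (e i) = 1" and norm_f: "i < n \<Longrightarrow> norm (f i) = 1"
  using pos by (simp_all add: norm_eq_sqrt_inner ee ff)

text \<open>
  \<open>P\<close> is the orthogonal projection onto a \<open>J\<close>-invariant subspace of the span of the frame; the
  subspace has complex codimension at most \<open>m\<close>.  The codimension is a trace, and since \<open>P\<close>
  commutes with \<open>J\<close> the vectors \<open>f i\<close> would only repeat the terms of the vectors \<open>e i\<close>.
\<close>

definition complex_projection :: "real \<Rightarrow> ('a \<Rightarrow>\<^sub>L 'a) \<Rightarrow> bool" where
  "complex_projection m P \<longleftrightarrow>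
     (\<forall>x y. P x \<bullet> y = x \<bullet> P y) \<and>
     (\<forall>x. P (P x) = P x) \<and>
     (\<forall>x. P (R x) = P x) \<and>
     (\<forall>x. R (P x) = P x) \<and>
     (\<forall>x. P (J x) = J (P x)) \<and>
     (\<Sum>i<n. 1 - e i \<bullet> P (e i)) \<le> m"

lemma complex_projection_norm_le:
  assumes "complex_projection m P"
  shows "norm (P x) \<le> norm x"
proof -
  have "norm (P x) * norm (P x) = x \<bullet> P x"
    using assms by (simp add: complex_projection_def power2_norm_eq_inner[symmetric] flip: power2_eq_square)
      (metis assms complex_projection_def power2_norm_eq_inner)
  also have "\<dots> \<le> norm x * norm (P x)" by (rule norm_cauchy_schwarz)
  finally show ?thesis by (cases "P x = 0") auto
qed

text \<open>
  Each further vector to be annihilated costs one complex dimension.  Working with the complex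
  structure, rather than with real dimensions, is what gives the tail from \<open>m\<close> on instead of
  the one from \<open>2 m\<close> on.
\<close>

lemma complex_projection_exists:
  fixes a :: "nat \<Rightarrow> 'a"
  shows "\<exists>P. complex_projection (real m) P \<and> (\<forall>k<m. P (a k) = 0)"
proof (induction m)
  case 0
  have "e i \<bullet> R (e i) = 1" if "i < n" for i using pos[OF that] by (simp add: R_e that ee)
  then have "complex_projection 0 R"
    by (auto simp: complex_projection_def R_symmetric R_R R_J J_R)
  then show ?case by auto
next
  case (Suc m)
  then obtain P where P: "complex_projection (real m) P" and Pa: "\<And>k. k < m \<Longrightarrow> P (a k) = 0"
    by blast
  let ?P = "blinfun_apply P" and ?J = "blinfun_apply J" and ?R = "blinfun_apply R"
  have sym: "?P x \<bullet> y = x \<bullet> ?P y" and PP: "?P (?P x) = ?P x" and PR: "?P (?R x) = ?P x"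
    and RP: "?R (?P x) = ?P x" and PJ: "?P (?J x) = ?J (?P x)" for x y
    using P by (auto simp: complex_projection_def)
  have tr: "(\<Sum>i<n. 1 - e i \<bullet> ?P (e i)) \<le> real m" using P by (simp add: complex_projection_def)
  define b where "b = ?P (a m)"
  show ?case
  proof (cases "b = 0")
    case True
    have "complex_projection (real (Suc m)) P" using P by (auto simp: complex_projection_def)
    moreover have "?P (a k) = 0" if "k < Suc m" for k using Pa that True by (cases "k = m") (auto simp: b_def)
    ultimately show ?thesis by blast
  next
    case False
    define c where "c = 1 / (b \<bullet> b)"
    have cb: "c * (b \<bullet> b) = 1" using False by (simp add: c_def)
    have c0: "0 \<le> c" by (simp add: c_def)
    define d where "d = ?J b"
    have Pb: "?P b = b" and Rb: "?R b = b" by (simp_all add: b_def PP RP)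
    have Pd: "?P d = d" and Rd: "?R d = d" and Jd: "?J d = - b" by (simp_all add: d_def PJ Pb R_J J_J Rb)
    have "b \<bullet> d = - (b \<bullet> d)" using J_skew[of b b] by (simp add: d_def inner_commute)
    then have bd: "b \<bullet> d = 0" by simp
    have dd: "d \<bullet> d = b \<bullet> b" using J_skew[of b d] by (simp add: Jd flip: d_def)
    have shift: "b \<bullet> ?P x = b \<bullet> x" "d \<bullet> ?P x = d \<bullet> x" "b \<bullet> ?R x = b \<bullet> x" "d \<bullet> ?R x = d \<bullet> x"
        "b \<bullet> ?J x = - (d \<bullet> x)" "d \<bullet> ?J x = b \<bullet> x" for x
      using sym[of b x] sym[of d x] R_symmetric[of b x] R_symmetric[of d x] J_skew[of b x] J_skew[of d x]
      by (simp_all add: Pb Pd Rb Rd Jd flip: d_def)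
    define Q where "Q = P - c *\<^sub>R (tensor b b + tensor d d)"
    have Q: "Q x = ?P x - c *\<^sub>R ((b \<bullet> x) *\<^sub>R b + (d \<bullet> x) *\<^sub>R d)" for x
      by (simp add: Q_def blinfun.diff_left blinfun.scaleR_left blinfun.add_left tensor_apply)
    have Qb: "Q b = 0" and Qd: "Q d = 0"
      using cb by (simp_all add: Q Pb Pd bd dd inner_commute[of d b])
    have "Q (?P x) = Q x" for x by (simp add: Q PP shift)
    then have QQ: "Q (Q x) = Q x" for x
      by (subst (2) Q) (simp add: blinfun.diff_right blinfun.scaleR_right blinfun.add_right Qb Qd)
    have "complex_projection (real (Suc m)) Q"
      unfolding complex_projection_def
    proof (intro conjI allI)
      show "Q x \<bullet> y = x \<bullet> Q y" for x y
        by (simp add: Q inner_diff_left inner_diff_right inner_add_left inner_add_right sym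
            inner_commute[of x b] inner_commute[of x d] mult_ac)
      show "Q (?R x) = Q x" for x by (simp add: Q PR shift)
      show "?R (Q x) = Q x" for x
        by (simp add: Q blinfun.diff_right blinfun.scaleR_right blinfun.add_right RP Rb Rd)
      show "Q (?J x) = ?J (Q x)" for x
        by (simp add: Q blinfun.diff_right blinfun.scaleR_right blinfun.add_right PJ shift Jd flip: d_def)
      have "(\<Sum>i<n. (b \<bullet> e i)\<^sup>2 + (d \<bullet> e i)\<^sup>2) = (\<Sum>i<n. (e i \<bullet> b)\<^sup>2 + (f i \<bullet> b)\<^sup>2)"
      proof (intro sum.cong refl)
        fix i assume "i \<in> {..<n}"
        then have "d \<bullet> e i = - (b \<bullet> f i)" using J_skew[of b "e i"] by (simp add: J_e flip: d_def)
        then show "(b \<bullet> e i)\<^sup>2 + (d \<bullet> e i)\<^sup>2 = (e i \<bullet> b)\<^sup>2 + (f i \<bullet> b)\<^sup>2" by (simp add: inner_commute)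
      qed
      also have "\<dots> \<le> b \<bullet> b" using bessel_frame[of "{..<n}" b] by (simp add: power2_norm_eq_inner)
      finally have "c * (\<Sum>i<n. (b \<bullet> e i)\<^sup>2 + (d \<bullet> e i)\<^sup>2) \<le> c * (b \<bullet> b)" by (rule mult_left_mono[OF _ c0])
      moreover have "(\<Sum>i<n. 1 - e i \<bullet> Q (e i))
          = (\<Sum>i<n. 1 - e i \<bullet> ?P (e i)) + c * (\<Sum>i<n. (b \<bullet> e i)\<^sup>2 + (d \<bullet> e i)\<^sup>2)"
        unfolding sum_distrib_left sum.distrib[symmetric]
        by (intro sum.cong refl) (simp add: Q inner_diff_right inner_add_right inner_commute[of "e _" b]
            inner_commute[of "e _" d] power2_eq_square algebra_simps)
      ultimately show "(\<Sum>i<n. 1 - e i \<bullet> Q (e i)) \<le> real (Suc m)"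
        using tr cb by simp
    qed (rule QQ)
    moreover have "Q (a k) = 0" if "k < Suc m" for k
    proof (cases "k = m")
      case True
      have "b \<bullet> a m = b \<bullet> b" "d \<bullet> a m = 0"
        using shift(1,2)[of "a m"] by (simp_all add: b_def[symmetric] bd inner_commute[of d b])
      then show ?thesis using cb True by (simp add: Q b_def[symmetric])
    next
      case False
      then have "?P (a k) = 0" using Pa that by simp
      moreover from this have "b \<bullet> a k = 0" "d \<bullet> a k = 0" using shift(1,2)[of "a k"] by simp_all
      ultimately show ?thesis by (simp add: Q)
    qed
    ultimately show ?thesis by blast
  qed
qed

text \<open>
  A Ky Fan type inequality: the tail of the singular values of an operator close to
  \<open>\<Sum>k<K. a k \<and> b k\<close> is bounded by the tail of that sum.  The operator is paired with the skew
  partial isometry \<open>J P\<close>, where \<open>P\<close> annihilates \<open>a k\<close> for \<open>k < m\<close>; it suffices to kill one of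
  the two factors of \<open>a k \<and> b k\<close>.
\<close>

lemma tail_le:
  fixes a b :: "nat \<Rightarrow> 'a"
  assumes close: "norm (X - (\<Sum>k<K. wedge (a k) (b k))) \<le> \<epsilon>"
  shows "(\<Sum>i\<in>{m..<n}. \<sigma> i) \<le> (\<Sum>k\<in>{m..<K}. norm (a k) * norm (b k)) + real n * \<epsilon>"
proof -
  obtain P where P: "complex_projection (real m) P" and Pa: "\<And>k. k < m \<Longrightarrow> P (a k) = 0"
    using complex_projection_exists by blast
  let ?P = "blinfun_apply P" and ?J = "blinfun_apply J" and ?R = "blinfun_apply R"
  define A where "A = (\<Sum>k<K. wedge (a k) (b k))"
  define T where "T x = ?J (?P x)" for x
  have sym: "?P x \<bullet> y = x \<bullet> ?P y" and PP: "?P (?P x) = ?P x" and RP: "?R (?P x) = ?P x"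
    and PJ: "?P (?J x) = ?J (?P x)" for x y
    using P by (auto simp: complex_projection_def)
  have T_skew: "x \<bullet> T y = - (T x \<bullet> y)" for x y
    using J_skew[of x "?P y"] sym[of "?J x" y] by (simp add: T_def PJ)
  have T_frame: "T x = (\<Sum>j<n. (e j \<bullet> T x) *\<^sub>R e j + (f j \<bullet> T x) *\<^sub>R f j)" for x
    unfolding R_apply[symmetric] by (simp add: T_def R_J)
  have T_norm: "norm (T x) \<le> norm x" for x
  proof -
    have "T x \<bullet> T x = ?P x \<bullet> ?P x" unfolding T_def J_skew by (simp add: J_J RP)
    then show ?thesis using complex_projection_norm_le[OF P, of x] by (simp add: norm_eq_sqrt_inner)
  qed
  have pair: "2 * (T x \<bullet> y) = (\<Sum>j<n. wedge x y (e j) \<bullet> T (e j) + wedge x y (f j) \<bullet> T (f j))"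
    for x y
  proof -
    have eT: "e j \<bullet> T z = - (z \<bullet> T (e j))" and fT: "f j \<bullet> T z = - (z \<bullet> T (f j))" for j z
      using T_skew[of "e j" z] T_skew[of "f j" z] by (simp_all add: inner_commute[of z])
    have "T x \<bullet> y = (\<Sum>j<n. (e j \<bullet> T x) * (e j \<bullet> y) + (f j \<bullet> T x) * (f j \<bullet> y))"
      by (subst T_frame[of x]) (simp add: inner_sum_left inner_add_left)
    then have "T x \<bullet> y = (\<Sum>j<n. - ((x \<bullet> T (e j)) * (y \<bullet> e j)) - (x \<bullet> T (f j)) * (y \<bullet> f j))"
      unfolding eT[of _ x] fT[of _ x] by (simp add: inner_commute[of y])
    moreover have "T x \<bullet> y = (\<Sum>j<n. (x \<bullet> e j) * (y \<bullet> T (e j)) + (x \<bullet> f j) * (y \<bullet> T (f j)))"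
    proof -
      have "x \<bullet> T y = (\<Sum>j<n. (e j \<bullet> T y) * (x \<bullet> e j) + (f j \<bullet> T y) * (x \<bullet> f j))"
        by (subst T_frame[of y]) (simp add: inner_sum_right inner_add_right)
      then have "- (x \<bullet> T y) = (\<Sum>j<n. (x \<bullet> e j) * (y \<bullet> T (e j)) + (x \<bullet> f j) * (y \<bullet> T (f j)))"
        unfolding eT[of _ y] fT[of _ y] by (simp add: sum_negf[symmetric] mult.commute add.commute)
      then show ?thesis using T_skew[of x y] by simp
    qed
    ultimately have "2 * (T x \<bullet> y) = (\<Sum>j<n. - ((x \<bullet> T (e j)) * (y \<bullet> e j)) - (x \<bullet> T (f j)) * (y \<bullet> f j))
        + (\<Sum>j<n. (x \<bullet> e j) * (y \<bullet> T (e j)) + (x \<bullet> f j) * (y \<bullet> T (f j)))" by linarith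
    then show ?thesis unfolding sum.distrib[symmetric]
      by (simp add: inner_wedge algebra_simps)
  qed
  have trace: "(\<Sum>j<n. A (e j) \<bullet> T (e j) + A (f j) \<bullet> T (f j)) = 2 * (\<Sum>k<K. T (a k) \<bullet> b k)"
  proof -
    have "(\<Sum>j<n. A (e j) \<bullet> T (e j) + A (f j) \<bullet> T (f j))
        = (\<Sum>j<n. \<Sum>k<K. wedge (a k) (b k) (e j) \<bullet> T (e j) + wedge (a k) (b k) (f j) \<bullet> T (f j))"
      by (simp add: A_def blinfun.sum_left inner_sum_left sum.distrib)
    also have "\<dots> = (\<Sum>k<K. 2 * (T (a k) \<bullet> b k))" by (subst sum.swap) (simp add: pair)
    finally show ?thesis by (simp add: sum_distrib_left)
  qed
  define p where "p j = e j \<bullet> ?P (e j)" for j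
  have p: "0 \<le> p j" "p j \<le> 1" if "j < n" for j
  proof -
    have "p j = (norm (?P (e j)))\<^sup>2" using sym[of "e j" "?P (e j)"] by (simp add: p_def PP power2_norm_eq_inner)
    moreover have "norm (?P (e j)) \<le> 1" using complex_projection_norm_le[OF P, of "e j"] norm_e[OF that] by simp
    ultimately show "0 \<le> p j" "p j \<le> 1" by (auto simp: power_le_one)
  qed
  have Xe: "X (e j) \<bullet> T (e j) = \<sigma> j * p j" and Xf: "X (f j) \<bullet> T (f j) = \<sigma> j * p j"
    if j: "j < n" for j
  proof -
    have "f j \<bullet> T (e j) = p j" using J_skew[of "f j" "?P (e j)"] by (simp add: T_def J_f[OF j] p_def)
    then show "X (e j) \<bullet> T (e j) = \<sigma> j * p j" by (simp add: X_e)
    have "e j \<bullet> T (f j) = - (f j \<bullet> ?P (f j))" using J_skew[of "e j" "?P (f j)"] by (simp add: T_def J_e[OF j])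
    also have "f j \<bullet> ?P (f j) = p j"
      using J_skew[of "e j" "?J (?P (e j))"] by (simp add: p_def J_e[OF j, symmetric] PJ J_J RP)
    finally show "X (f j) \<bullet> T (f j) = \<sigma> j * p j" by (simp add: X_f)
  qed
  have err: "X z \<bullet> T z \<le> A z \<bullet> T z + \<epsilon>" if z: "norm z = 1" for z
  proof -
    have "X z \<bullet> T z - A z \<bullet> T z = (X - A) z \<bullet> T z"
      by (simp add: blinfun.diff_left inner_diff_left)
    also have "\<dots> \<le> norm ((X - A) z) * norm (T z)" by (rule norm_cauchy_schwarz)
    also have "\<dots> \<le> norm ((X - A) z) * 1"
      using T_norm[of z] z by (intro mult_left_mono) auto
    also have "\<dots> \<le> \<epsilon>" using norm_blinfun[of "X - A" z] close z by (simp add: A_def)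
    finally show ?thesis by simp
  qed
  have "(\<Sum>j<n. 2 * (\<sigma> j * p j)) = (\<Sum>j<n. X (e j) \<bullet> T (e j) + X (f j) \<bullet> T (f j))"
    by (intro sum.cong refl) (simp add: Xe Xf)
  also have "\<dots> \<le> (\<Sum>j<n. (A (e j) \<bullet> T (e j) + A (f j) \<bullet> T (f j)) + 2 * \<epsilon>)"
  proof (rule sum_mono)
    fix j assume "j \<in> {..<n}"
    then show "X (e j) \<bullet> T (e j) + X (f j) \<bullet> T (f j)
        \<le> (A (e j) \<bullet> T (e j) + A (f j) \<bullet> T (f j)) + 2 * \<epsilon>"
      using err[OF norm_e, of j] err[OF norm_f, of j] by simp
  qed
  also have "\<dots> = 2 * (\<Sum>k<K. T (a k) \<bullet> b k) + 2 * (real n * \<epsilon>)"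
    unfolding sum.distrib[of "\<lambda>j. A (e j) \<bullet> T (e j) + A (f j) \<bullet> T (f j)"] trace by simp
  finally have "(\<Sum>j<n. \<sigma> j * p j) \<le> (\<Sum>k<K. T (a k) \<bullet> b k) + real n * \<epsilon>"
    by (simp add: sum_distrib_left[symmetric])
  also have "(\<Sum>k<K. T (a k) \<bullet> b k) \<le> (\<Sum>k<K. if m \<le> k then norm (a k) * norm (b k) else 0)"
  proof (rule sum_mono)
    fix k
    show "T (a k) \<bullet> b k \<le> (if m \<le> k then norm (a k) * norm (b k) else 0)"
    proof (cases "m \<le> k")
      case True
      have "T (a k) \<bullet> b k \<le> norm (T (a k)) * norm (b k)" by (rule norm_cauchy_schwarz)
      also have "\<dots> \<le> norm (a k) * norm (b k)" by (intro mult_right_mono T_norm) simp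
      finally show ?thesis using True by simp
    qed (simp add: T_def Pa blinfun.zero_right)
  qed
  also have "(\<Sum>k<K. if m \<le> k then norm (a k) * norm (b k) else 0) = (\<Sum>k\<in>{m..<K}. norm (a k) * norm (b k))"
    by (simp add: sum.If_cases) (rule sum.cong, auto)
  finally have upper: "(\<Sum>j<n. \<sigma> j * p j) \<le> (\<Sum>k\<in>{m..<K}. norm (a k) * norm (b k)) + real n * \<epsilon>" by simp
  have "(\<Sum>i\<in>{m..<n}. \<sigma> i) \<le> (\<Sum>j<n. \<sigma> j * p j)"
  proof (cases "m < n")
    case True
    have split: "(\<Sum>j<n. h j) = (\<Sum>j<m. h j) + (\<Sum>j\<in>{m..<n}. h j)" for h :: "nat \<Rightarrow> real"
      using True by (simp add: lessThan_atLeast0 sum.atLeastLessThan_concat)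
    have "(\<Sum>j<m. \<sigma> m * p j) \<le> (\<Sum>j<m. \<sigma> j * p j)"
      using True p by (intro sum_mono mult_right_mono antimonoD[OF antimono]) auto
    moreover have "(\<Sum>j\<in>{m..<n}. \<sigma> j * (1 - p j)) \<le> (\<Sum>j\<in>{m..<n}. \<sigma> m * (1 - p j))"
      using p by (intro sum_mono mult_right_mono antimonoD[OF antimono]) auto
    moreover have "(\<Sum>j\<in>{m..<n}. \<sigma> j * (1 - p j)) = (\<Sum>j\<in>{m..<n}. \<sigma> j) - (\<Sum>j\<in>{m..<n}. \<sigma> j * p j)"
      by (simp add: right_diff_distrib sum_subtractf)
    moreover have "(\<Sum>j\<in>{m..<n}. \<sigma> m * (1 - p j)) \<le> (\<Sum>j<m. \<sigma> m * p j)"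
    proof -
      have "(\<Sum>j<n. 1 - p j) \<le> real m" using P by (simp add: complex_projection_def p_def)
      then have "(\<Sum>j\<in>{m..<n}. 1 - p j) \<le> (\<Sum>j<m. p j)"
        unfolding split[of "\<lambda>j. 1 - p j"] by (simp add: sum_subtractf)
      then show ?thesis unfolding sum_distrib_left[symmetric] by (rule mult_left_mono[OF _ nonneg])
    qed
    ultimately show ?thesis unfolding split[of "\<lambda>j. \<sigma> j * p j"] by linarith
  next
    case False
    then show ?thesis using p nonneg by (auto intro!: sum_nonneg mult_nonneg_nonneg)
  qed
  then show ?thesis using upper by linarith
qed

end

section \<open>Discrete Fourier analysis of polygons\<close>

lemma odd_angle_bounds:
  assumes "k < K"
  shows "0 < pi * real (2 * k + 1) / real (2 * K)" "pi * real (2 * k + 1) / real (2 * K) < pi"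
proof -
  have "real (2 * k + 1) < real (2 * K)" using assms by (simp only: of_nat_less_iff)
  then have "pi * real (2 * k + 1) < pi * real (2 * K)" by (rule mult_strict_left_mono) simp
  moreover have "0 < real (2 * K)" using assms by simp
  ultimately show "0 < pi * real (2 * k + 1) / real (2 * K)" "pi * real (2 * k + 1) / real (2 * K) < pi"
    by (simp_all only: pos_divide_less_eq) auto
qed

text \<open>
  Multiplied by \<open>2 sin \<phi>\<close>, where \<open>\<phi> = \<pi> d / (2 K)\<close>, the sum telescopes to \<open>sin (\<pi> d)\<close>.
\<close>

lemma sum_cos_odd_multiples:
  assumes d: "0 < d" "d < 2 * K"
  shows "(\<Sum>k<K. cos (pi * real (2 * k + 1) / real (2 * K) * real d)) = 0"
proof -
  have K: "0 < K" using d by simp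
  define \<phi> where "\<phi> = pi * real d / real (2 * K)"
  have \<phi>: "0 < \<phi>" "\<phi> < pi" using d K by (auto simp: \<phi>_def field_simps)
  have "2 * sin \<phi> * cos (pi * real (2 * k + 1) / real (2 * K) * real d) = sin (2 * \<phi> * real (Suc k)) - sin (2 * \<phi> * real k)" for k
  proof -
    have "pi * real (2 * k + 1) / real (2 * K) * real d = (2 * real k + 1) * \<phi>"
      using K by (simp add: \<phi>_def field_simps)
    moreover have "sin (2 * \<phi> * real (Suc k)) - sin (2 * \<phi> * real k) = 2 * sin \<phi> * cos ((2 * real k + 1) * \<phi>)"
    proof -
      have "(2 * \<phi> * real (Suc k) - 2 * \<phi> * real k) / 2 = \<phi>"
        "(2 * \<phi> * real (Suc k) + 2 * \<phi> * real k) / 2 = (2 * real k + 1) * \<phi>"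
        by (simp_all add: field_simps)
      then show ?thesis by (simp only: sin_diff_sin)
    qed
    ultimately show ?thesis by simp
  qed
  then have "2 * sin \<phi> * (\<Sum>k<K. cos (pi * real (2 * k + 1) / real (2 * K) * real d))
      = (\<Sum>k<K. sin (2 * \<phi> * real (Suc k)) - sin (2 * \<phi> * real k))"
    by (simp add: sum_distrib_left)
  also have "\<dots> = sin (2 * \<phi> * real K)" by (subst sum_lessThan_telescope) simp
  also have "2 * \<phi> * real K = real d * pi" using K by (simp add: \<phi>_def)
  also have "sin (real d * pi) = 0" by (rule sin_npi)
  finally show ?thesis using sin_gt_zero[OF \<phi>] by simp
qed

text \<open>
  Passing from \<open>d\<close> to \<open>d + 1\<close> changes the sum by two sums of cosines, which vanish except that the
  one for \<open>d = 0\<close> is \<open>K\<close>.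
\<close>

lemma sum_cot_sin_odd_multiples:
  assumes d: "0 < d" "d < 2 * K"
  shows "(\<Sum>k<K. cot (pi * real (2 * k + 1) / real (2 * K) / 2) * sin (pi * real (2 * k + 1) / real (2 * K) * real d)) = real K"
  using d
proof (induction d)
  case (Suc d)
  have K: "0 < K" using Suc.prems by simp
  define \<theta> where "\<theta> k = pi * real (2 * k + 1) / real (2 * K)" for k
  have s: "sin (\<theta> k / 2) \<noteq> 0" if "k < K" for k
  proof -
    have "0 < \<theta> k" "\<theta> k < pi" using odd_angle_bounds[OF that] by (simp_all add: \<theta>_def)
    then have "0 < sin (\<theta> k / 2)" by (intro sin_gt_zero) auto
    then show ?thesis by simp
  qed
  have step: "cot (\<theta> k / 2) * sin (\<theta> k * real (Suc d))
      = cot (\<theta> k / 2) * sin (\<theta> k * real d) + cos (\<theta> k * real (Suc d)) + cos (\<theta> k * real d)" if "k < K" for k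
  proof -
    have "sin (\<theta> k * real (Suc d)) - sin (\<theta> k * real d) = 2 * sin (\<theta> k / 2) * cos (\<theta> k * real d + \<theta> k / 2)"
      unfolding sin_diff_sin by (simp add: algebra_simps add_divide_distrib)
    then have "cot (\<theta> k / 2) * (sin (\<theta> k * real (Suc d)) - sin (\<theta> k * real d)) = 2 * cos (\<theta> k / 2) * cos (\<theta> k * real d + \<theta> k / 2)"
      using s[OF that] by (simp add: cot_def)
    also have "\<dots> = cos (\<theta> k * real (Suc d)) + cos (\<theta> k * real d)"
      unfolding cos_plus_cos by (simp add: algebra_simps add_divide_distrib)
    finally show ?thesis by (simp add: algebra_simps)
  qed
  have cos0: "(\<Sum>k<K. cos (\<theta> k * real (Suc d))) = 0"
    unfolding \<theta>_def by (rule sum_cos_odd_multiples) (use Suc.prems in auto)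
  have "(\<Sum>k<K. cot (\<theta> k / 2) * sin (\<theta> k * real (Suc d)))
      = (\<Sum>k<K. cot (\<theta> k / 2) * sin (\<theta> k * real d)) + (\<Sum>k<K. cos (\<theta> k * real (Suc d))) + (\<Sum>k<K. cos (\<theta> k * real d))"
    unfolding sum.distrib[symmetric] by (intro sum.cong refl) (simp only: step lessThan_iff)
  also have "\<dots> = real K"
  proof (cases "d = 0")
    case False
    then have "(\<Sum>k<K. cos (\<theta> k * real d)) = 0"
      unfolding \<theta>_def by (intro sum_cos_odd_multiples) (use Suc.prems in auto)
    moreover have "(\<Sum>k<K. cot (\<theta> k / 2) * sin (\<theta> k * real d)) = real K"
      unfolding \<theta>_def by (rule Suc.IH) (use False Suc.prems in auto)
    ultimately show ?thesis using cos0 by simp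
  qed (use cos0 in simp)
  finally show ?case by (simp add: \<theta>_def)
qed simp

lemma le_tan:
  assumes "0 \<le> x" "x < pi / 2"
  shows "x \<le> tan x"
proof -
  have "tan 0 - 0 \<le> tan x - x"
  proof (rule DERIV_nonneg_imp_nondecreasing[OF assms(1)])
    fix t assume t: "0 \<le> t" "t \<le> x"
    then have c: "0 < cos t" using assms by (intro cos_gt_zero_pi) auto
    then have "DERIV (\<lambda>t. tan t - t) t :> inverse ((cos t)\<^sup>2) - 1"
      by (auto intro!: derivative_eq_intros)
    moreover have "1 \<le> inverse ((cos t)\<^sup>2)"
      using c by (intro one_le_inverse) (auto simp: power_le_one)
    ultimately show "\<exists>y. DERIV (\<lambda>t. tan t - t) t :> y \<and> 0 \<le> y" by auto
  qed
  then show ?thesis by simp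
qed

lemma sum_rotate: "(\<Sum>k\<in>A. \<Sum>i\<in>B. \<Sum>j\<in>C. h k i j) = (\<Sum>i\<in>B. \<Sum>j\<in>C. \<Sum>k\<in>A. h k i j)"
proof -
  have "(\<Sum>k\<in>A. \<Sum>i\<in>B. \<Sum>j\<in>C. h k i j) = (\<Sum>i\<in>B. \<Sum>k\<in>A. \<Sum>j\<in>C. h k i j)"
    by (rule sum.swap)
  also have "\<dots> = (\<Sum>i\<in>B. \<Sum>j\<in>C. \<Sum>k\<in>A. h k i j)"
    by (intro sum.cong refl) (rule sum.swap)
  finally show ?thesis .
qed

lemma sum_square_split:
  fixes F :: "nat \<Rightarrow> nat \<Rightarrow> 'b::ab_group_add"
  shows "(\<Sum>i<M. \<Sum>j<M. F i j) = (\<Sum>j<M. \<Sum>i<j. F i j + F j i) + (\<Sum>i<M. F i i)"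
  by (induction M) (simp_all add: sum.distrib algebra_simps)

text \<open>
  An even number of edges makes the antiperiodic modes come in \<open>K\<close> pairs of a cosine and a sine.
\<close>

locale polygon =
  fixes u :: "nat \<Rightarrow> 'a::{real_inner,banach}" and K :: nat
  assumes K: "0 < K"
begin

definition \<theta> :: "nat \<Rightarrow> real" where "\<theta> k = pi * real (2 * k + 1) / real (2 * K)"
definition \<alpha> :: "nat \<Rightarrow> 'a" where "\<alpha> k = (\<Sum>i<2 * K. cos (\<theta> k * real i) *\<^sub>R u i)"
definition \<beta> :: "nat \<Rightarrow> 'a" where "\<beta> k = (\<Sum>i<2 * K. sin (\<theta> k * real i) *\<^sub>R u i)"

lemma \<theta>_bounds: "k < K \<Longrightarrow> 0 < \<theta> k \<and> \<theta> k < pi"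
  using odd_angle_bounds[of k K] by (simp add: \<theta>_def)

text \<open>
  The area form of a polygon has the kernel \<open>sgn (j - i) / 2\<close>.  It extends antiperiodically to all
  differences of indices and is therefore diagonal in the antiperiodic Fourier modes, with
  eigenvalues given by cotangents.
\<close>

lemma area_expansion:
  "(\<Sum>k<K. wedge ((cot (\<theta> k / 2) / real (2 * K)) *\<^sub>R \<alpha> k) (\<beta> k)) = (1/2) *\<^sub>R (\<Sum>j<2 * K. \<Sum>i<j. wedge (u i) (u j))"
proof -
  define c where "c k = cot (\<theta> k / 2) / real (2 * K)" for k
  define G where "G i j = (\<Sum>k<K. c k * (cos (\<theta> k * real i) * sin (\<theta> k * real j)))" for i j
  have G: "G i j - G j i = 1/2" if "i < j" "j < 2 * K" for i j
  proof -
    have "G i j - G j i = (\<Sum>k<K. c k * sin (\<theta> k * real (j - i)))"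
      unfolding G_def sum_subtractf[symmetric]
      using that by (intro sum.cong refl) (simp add: of_nat_diff right_diff_distrib sin_diff algebra_simps)
    also have "\<dots> = (\<Sum>k<K. cot (\<theta> k / 2) * sin (\<theta> k * real (j - i))) / real (2 * K)"
      by (simp add: c_def sum_divide_distrib)
    also have "\<dots> = 1/2"
      unfolding \<theta>_def using sum_cot_sin_odd_multiples[of "j - i" K] that K by simp
    finally show ?thesis .
  qed
  have "(\<Sum>k<K. wedge (c k *\<^sub>R \<alpha> k) (\<beta> k))
      = (\<Sum>k<K. \<Sum>i<2 * K. \<Sum>j<2 * K. (c k * (cos (\<theta> k * real i) * sin (\<theta> k * real j))) *\<^sub>R wedge (u i) (u j))"
  proof (intro sum.cong refl)
    fix k
    show "wedge (c k *\<^sub>R \<alpha> k) (\<beta> k)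
        = (\<Sum>i<2 * K. \<Sum>j<2 * K. (c k * (cos (\<theta> k * real i) * sin (\<theta> k * real j))) *\<^sub>R wedge (u i) (u j))"
      unfolding \<alpha>_def \<beta>_def scaleR_sum_right wedge_sum_left
      by (simp add: wedge_sum_right wedge_scaleR_left wedge_scaleR_right mult_ac)
  qed
  also have "\<dots> = (\<Sum>i<2 * K. \<Sum>j<2 * K. G i j *\<^sub>R wedge (u i) (u j))"
    unfolding G_def scaleR_sum_left by (rule sum_rotate)
  also have "\<dots> = (\<Sum>j<2 * K. \<Sum>i<j. G i j *\<^sub>R wedge (u i) (u j) + G j i *\<^sub>R wedge (u j) (u i))"
    unfolding sum_square_split by simp
  also have "\<dots> = (\<Sum>j<2 * K. \<Sum>i<j. (1/2) *\<^sub>R wedge (u i) (u j))"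
  proof (intro sum.cong refl)
    fix j i assume "j \<in> {..<2 * K}" "i \<in> {..<j}"
    then have "(G i j - G j i) *\<^sub>R wedge (u i) (u j) = (1/2) *\<^sub>R wedge (u i) (u j)" using G by simp
    then show "G i j *\<^sub>R wedge (u i) (u j) + G j i *\<^sub>R wedge (u j) (u i) = (1/2) *\<^sub>R wedge (u i) (u j)"
      using wedge_swap[of "u j" "u i"] by (simp add: scaleR_diff_left)
  qed
  finally show ?thesis by (simp add: c_def scaleR_sum_right)
qed

lemma parseval: "(\<Sum>k<K. (norm (\<alpha> k))\<^sup>2 + (norm (\<beta> k))\<^sup>2) = real K * (\<Sum>i<2 * K. (norm (u i))\<^sup>2)"
proof -
  have cosd: "(\<Sum>k<K. cos (\<theta> k * real i) * cos (\<theta> k * real j) + sin (\<theta> k * real i) * sin (\<theta> k * real j))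
      = (if i = j then real K else 0)" if "i < 2 * K" "j < 2 * K" for i j
  proof -
    have eq: "(\<Sum>k<K. cos (\<theta> k * real i) * cos (\<theta> k * real j) + sin (\<theta> k * real i) * sin (\<theta> k * real j))
        = (\<Sum>k<K. cos (\<theta> k * (real i - real j)))" for i j
      by (simp add: right_diff_distrib cos_diff)
    show ?thesis
    proof (cases i j rule: linorder_cases)
      case less
      have "(\<Sum>k<K. cos (\<theta> k * (real i - real j))) = (\<Sum>k<K. cos (\<theta> k * real (j - i)))"
        using less by (intro sum.cong refl) (simp add: of_nat_diff right_diff_distrib cos_diff mult.commute)
      also have "\<dots> = 0" unfolding \<theta>_def by (rule sum_cos_odd_multiples) (use less that in auto)
      finally show ?thesis using less by (simp only: eq) simp
    next
      case greater
      have "(\<Sum>k<K. cos (\<theta> k * real (i - j))) = 0"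
        unfolding \<theta>_def by (rule sum_cos_odd_multiples) (use greater that in auto)
      then show ?thesis using greater by (simp only: eq) (simp add: of_nat_diff)
    qed (simp add: eq)
  qed
  have "(\<Sum>k<K. (norm (\<alpha> k))\<^sup>2 + (norm (\<beta> k))\<^sup>2)
      = (\<Sum>k<K. \<Sum>i<2 * K. \<Sum>j<2 * K. (cos (\<theta> k * real i) * cos (\<theta> k * real j) + sin (\<theta> k * real i) * sin (\<theta> k * real j)) * (u j \<bullet> u i))"
  proof (intro sum.cong refl)
    fix k
    show "(norm (\<alpha> k))\<^sup>2 + (norm (\<beta> k))\<^sup>2 = (\<Sum>i<2 * K. \<Sum>j<2 * K.
        (cos (\<theta> k * real i) * cos (\<theta> k * real j) + sin (\<theta> k * real i) * sin (\<theta> k * real j)) * (u j \<bullet> u i))"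
      unfolding distrib_right sum.distrib power2_norm_eq_inner \<alpha>_def \<beta>_def
      by (simp add: inner_sum_left inner_sum_right sum_distrib_left mult_ac)
  qed
  also have "\<dots> = (\<Sum>i<2 * K. \<Sum>j<2 * K. (\<Sum>k<K. cos (\<theta> k * real i) * cos (\<theta> k * real j) + sin (\<theta> k * real i) * sin (\<theta> k * real j)) * (u j \<bullet> u i))"
    unfolding sum_distrib_right by (rule sum_rotate)
  also have "\<dots> = (\<Sum>i<2 * K. \<Sum>j<2 * K. if j = i then real K * (u i \<bullet> u i) else 0)"
    by (intro sum.cong refl) (auto simp: cosd)
  also have "\<dots> = real K * (\<Sum>i<2 * K. (norm (u i))\<^sup>2)"
    by (simp add: power2_norm_eq_inner sum_distrib_left)
  finally show ?thesis .
qed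

text \<open>
  The estimate \<open>cot x \<le> 1 / x\<close> and the inequality of arithmetic and geometric means.
\<close>

lemma mode_bound:
  assumes k: "k < K"
  shows "norm ((cot (\<theta> k / 2) / real (2 * K)) *\<^sub>R \<alpha> k) * norm (\<beta> k) \<le> ((norm (\<alpha> k))\<^sup>2 + (norm (\<beta> k))\<^sup>2) / (pi * real (2 * k + 1))"
proof -
  have \<theta>: "0 < \<theta> k / 2" "\<theta> k / 2 < pi / 2" using \<theta>_bounds[OF k] by auto
  have "\<theta> k / 2 \<le> tan (\<theta> k / 2)" using le_tan[of "\<theta> k / 2"] \<theta> by simp
  then have "1 / tan (\<theta> k / 2) \<le> 1 / (\<theta> k / 2)" using \<theta> by (intro divide_left_mono) auto
  then have "cot (\<theta> k / 2) \<le> 2 / \<theta> k" by (simp add: tan_def cot_def)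
  then have "cot (\<theta> k / 2) / real (2 * K) \<le> (2 / \<theta> k) / real (2 * K)" by (rule divide_right_mono) simp
  also have "\<dots> = 2 / (pi * real (2 * k + 1))"
  proof -
    have cancel: "2 / (a / b) / b = 2 / a" if "b \<noteq> 0" for a b :: real using that by simp
    show ?thesis unfolding \<theta>_def by (rule cancel) (use K in simp)
  qed
  finally have c: "cot (\<theta> k / 2) / real (2 * K) \<le> 2 / (pi * real (2 * k + 1))" .
  have c0: "0 \<le> cot (\<theta> k / 2) / real (2 * K)"
    using sin_gt_zero[of "\<theta> k / 2"] cos_gt_zero[of "\<theta> k / 2"] \<theta> by (simp add: cot_def)
  have "norm ((cot (\<theta> k / 2) / real (2 * K)) *\<^sub>R \<alpha> k) * norm (\<beta> k) = (cot (\<theta> k / 2) / real (2 * K)) * (norm (\<alpha> k) * norm (\<beta> k))"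
    using abs_of_nonneg[OF c0] by (simp only: norm_scaleR mult.assoc)
  also have "\<dots> \<le> 2 / (pi * real (2 * k + 1)) * (((norm (\<alpha> k))\<^sup>2 + (norm (\<beta> k))\<^sup>2) / 2)"
    using sum_squares_bound[of "norm (\<alpha> k)" "norm (\<beta> k)"] by (intro mult_mono c) auto
  also have "\<dots> = ((norm (\<alpha> k))\<^sup>2 + (norm (\<beta> k))\<^sup>2) / (pi * real (2 * k + 1))"
  proof -
    have "2 / d * (s / 2) = s / d" for s d :: real by simp
    then show ?thesis .
  qed
  finally show ?thesis .
qed

end

section \<open>Areas of horizontal curves\<close>

lemma sum_weighted_tails: "(\<Sum>m<n. \<Sum>i\<in>{m..<n}. h i) = (\<Sum>i<n. real (Suc i) * h i)"
  for h :: "nat \<Rightarrow> real"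
proof (induction n)
  case (Suc n)
  have "(\<Sum>m<Suc n. \<Sum>i\<in>{m..<Suc n}. h i) = (\<Sum>m<n. \<Sum>i\<in>{m..<Suc n}. h i) + h n" by simp
  also have "(\<Sum>m<n. \<Sum>i\<in>{m..<Suc n}. h i) = (\<Sum>m<n. (\<Sum>i\<in>{m..<n}. h i) + h n)"
    by (intro sum.cong refl) (simp add: sum.atLeastLessThan_Suc)
  finally show ?case using Suc by (simp add: sum.distrib algebra_simps)
qed simp

text \<open>
  Summing the tail inequality over all \<open>m\<close> turns the factor \<open>1 / (2 k + 1)\<close> of the \<open>k\<close>-th mode
  into a bounded one.  The full sum \<open>\<Sum>k. k \<sigma> k\<close> is thereby controlled by the energy.
\<close>

lemma polygon_tails:
  fixes u :: "nat \<Rightarrow> 'a::{real_inner,banach}"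
  assumes nf: "skew_normal_form_block X \<sigma> e f n" and K: "0 < K"
    and u: "\<And>i. i < 2 * K \<Longrightarrow> norm (u i) \<le> L / real (2 * K)"
    and close: "norm (X - (1/2) *\<^sub>R (\<Sum>j<2 * K. \<Sum>i<j. wedge (u i) (u j))) \<le> \<epsilon>"
  shows "(\<Sum>i<n. real (Suc i) * \<sigma> i) \<le> L\<^sup>2 / (2 * pi) + (real n)\<^sup>2 * \<epsilon>"
proof -
  interpret skew_normal_form_block X \<sigma> e f n by (rule nf)
  interpret polygon u K by unfold_locales (rule K)
  define E where "E k = (norm (\<alpha> k))\<^sup>2 + (norm (\<beta> k))\<^sup>2" for k
  have E0: "0 \<le> E k" for k by (simp add: E_def)
  define B where "B k = E k / (pi * real (2 * k + 1))" for k
  have B0: "0 \<le> B k" for k by (simp add: B_def E0)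
  have tail: "(\<Sum>i\<in>{m..<n}. \<sigma> i) \<le> (\<Sum>k\<in>{m..<K}. B k) + real n * \<epsilon>" for m
  proof -
    have "(\<Sum>i\<in>{m..<n}. \<sigma> i)
        \<le> (\<Sum>k\<in>{m..<K}. norm ((cot (\<theta> k / 2) / real (2 * K)) *\<^sub>R \<alpha> k) * norm (\<beta> k)) + real n * \<epsilon>"
      by (rule tail_le) (simp only: area_expansion close)
    also have "(\<Sum>k\<in>{m..<K}. norm ((cot (\<theta> k / 2) / real (2 * K)) *\<^sub>R \<alpha> k) * norm (\<beta> k)) \<le> (\<Sum>k\<in>{m..<K}. B k)"
      unfolding B_def E_def by (intro sum_mono mode_bound) simp
    finally show ?thesis by simp
  qed
  have "(\<Sum>i<n. real (Suc i) * \<sigma> i) = (\<Sum>m<n. \<Sum>i\<in>{m..<n}. \<sigma> i)" by (rule sum_weighted_tails[symmetric])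
  also have "\<dots> \<le> (\<Sum>m<n. (\<Sum>k\<in>{m..<K}. B k) + real n * \<epsilon>)" by (intro sum_mono tail)
  also have "\<dots> = (\<Sum>m<n. \<Sum>k\<in>{m..<K}. B k) + (real n)\<^sup>2 * \<epsilon>" by (simp add: sum.distrib power2_eq_square)
  also have "(\<Sum>m<n. \<Sum>k\<in>{m..<K}. B k) \<le> (\<Sum>m<max n K. \<Sum>k\<in>{m..<K}. B k)"
    by (intro sum_mono2) (auto intro!: sum_nonneg B0)
  also have "\<dots> = (\<Sum>m<K. \<Sum>k\<in>{m..<K}. B k)"
    by (intro sum.mono_neutral_right) auto
  also have "\<dots> = (\<Sum>k<K. real (Suc k) * B k)" by (rule sum_weighted_tails)
  also have "\<dots> \<le> (\<Sum>k<K. E k / pi)"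
  proof (rule sum_mono)
    fix k
    have "real (Suc k) * E k \<le> real (2 * k + 1) * E k" by (intro mult_right_mono E0) simp
    then have "real (Suc k) * E k / (pi * real (2 * k + 1)) \<le> real (2 * k + 1) * E k / (pi * real (2 * k + 1))"
      by (rule divide_right_mono) simp
    also have "\<dots> = E k / pi" by simp
    finally show "real (Suc k) * B k \<le> E k / pi" by (simp add: B_def)
  qed
  also have "\<dots> = real K * (\<Sum>i<2 * K. (norm (u i))\<^sup>2) / pi"
    unfolding E_def sum_divide_distrib[symmetric] parseval ..
  also have "\<dots> \<le> real K * (\<Sum>i<2 * K. (L / real (2 * K))\<^sup>2) / pi"
    by (intro divide_right_mono mult_left_mono sum_mono power_mono u) auto
  also have "\<dots> = L\<^sup>2 / (2 * pi)" using K by (simp add: power2_eq_square field_simps)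
  finally show ?thesis by simp
qed

text \<open>
  The area is the limit of areas of inscribed polygons, so it is compact and skew-symmetric.  For
  each partial sum the polygon estimate is applied with finer and finer polygons; partial sums that
  end in vanishing singular values are reduced to shorter ones.
\<close>

lemma horizontal_area:
  assumes g: "horizontal L g"
  shows "compact_op (snd (g 1))" "skew (snd (g 1))" "cc_norm (snd (g 1)) \<le> ennreal (L\<^sup>2 / pi)"
proof -
  define X where "X = snd (g 1)"
  define u where "u K i = fst (g (real (Suc i) / real (2 * K))) - fst (g (real i / real (2 * K)))" for K i
  define A where "A K = (1/2) *\<^sub>R (\<Sum>j<2 * K. \<Sum>i<j. wedge (u K i) (u K j))" for K
  have close: "norm (X - A K) \<le> L\<^sup>2 / real (2 * K)" if K: "0 < K" for K
  proof -
    have x: "(\<Sum>i<j. u K i) = fst (g (real j / real (2 * K)))" for j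
      unfolding u_def by (subst sum_lessThan_telescope) (simp add: horizontalD(1)[OF g])
    have "A K = (1/2) *\<^sub>R (\<Sum>j<2 * K. wedge (fst (g (real j / real (2 * K)))) (u K j))"
      unfolding A_def x[symmetric] wedge_sum_left ..
    then show ?thesis using horizontal_polygon[OF g, of "2 * K"] K by (simp only: X_def u_def)
  qed
  have ue: "norm (u K i) \<le> L / real (2 * K)" if "0 < K" "i < 2 * K" for K i
  proof -
    have "real (Suc i) \<le> real (2 * K)" using that by (simp only: of_nat_le_iff Suc_le_eq)
    then have "increment (g (real i / real (2 * K))) (g (real (Suc i) / real (2 * K)))
        \<in> short (L * (real (Suc i) / real (2 * K) - real i / real (2 * K)))"
      using that by (intro horizontalD(2)[OF g]) (auto simp: divide_simps)
    also have "real (Suc i) / real (2 * K) - real i / real (2 * K) = 1 / real (2 * K)"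
      by (simp add: diff_divide_distrib[symmetric])
    finally show ?thesis by (simp add: short_def fst_increment u_def)
  qed
  have A_lim: "(\<lambda>K. A (Suc K)) \<longlonglongrightarrow> X"
  proof -
    have z: "(\<lambda>K. L\<^sup>2 / 2 * inverse (real (Suc K))) \<longlonglongrightarrow> 0"
      using tendsto_mult[OF tendsto_const LIMSEQ_inverse_real_of_nat, of "L\<^sup>2 / 2"] by simp
    have "norm (X - A (Suc K)) \<le> L\<^sup>2 / 2 * inverse (real (Suc K))" for K
      using close[of "Suc K"] by (simp add: field_simps)
    then have "(\<lambda>K. norm (X - A (Suc K))) \<longlonglongrightarrow> 0"
      by (intro tendsto_sandwich[OF always_eventually always_eventually tendsto_const z] allI norm_ge_zero)
    then have "(\<lambda>K. X - A (Suc K)) \<longlonglongrightarrow> 0" by (rule tendsto_norm_zero_cancel)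
    from tendsto_diff[OF tendsto_const this, of X] show ?thesis by simp
  qed
  show comp: "compact_op (snd (g 1))" unfolding X_def[symmetric]
    by (rule compact_op_limit[OF _ A_lim])
       (unfold A_def, intro compact_op_scaleR compact_op_sum compact_op_wedge)
  show sk: "skew (snd (g 1))" unfolding X_def[symmetric]
    by (rule skew_limit[OF _ A_lim]) (unfold A_def, intro skew_scaleR skew_sum skew_wedge)
  obtain \<sigma> e f where nf: "skew_normal_form X \<sigma> e f"
    using skew_normal_form_exists[OF comp sk] by (auto simp: X_def)
  then interpret skew_normal_form X \<sigma> e f .
  have "(\<Sum>i<n. real (Suc i) * \<sigma> i) \<le> L\<^sup>2 / (2 * pi)" for n
  proof (induction n)
    case (Suc n)
    show ?case
    proof (cases "\<sigma> n = 0")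
      case False
      have "0 < \<sigma> i" if "i < Suc n" for i
        using antimonoD[OF antimono, of i n] that False nonneg[of n] by simp
      then have block: "skew_normal_form_block X \<sigma> e f (Suc n)"
        by unfold_locales auto
      have "(\<Sum>i<Suc n. real (Suc i) * \<sigma> i) \<le> L\<^sup>2 / (2 * pi) + (real (Suc n))\<^sup>2 * (L\<^sup>2 / 2 * inverse (real (Suc K)))" for K
        using polygon_tails[OF block, of "Suc K" "u (Suc K)" L "L\<^sup>2 / real (2 * Suc K)"] ue[of "Suc K"] close[of "Suc K"]
        by (simp add: A_def field_simps)
      moreover have "(\<lambda>K. L\<^sup>2 / (2 * pi) + (real (Suc n))\<^sup>2 * (L\<^sup>2 / 2 * inverse (real (Suc K))))
          \<longlonglongrightarrow> L\<^sup>2 / (2 * pi) + (real (Suc n))\<^sup>2 * (L\<^sup>2 / 2 * 0)"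
        by (intro tendsto_intros LIMSEQ_inverse_real_of_nat)
      ultimately have "(\<Sum>i<Suc n. real (Suc i) * \<sigma> i) \<le> L\<^sup>2 / (2 * pi) + (real (Suc n))\<^sup>2 * (L\<^sup>2 / 2 * 0)"
        by (intro LIMSEQ_le_const) auto
      then show ?thesis by simp
    qed (use Suc in simp)
  qed simp
  moreover have "L\<^sup>2 / (2 * pi) \<le> L\<^sup>2 / pi" by (intro divide_left_mono) auto
  ultimately have "(\<Sum>i<n. real (Suc i) * \<sigma> i) \<le> L\<^sup>2 / pi" for n by (rule order_trans)
  then have "(\<Sum>i<n. ennreal (real (Suc i) * \<sigma> i)) \<le> ennreal (L\<^sup>2 / pi)" for n
    using nonneg by (subst sum_ennreal) (simp_all add: ennreal_leI)
  then show "cc_norm (snd (g 1)) \<le> ennreal (L\<^sup>2 / pi)"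
    unfolding X_def[symmetric] cc_norm_eq by (intro suminf_le_const) auto
qed

section \<open>Loops that realise a given area\<close>

lemma has_integral_cos_period: "((\<lambda>t. cos (2 * pi * of_int m * t)) has_integral (if m = 0 then 1 else 0)) {0..1::real}"
proof (cases "m = 0")
  case True
  then show ?thesis using has_integral_const_real[of "1::real" 0 1] by simp
next
  case False
  have "((\<lambda>t. cos (2 * pi * of_int m * t)) has_integral
      sin (2 * pi * of_int m * 1) / (2 * pi * of_int m) - sin (2 * pi * of_int m * 0) / (2 * pi * of_int m)) {0..1}"
  proof (rule fundamental_theorem_of_calculus)
    fix t :: real
    have "((\<lambda>t. sin (2 * pi * of_int m * t) / (2 * pi * of_int m)) has_real_derivative cos (2 * pi * of_int m * t)) (at t within {0..1})"
      using False by (auto intro!: derivative_eq_intros)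
    then show "((\<lambda>t. sin (2 * pi * of_int m * t) / (2 * pi * of_int m)) has_vector_derivative cos (2 * pi * of_int m * t)) (at t within {0..1})"
      by (simp add: has_real_derivative_iff_has_vector_derivative)
  qed simp
  moreover have "sin (2 * pi * of_int m) = 0" using sin_int_2pin[of m] by simp
  ultimately show ?thesis using False by simp
qed

lemma has_integral_sin_period: "((\<lambda>t. sin (2 * pi * of_int m * t)) has_integral 0) {0..1::real}"
proof (cases "m = 0")
  case True
  then show ?thesis by simp
next
  case False
  have "((\<lambda>t. sin (2 * pi * of_int m * t)) has_integral
      - cos (2 * pi * of_int m * 1) / (2 * pi * of_int m) - (- cos (2 * pi * of_int m * 0) / (2 * pi * of_int m))) {0..1}"
  proof (rule fundamental_theorem_of_calculus)
    fix t :: real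
    have "((\<lambda>t. - cos (2 * pi * of_int m * t) / (2 * pi * of_int m)) has_real_derivative sin (2 * pi * of_int m * t)) (at t within {0..1})"
      using False by (auto intro!: derivative_eq_intros)
    then show "((\<lambda>t. - cos (2 * pi * of_int m * t) / (2 * pi * of_int m)) has_vector_derivative sin (2 * pi * of_int m * t)) (at t within {0..1})"
      by (simp add: has_real_derivative_iff_has_vector_derivative)
  qed simp
  moreover have "cos (2 * pi * of_int m) = 1" using cos_int_2pin[of m] by simp
  ultimately show ?thesis by simp
qed

lemma continuous_imp_L1:
  assumes "continuous_on {0..1} u"
  shows "u \<in> L1"
proof -
  have "compact (u ` {0..1})" using assms by (rule compact_continuous_image) simp
  then have "bounded (u ` {0..1})" by (rule compact_imp_bounded)
  then obtain C where "\<forall>y\<in>u ` {0..1}. norm y \<le> C" unfolding bounded_iff by blast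
  then have C: "norm (u t) \<le> C" if "t \<in> {0..1}" for t using that by blast
  have sm: "strongly_measurable leb01 u" using assms by (rule strongly_measurable_continuous)
  have "integrable leb01 (\<lambda>t. norm (u t))"
    by (rule finite_measure.integrable_const_bound[OF finite_measure_leb01 _ strongly_measurable_norm[OF sm], of C])
       (use C in \<open>auto intro!: AE_I2\<close>)
  then show ?thesis using sm by (simp add: L1_def)
qed

context skew_normal_form
begin

definition \<omega> :: "nat \<Rightarrow> real" where "\<omega> j = 2 * pi * real (Suc j)"
definition radius :: "nat \<Rightarrow> real" where "radius j = sqrt (\<sigma> j / (pi * real (Suc j)))"
definition circle :: "nat \<Rightarrow> real \<Rightarrow> 'a" where
  "circle j t = cos (\<omega> j * t) *\<^sub>R e j + sin (\<omega> j * t) *\<^sub>R f j"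
definition circle' :: "nat \<Rightarrow> real \<Rightarrow> 'a" where
  "circle' j t = - sin (\<omega> j * t) *\<^sub>R e j + cos (\<omega> j * t) *\<^sub>R f j"

lemma circle_deriv: "(circle j has_vector_derivative \<omega> j *\<^sub>R circle' j t) (at t within S)"
  unfolding circle_def circle'_def
  by (auto intro!: derivative_eq_intros simp: has_vector_derivative_def algebra_simps)

lemma circle_period: "circle j 1 = circle j 0"
  using sin_int_2pin[of "int (Suc j)"] cos_int_2pin[of "int (Suc j)"]
  by (simp add: circle_def \<omega>_def)

text \<open>Circles run through at different frequencies sweep no area in the product of their planes.\<close>

lemma circle_area:
  "((\<lambda>t. wedge (circle j t) (circle' k t)) has_integral (if j = k then wedge (e j) (f j) else 0)) {0..1}"
proof -
  define p where "p = int j - int k"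
  define q where "q = int (Suc j) + int (Suc k)"
  have pq: "\<omega> j - \<omega> k = 2 * pi * of_int p" "\<omega> j + \<omega> k = 2 * pi * of_int q"
    by (simp_all add: \<omega>_def p_def q_def algebra_simps)
  have angles: "\<omega> j * t - \<omega> k * t = 2 * pi * of_int p * t" "\<omega> j * t + \<omega> k * t = 2 * pi * of_int q * t" for t
    by (simp_all only: pq[symmetric] left_diff_distrib distrib_right)
  have q0: "q \<noteq> 0" by (simp add: q_def)
  define \<delta> where "\<delta> = (if j = k then 1/2 else 0 :: real)"
  have p0: "p = 0 \<longleftrightarrow> j = k" by (simp add: p_def)
  note cosp = has_integral_cos_period[of p] and cosq = has_integral_cos_period[of q]
    and sinp = has_integral_sin_period[of p] and sinq = has_integral_sin_period[of q]
  have cc: "((\<lambda>t. cos (\<omega> j * t) * cos (\<omega> k * t)) has_integral \<delta>) {0..1}"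
    using has_integral_mult_right[OF has_integral_add[OF cosp cosq], of "1/2"] q0 p0
    by (simp add: \<delta>_def cos_times_cos angles split: if_splits)
  have ss: "((\<lambda>t. sin (\<omega> j * t) * sin (\<omega> k * t)) has_integral \<delta>) {0..1}"
    using has_integral_mult_right[OF has_integral_diff[OF cosp cosq], of "1/2"] q0 p0
    by (simp add: \<delta>_def sin_times_sin angles split: if_splits)
  have sc: "((\<lambda>t. sin (\<omega> j * t) * cos (\<omega> k * t)) has_integral 0) {0..1}"
    using has_integral_mult_right[OF has_integral_add[OF sinq sinp], of "1/2"]
    by (simp add: sin_times_cos angles)
  have cs: "((\<lambda>t. cos (\<omega> j * t) * sin (\<omega> k * t)) has_integral 0) {0..1}"
    using has_integral_mult_right[OF has_integral_diff[OF sinq sinp], of "1/2"]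
    by (simp add: cos_times_sin angles)
  have "((\<lambda>t. (cos (\<omega> j * t) * cos (\<omega> k * t)) *\<^sub>R wedge (e j) (f k) - (cos (\<omega> j * t) * sin (\<omega> k * t)) *\<^sub>R wedge (e j) (e k)
      + ((sin (\<omega> j * t) * cos (\<omega> k * t)) *\<^sub>R wedge (f j) (f k) - (sin (\<omega> j * t) * sin (\<omega> k * t)) *\<^sub>R wedge (f j) (e k)))
      has_integral (\<delta> *\<^sub>R wedge (e j) (f k) - 0 *\<^sub>R wedge (e j) (e k)) + (0 *\<^sub>R wedge (f j) (f k) - \<delta> *\<^sub>R wedge (f j) (e k))) {0..1}"
    by (intro has_integral_add has_integral_diff has_integral_scaleR_left cc cs sc ss)
  moreover have "(\<delta> *\<^sub>R wedge (e j) (f k) - 0 *\<^sub>R wedge (e j) (e k)) + (0 *\<^sub>R wedge (f j) (f k) - \<delta> *\<^sub>R wedge (f j) (e k))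
      = (if j = k then wedge (e j) (f j) else 0)"
    using wedge_swap[of "f j" "e j"] by (auto simp: \<delta>_def scaleR_add_left[symmetric])
  moreover have "wedge (circle j t) (circle' k t)
      = (cos (\<omega> j * t) * cos (\<omega> k * t)) *\<^sub>R wedge (e j) (f k) - (cos (\<omega> j * t) * sin (\<omega> k * t)) *\<^sub>R wedge (e j) (e k)
      + ((sin (\<omega> j * t) * cos (\<omega> k * t)) *\<^sub>R wedge (f j) (f k) - (sin (\<omega> j * t) * sin (\<omega> k * t)) *\<^sub>R wedge (f j) (e k))" for t
    by (simp add: circle_def circle'_def wedge_add_left wedge_add_right wedge_diff_right wedge_scaleR_left wedge_scaleR_right wedge_minus_right
        scaleR_diff_right scaleR_add_right algebra_simps)
  ultimately show ?thesis by simp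
qed

text \<open>
  The loop runs \<open>Suc j\<close> times through a circle of area \<open>\<sigma> j / Suc j\<close> in the \<open>j\<close>-th plane, so that
  the largest areas are swept at the lowest frequencies.  By orthogonality its speed is constant.
\<close>

lemma loop_cc_dist0_le:
  "cc_dist0 (0, part n) \<le> ennreal (sqrt (4 * pi * (\<Sum>j<n. real (Suc j) * \<sigma> j)))"
proof -
  define x where "x t = (\<Sum>j<n. radius j *\<^sub>R circle j t)" for t
  define u where "u t = (\<Sum>j<n. (radius j * \<omega> j) *\<^sub>R circle' j t)" for t
  have rad: "(radius j)\<^sup>2 * \<omega> j = 2 * \<sigma> j" for j
  proof -
    have "\<sigma> j / (pi * s) * (2 * pi * s) = 2 * \<sigma> j" if "0 < s" for s using that by (simp add: field_simps)
    from this[of "real (Suc j)"] show ?thesis using nonneg[of j] by (simp add: radius_def \<omega>_def)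
  qed
  have deriv: "(x has_vector_derivative u t) (at t within S)" for t S
    unfolding x_def u_def
  proof (rule has_vector_derivative_sum)
    fix j
    show "((\<lambda>t. radius j *\<^sub>R circle j t) has_vector_derivative (radius j * \<omega> j) *\<^sub>R circle' j t) (at t within S)"
      using bounded_linear.has_vector_derivative[OF bounded_linear_scaleR_right[of "radius j"] circle_deriv[of j t S]]
      by simp
  qed
  have cont: "continuous_on {0..1} u"
    unfolding u_def circle'_def by (intro continuous_intros)
  have u: "u \<in> L1" by (rule continuous_imp_L1[OF cont])
  have G1: "Gamma1 u t = x t - x 0" if "0 \<le> t" for t
    unfolding Gamma1_def
    by (rule integral_unique) (rule fundamental_theorem_of_calculus[OF that deriv])
  have x1: "x 1 = x 0" by (simp add: x_def circle_period)
  have u0: "(u has_integral 0) {0..1}"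
    using fundamental_theorem_of_calculus[of 0 1 x u] deriv x1 by simp
  have "((\<lambda>t. \<Sum>j<n. \<Sum>k<n. (radius j * (radius k * \<omega> k)) *\<^sub>R wedge (circle j t) (circle' k t))
      has_integral (\<Sum>j<n. \<Sum>k<n. (radius j * (radius k * \<omega> k)) *\<^sub>R (if j = k then wedge (e j) (f j) else 0))) {0..1}"
    by (intro has_integral_sum has_integral_cmul circle_area finite_lessThan)
  moreover have "(\<Sum>k<n. (radius j * (radius k * \<omega> k)) *\<^sub>R (if j = k then wedge (e j) (f j) else 0)) = (2 * \<sigma> j) *\<^sub>R wedge (e j) (f j)"
    if "j < n" for j
  proof -
    have "(\<Sum>k<n. (radius j * (radius k * \<omega> k)) *\<^sub>R (if j = k then wedge (e j) (f j) else 0))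
        = (\<Sum>k<n. if k = j then ((radius j)\<^sup>2 * \<omega> j) *\<^sub>R wedge (e j) (f j) else 0)"
      by (intro sum.cong refl) (auto simp: power2_eq_square mult.assoc)
    then show ?thesis using that by (simp add: rad)
  qed
  moreover have "wedge (x t) (u t) = (\<Sum>j<n. \<Sum>k<n. (radius j * (radius k * \<omega> k)) *\<^sub>R wedge (circle j t) (circle' k t))" for t
    unfolding x_def wedge_sum_left
    by (simp add: u_def wedge_sum_right wedge_scaleR_left wedge_scaleR_right scaleR_sum_right mult_ac)
  ultimately have "((\<lambda>t. wedge (x t) (u t)) has_integral (\<Sum>j<n. (2 * \<sigma> j) *\<^sub>R wedge (e j) (f j))) {0..1}" by simp
  moreover have "((\<lambda>t. wedge (x 0) (u t)) has_integral wedge (x 0) 0) {0..1}"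
    using has_integral_linear[OF u0 bounded_bilinear.bounded_linear_right[OF bounded_bilinear_wedge, of "x 0"]]
    by (simp add: o_def)
  ultimately have "((\<lambda>t. wedge (x t) (u t) - wedge (x 0) (u t)) has_integral (\<Sum>j<n. (2 * \<sigma> j) *\<^sub>R wedge (e j) (f j)) - wedge (x 0) 0) {0..1}"
    by (rule has_integral_diff)
  moreover have "wedge (Gamma1 u t) (u t) = wedge (x t) (u t) - wedge (x 0) (u t)" if "t \<in> {0..1}" for t
    using that by (simp add: G1 wedge_diff_left)
  ultimately have "((\<lambda>t. wedge (Gamma1 u t) (u t)) has_integral (\<Sum>j<n. (2 * \<sigma> j) *\<^sub>R wedge (e j) (f j))) {0..1}"
    using has_integral_cong[of "{0..1}" "\<lambda>t. wedge (Gamma1 u t) (u t)"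
        "\<lambda>t. wedge (x t) (u t) - wedge (x 0) (u t)"] by simp
  then have "Gamma2 u 1 = part n"
    by (simp add: Gamma2_def integral_unique part_def scaleR_sum_right)
  then have end_point: "Gamma u 1 = (0, part n)" by (simp add: Gamma_def G1 x1)
  have speed: "norm (u t) \<le> sqrt (4 * pi * (\<Sum>j<n. real (Suc j) * \<sigma> j))" for t
  proof (rule real_le_rsqrt)
    have "u t = (\<Sum>j<n. (- (radius j * \<omega> j) * sin (\<omega> j * t)) *\<^sub>R e j + (radius j * \<omega> j * cos (\<omega> j * t)) *\<^sub>R f j)"
      by (simp add: u_def circle'_def scaleR_add_right scaleR_diff_right)
    then have "(norm (u t))\<^sup>2 \<le> (\<Sum>j<n. (- (radius j * \<omega> j) * sin (\<omega> j * t))\<^sup>2 + (radius j * \<omega> j * cos (\<omega> j * t))\<^sup>2)"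
      by (simp only: norm_frame_sum_le[OF finite_lessThan])
    also have "\<dots> = (\<Sum>j<n. (radius j)\<^sup>2 * \<omega> j * \<omega> j)"
    proof (intro sum.cong refl)
      fix j
      have "(- (radius j * \<omega> j) * sin (\<omega> j * t))\<^sup>2 + (radius j * \<omega> j * cos (\<omega> j * t))\<^sup>2
          = (radius j * \<omega> j)\<^sup>2 * ((sin (\<omega> j * t))\<^sup>2 + (cos (\<omega> j * t))\<^sup>2)"
        by (simp only: power_mult_distrib power2_minus distrib_left)
      also have "\<dots> = (radius j)\<^sup>2 * \<omega> j * \<omega> j"
        unfolding sin_cos_squared_add by (simp add: power2_eq_square mult_ac)
      finally show "(- (radius j * \<omega> j) * sin (\<omega> j * t))\<^sup>2 + (radius j * \<omega> j * cos (\<omega> j * t))\<^sup>2 = (radius j)\<^sup>2 * \<omega> j * \<omega> j" .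
    qed
    also have "\<dots> = 4 * pi * (\<Sum>j<n. real (Suc j) * \<sigma> j)"
      unfolding rad by (simp add: \<omega>_def sum_distrib_left mult_ac)
    finally show "(norm (u t))\<^sup>2 \<le> 4 * pi * (\<Sum>j<n. real (Suc j) * \<sigma> j)" .
  qed
  have "L1_norm u \<le> integral {0..1::real} (\<lambda>t. sqrt (4 * pi * (\<Sum>j<n. real (Suc j) * \<sigma> j)))"
    unfolding L1_norm_eq[OF u] by (rule integral_le) (use L1_integrable[OF u] speed in auto)
  then have "L1_norm u \<le> sqrt (4 * pi * (\<Sum>j<n. real (Suc j) * \<sigma> j))" by simp
  then have "ennreal (L1_norm u) \<le> ennreal (sqrt (4 * pi * (\<Sum>j<n. real (Suc j) * \<sigma> j)))" by (rule ennreal_leI)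
  then show ?thesis
    unfolding cc_dist0_def by (intro INF_lower2[of u]) (use u end_point in auto)
qed

end

text \<open>
  The loops for the partial sums of the normal form have uniformly bounded length; by
  semicontinuity the bound passes to their limit.
\<close>

lemma cc_dist0_vertical_le:
  fixes X :: "'a::{real_inner,banach} \<Rightarrow>\<^sub>L 'a"
  assumes X: "X \<in> so_cc"
  shows "cc_dist0 (0, X) \<le> ennreal (2 * (sqrt pi * sqrt (enn2real (cc_norm X))))"
proof -
  define c where "c = enn2real (cc_norm X)"
  obtain \<sigma> e f where "skew_normal_form X \<sigma> e f"
    using skew_normal_form_exists[of X] X by (auto simp: so_cc_def)
  then interpret skew_normal_form X \<sigma> e f .
  have c: "cc_norm X = ennreal c" using X by (simp add: so_cc_def c_def)
  have partial: "(\<Sum>j<n. real (Suc j) * \<sigma> j) \<le> c" for n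
  proof -
    have "(\<Sum>j<n. ennreal (real (Suc j) * \<sigma> j)) \<le> ennreal c"
      unfolding c[symmetric] cc_norm_eq by (rule sum_le_suminf) auto
    then show ?thesis
      by (subst (asm) sum_ennreal) (simp_all add: nonneg c_def)
  qed
  have "\<exists>g. horizontal (2 * (sqrt pi * sqrt c)) g \<and> g 1 = (0, part n)" for n
  proof -
    have "sqrt (4 * pi * (\<Sum>j<n. real (Suc j) * \<sigma> j)) \<le> sqrt (4 * pi * c)"
      using partial[of n] by (intro real_sqrt_le_mono mult_left_mono) auto
    also have "\<dots> = 2 * (sqrt pi * sqrt c)" by (simp add: real_sqrt_mult)
    finally have "cc_dist0 (0, part n) \<le> ennreal (2 * (sqrt pi * sqrt c))"
      using loop_cc_dist0_le[of n] by (intro order_trans[OF loop_cc_dist0_le] ennreal_leI)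
    then obtain g where "horizontal (2 * (sqrt pi * sqrt c)) g" "g 1 = (0, part n)"
      by (rule cc_dist0_le_imp_horizontal) (simp add: c_def)
    then show ?thesis by blast
  qed
  then obtain g where g: "\<And>n. horizontal (2 * (sqrt pi * sqrt c)) (g n)" "\<And>n. g n 1 = (0, part n)" by metis
  have "(\<lambda>n. g n 1) \<longlonglongrightarrow> (0, X)" unfolding g(2) by (intro tendsto_intros part_lim)
  then obtain h where "horizontal (2 * (sqrt pi * sqrt c)) h" "h 1 = (0, X)"
    by (rule horizontal_limit[OF g(1) tendsto_const])
  then show ?thesis using horizontal_imp_cc_dist0_le by (metis c_def)
qed

lemma cc_dist0_line_le: "cc_dist0 (x, 0) \<le> ennreal (norm x)"
proof -
  have "horizontal (norm x) (\<lambda>t. (t *\<^sub>R x, 0))"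
    unfolding horizontal_def
  proof (intro conjI allI impI)
    fix s t :: real assume st: "0 \<le> s \<and> s \<le> t \<and> t \<le> 1"
    have "norm (t *\<^sub>R x - s *\<^sub>R x) = (t - s) * norm x"
      using st by (simp add: scaleR_diff_left[symmetric])
    then show "increment (s *\<^sub>R x, 0) (t *\<^sub>R x, 0) \<in> short (norm x * (t - s))"
      by (simp add: short_def fst_increment snd_increment wedge_scaleR_left wedge_scaleR_right mult.commute)
  qed (simp add: zero_prod_def)
  from horizontal_imp_cc_dist0_le[OF this] show ?thesis by simp
qed

text \<open>
  A loop with the required area, followed by a segment.
\<close>

lemma cc_dist0_le_hom_norm:
  assumes "x \<in> G2cc"
  shows "cc_dist0 x \<le> 3 * ennreal (hom_norm x)"
proof -
  obtain a X where x: "x = (a, X)" by (cases x)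
  have X: "X \<in> so_cc" using assms by (simp add: G2cc_def x)
  define v where "v = sqrt pi * sqrt (enn2real (cc_norm X))"
  have v0: "0 \<le> v" by (simp add: v_def)
  have "x = g2_mult (0, X) (a, 0)" by (simp add: x g2_mult_def)
  then have "cc_dist0 x \<le> cc_dist0 (0, X) + cc_dist0 (a, 0)" using cc_dist0_triangle by metis
  also have "\<dots> \<le> ennreal (2 * v) + ennreal (norm a)"
    unfolding v_def by (intro add_mono cc_dist0_vertical_le X cc_dist0_line_le)
  also have "\<dots> = ennreal (2 * v + norm a)" using v0 by (simp add: ennreal_plus)
  also have "\<dots> \<le> ennreal (3 * hom_norm x)"
    by (intro ennreal_leI) (simp add: hom_norm_def x v_def[symmetric])
  also have "\<dots> = 3 * ennreal (hom_norm x)" 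
    by (subst ennreal_mult) (auto simp: hom_norm_def intro: max.coboundedI1)
  finally show ?thesis .
qed

section \<open>Finite rank operators and the tensor norm\<close>

lemma finite_rank_0: "finite_rank 0"
  by (auto simp: finite_rank_def intro!: exI[of _ "{}"])

lemma finite_rank_add:
  assumes "finite_rank S" "finite_rank T"
  shows "finite_rank (S + T)"
proof -
  obtain A B where AB: "finite A" "range (S) \<subseteq> span A" "finite B" "range (T) \<subseteq> span B"
    using assms by (auto simp: finite_rank_def)
  then have "(S + T) v \<in> span (A \<union> B)" for v
    using span_mono[of A "A \<union> B"] span_mono[of B "A \<union> B"]
    by (auto simp: blinfun.add_left intro!: span_add)
  then show ?thesis using AB unfolding finite_rank_def by (intro exI[of _ "A \<union> B"]) auto
qed

lemma finite_rank_scaleR: "finite_rank T \<Longrightarrow> finite_rank (c *\<^sub>R T)"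
  unfolding finite_rank_def by (auto simp: blinfun.scaleR_left image_subset_iff intro!: span_scale)

lemma finite_rank_tensor: "finite_rank (tensor x y)"
  unfolding finite_rank_def
  by (intro exI[of _ "{y}"]) (auto simp: tensor_apply intro: span_scale span_base)

lemma finite_rank_wedge: "finite_rank (wedge x y)"
  using finite_rank_add[OF finite_rank_tensor[of x y] finite_rank_scaleR[OF finite_rank_tensor[of y x], of "-1"]]
  by (simp add: wedge_def)

lemma finite_rank_sum: "(\<And>i. i \<in> I \<Longrightarrow> finite_rank (T i)) \<Longrightarrow> finite_rank (\<Sum>i\<in>I. T i)"
  by (induction I rule: infinite_finite_induct) (auto intro: finite_rank_0 finite_rank_add)

locale tensor_norm =
  fixes N :: "('a::{real_inner,banach} \<Rightarrow>\<^sub>L 'a) \<Rightarrow> real"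
  assumes norm: "norm_on_finite_rank N" and tensor: "\<And>x y. N (tensor x y) \<le> norm x * norm y"
begin

lemma scaleR: "finite_rank T \<Longrightarrow> N (c *\<^sub>R T) = \<bar>c\<bar> * N T"
  and triangle: "finite_rank S \<Longrightarrow> finite_rank T \<Longrightarrow> N (S + T) \<le> N S + N T"
  and zero: "N 0 = 0"
  using norm finite_rank_0 by (auto simp: norm_on_finite_rank_def)

lemma wedge_le: "N (wedge x y) \<le> 2 * norm x * norm y"
proof -
  have "N (wedge x y) = N (tensor x y + (-1) *\<^sub>R tensor y x)" by (simp add: wedge_def)
  also have "\<dots> \<le> N (tensor x y) + N ((-1) *\<^sub>R tensor y x)"
    by (intro triangle finite_rank_scaleR finite_rank_tensor)
  also have "\<dots> \<le> norm x * norm y + norm y * norm x"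
    using tensor[of x y] tensor[of y x] scaleR[OF finite_rank_tensor[of y x], of "-1"]
    by (simp add: mult.commute[of "norm y"])
  finally show ?thesis by (simp add: mult.commute[of "norm y"])
qed

lemma sum_le: "(\<And>i. i \<in> I \<Longrightarrow> finite_rank (T i)) \<Longrightarrow> N (\<Sum>i\<in>I. T i) \<le> (\<Sum>i\<in>I. N (T i))"
proof (induction I rule: infinite_finite_induct)
  case (insert i I)
  then have "N (T i + (\<Sum>i\<in>I. T i)) \<le> N (T i) + N (\<Sum>i\<in>I. T i)"
    by (intro triangle finite_rank_sum) auto
  also have "N (\<Sum>i\<in>I. T i) \<le> (\<Sum>i\<in>I. N (T i))" using insert by simp
  finally show ?case using insert by simp
qed (simp_all add: zero)

text \<open>
  Finiteness of \<open>\<Sum>j. j \<sigma> j\<close> makes the \<open>\<sigma> j\<close> summable, so the normal form converges absolutely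
  in every tensor norm for which elementary tensors have norm at most \<open>\<parallel>x\<parallel> \<parallel>y\<parallel>\<close>.
\<close>

lemma so_cc_subset: "so_cc \<subseteq> so_tensor N"
proof
  fix X :: "'a \<Rightarrow>\<^sub>L 'a" assume X: "X \<in> so_cc"
  obtain \<sigma> e f where "skew_normal_form X \<sigma> e f"
    using skew_normal_form_exists[of X] X by (auto simp: so_cc_def)
  then interpret skew_normal_form X \<sigma> e f .
  have term_fr: "finite_rank (\<sigma> m *\<^sub>R wedge (e m) (f m))" for m
    by (intro finite_rank_scaleR finite_rank_wedge)
  have ef_le: "norm (e m) \<le> 1" "norm (f m) \<le> 1" for m
    using ee[of m m] ff[of m m] by (auto simp: norm_eq_sqrt_inner)
  have "(\<Sum>j. ennreal (real (Suc j) * \<sigma> j)) \<noteq> top"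
    using X by (simp add: so_cc_def cc_norm_eq less_top)
  then have "summable (\<lambda>j. real (Suc j) * \<sigma> j)"
    by (rule summable_suminf_not_top[rotated]) (simp add: nonneg)
  then have "summable \<sigma>"
  proof (rule summable_comparison_test')
    show "norm (\<sigma> j) \<le> real (Suc j) * \<sigma> j" if "0 \<le> j" for j
      using nonneg[of j] mult_right_mono[of 1 "real (Suc j)" "\<sigma> j"] by simp
  qed
  then have S: "Cauchy (\<lambda>n. \<Sum>m<n. \<sigma> m)" by (simp add: summable_iff_convergent convergent_Cauchy)
  have part_diff: "N (part q - part p) \<le> 2 * ((\<Sum>m<q. \<sigma> m) - (\<Sum>m<p. \<sigma> m))" if "p \<le> q" for p q
  proof -
    have "part q - part p = (\<Sum>m\<in>{p..<q}. \<sigma> m *\<^sub>R wedge (e m) (f m))"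
      using that by (simp add: part_def lessThan_atLeast0 sum_diff_nat_ivl)
    then have "N (part q - part p) \<le> (\<Sum>m\<in>{p..<q}. N (\<sigma> m *\<^sub>R wedge (e m) (f m)))"
      using sum_le[OF term_fr] by simp
    also have "\<dots> \<le> (\<Sum>m\<in>{p..<q}. \<sigma> m * 2)"
    proof (rule sum_mono)
      fix m
      have "norm (e m) * norm (f m) \<le> 1 * 1" by (intro mult_mono ef_le) auto
      then have "N (wedge (e m) (f m)) \<le> 2" using wedge_le[of "e m" "f m"] by simp
      then have "\<sigma> m * N (wedge (e m) (f m)) \<le> \<sigma> m * 2" by (rule mult_left_mono[OF _ nonneg])
      then show "N (\<sigma> m *\<^sub>R wedge (e m) (f m)) \<le> \<sigma> m * 2"
        using nonneg[of m] by (simp add: scaleR finite_rank_wedge)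
    qed
    also have "\<dots> = 2 * ((\<Sum>m<q. \<sigma> m) - (\<Sum>m<p. \<sigma> m))"
      using that by (simp add: lessThan_atLeast0 sum_diff_nat_ivl sum_distrib_right[symmetric] mult.commute)
    finally show ?thesis .
  qed
  have part_fr: "finite_rank (part n)" for n unfolding part_def by (intro finite_rank_sum term_fr)
  have N_commute: "N (part p - part q) = N (part q - part p)" for p q
    using scaleR[of "part q - part p" "-1"] finite_rank_add[OF part_fr finite_rank_scaleR[OF part_fr, of "-1"]]
    by simp
  have "\<exists>k. \<forall>m\<ge>k. \<forall>n\<ge>k. N (part m - part n) < c" if c: "0 < c" for c
  proof -
    obtain k where k: "\<And>p q. p \<ge> k \<Longrightarrow> q \<ge> k \<Longrightarrow> norm ((\<Sum>m<p. \<sigma> m) - (\<Sum>m<q. \<sigma> m)) < c / 2"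
      using CauchyD[OF S, of "c / 2"] c by auto
    have up: "N (part q - part p) < c" if "p \<ge> k" "q \<ge> k" "p \<le> q" for p q
    proof -
      have "(\<Sum>m<q. \<sigma> m) - (\<Sum>m<p. \<sigma> m) < c / 2"
        by (rule le_less_trans[OF abs_ge_self k[OF that(2,1), unfolded real_norm_def]])
      then have "2 * ((\<Sum>m<q. \<sigma> m) - (\<Sum>m<p. \<sigma> m)) < c" by simp
      with part_diff[OF that(3)] show ?thesis by (rule le_less_trans)
    qed
    have "N (part p - part q) < c" if "p \<ge> k" "q \<ge> k" for p q
      using up[of p q] up[of q p] N_commute[of p q] that by (cases "p \<le> q") auto
    then show ?thesis by blast
  qed
  moreover have "finite_rank (part n) \<and> skew (part n)" for n
    using part_fr by (auto simp: part_def intro!: skew_sum skew_scaleR skew_wedge)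
  ultimately have "X \<in> tensor_closure N {F. finite_rank F \<and> skew F}"
    unfolding tensor_closure_def using part_lim by blast
  then show "X \<in> so_tensor N" using X by (simp add: so_tensor_def so_cc_def)
qed

end

section \<open>Points at finite distance\<close>

lemma finite_part_imp:
  assumes x: "x \<in> finite_part"
  shows "x \<in> G2cc" "ennreal (hom_norm x) \<le> cc_dist 0 x"
proof -
  have "cc_dist 0 x < \<infinity>" using x by (simp only: finite_part_def mem_Collect_eq)
  then obtain L where L: "0 \<le> L" "cc_dist 0 x = ennreal L" by (rule ennreal_finite_cases)
  obtain g where g: "horizontal L g" "g 1 = x"
    by (rule cc_dist0_le_imp_horizontal[of x L]) (use L in \<open>auto simp: cc_dist_zero_left\<close>)
  have area: "cc_norm (snd x) \<le> ennreal (L\<^sup>2 / pi)" using horizontal_area(3)[OF g(1)] g(2) by simp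
  then show "x \<in> G2cc"
    using horizontal_area(1,2)[OF g(1)] g(2) by (auto simp: G2cc_def so_cc_def mem_Times_iff intro: le_less_trans)
  have "enn2real (cc_norm (snd x)) \<le> L\<^sup>2 / pi" by (rule enn2real_leI[OF _ area]) simp
  then have "pi * enn2real (cc_norm (snd x)) \<le> L\<^sup>2" by (simp add: pos_le_divide_eq mult.commute)
  then have "sqrt (pi * enn2real (cc_norm (snd x))) \<le> L" using L(1) by (rule real_le_lsqrt[rotated])
  moreover have "norm (fst x) \<le> L" using horizontal_end[OF g(1)] g(2) by (simp add: short_def)
  ultimately have "hom_norm x \<le> L" by (simp add: hom_norm_def real_sqrt_mult)
  then show "ennreal (hom_norm x) \<le> cc_dist 0 x" unfolding L(2) by (rule ennreal_leI)
qed

lemma finite_part_eq: "(finite_part :: ('a::{real_inner,banach} \<times> ('a \<Rightarrow>\<^sub>L 'a)) set) = G2cc"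
    (is "?F = ?G")
proof
  show "?G \<subseteq> ?F"
  proof
    fix x :: "'a \<times> ('a \<Rightarrow>\<^sub>L 'a)" assume "x \<in> G2cc"
    then have "cc_dist0 x \<le> 3 * ennreal (hom_norm x)" by (rule cc_dist0_le_hom_norm)
    also have "\<dots> < \<infinity>" by (simp add: ennreal_mult_less_top)
    finally show "x \<in> finite_part" by (simp add: finite_part_def cc_dist_zero_left)
  qed
qed (use finite_part_imp in blast)

theorem theorem5p3:
  fixes N :: "('a::{real_inner,banach} \<Rightarrow>\<^sub>L 'a) \<Rightarrow> real"
  assumes "norm_on_finite_rank N"
    and "\<And>x y. N (tensor x y) \<le> norm x * norm y"
    and "\<And>x y. N (tensor x y) = N (tensor y x)"
    and "\<And>T. finite_rank T \<Longrightarrow> norm T \<le> N T"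
  shows "G2cc = {x \<in> G2 N. cc_dist 0 x < \<infinity>} \<and>
         (\<forall>x\<in>G2cc. \<forall>y\<in>(G2cc :: ('a \<times> ('a \<Rightarrow>\<^sub>L 'a)) set). cc_dist x y < \<infinity>) \<and>
         Metric_space G2cc (cc_metric :: 'a \<times> ('a \<Rightarrow>\<^sub>L 'a) \<Rightarrow> _) \<and>
         Metric_space.mcomplete G2cc (cc_metric :: 'a \<times> ('a \<Rightarrow>\<^sub>L 'a) \<Rightarrow> _) \<and>
         geodesic_space G2cc (cc_metric :: 'a \<times> ('a \<Rightarrow>\<^sub>L 'a) \<Rightarrow> _) \<and>
         (\<forall>x \<in> (G2cc :: ('a \<times> ('a \<Rightarrow>\<^sub>L 'a)) set).
            ennreal (hom_norm x) \<le> cc_dist 0 x \<and> cc_dist 0 x \<le> 3 * ennreal (hom_norm x))"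
proof (intro conjI ballI)
  interpret tensor_norm N by unfold_locales (rule assms)+
  have "G2cc \<subseteq> G2 N" unfolding G2cc_def G2_def using so_cc_subset by blast
  then show "G2cc = {x \<in> G2 N. cc_dist 0 x < \<infinity>}"
    unfolding finite_part_eq[symmetric] by (auto simp: finite_part_def)
  fix x y :: "'a \<times> ('a \<Rightarrow>\<^sub>L 'a)" assume "x \<in> G2cc" "y \<in> G2cc"
  then show "cc_dist x y < \<infinity>" by (intro cc_dist_finite) (simp_all add: finite_part_eq)
next
  show "Metric_space G2cc (cc_metric :: 'a \<times> ('a \<Rightarrow>\<^sub>L 'a) \<Rightarrow> _)"
    using Metric_space_finite_part by (simp only: finite_part_eq)
  show "Metric_space.mcomplete G2cc (cc_metric :: 'a \<times> ('a \<Rightarrow>\<^sub>L 'a) \<Rightarrow> _)"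
    using mcomplete_finite_part by (simp only: finite_part_eq)
  show "geodesic_space G2cc (cc_metric :: 'a \<times> ('a \<Rightarrow>\<^sub>L 'a) \<Rightarrow> _)"
    using geodesic_space_finite_part by (simp only: finite_part_eq)
next
  fix x :: "'a \<times> ('a \<Rightarrow>\<^sub>L 'a)" assume x: "x \<in> G2cc"
  then show "ennreal (hom_norm x) \<le> cc_dist 0 x"
    using finite_part_imp(2) by (simp add: finite_part_eq)
  show "cc_dist 0 x \<le> 3 * ennreal (hom_norm x)"
    using cc_dist0_le_hom_norm[OF x] by (simp add: cc_dist_zero_left)
qed

end
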